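(* Let $M\in\mathbb{N}^*$ be a positive integer. There exists a $G$-function which is not an element of the field $\mathcal{F}_M$ of rational functions with coefficients in $\overline{\mathbb{C}(x)}$ of solutions of differential equations of the form ${}_p\mathcal{H}_{p-1}[\underline{a};\underline{b};\lambda]$, with $p\ge1$, $a_j\in\mathbb{C}$, $b_j\in\mathbb{C}\setminus\mathbb{Z}_{\le0}$, and $\lambda\in\mathbb{C}(x)$ with numerator and denominator of degree less than $M$.
   Context: $\overline{\mathbb{Q}}\subset\mathbb{C}$ is the field of algebraic numbers. A $G$-function is a power series $F(x)=\sum_{n\ge0}a_nx^n\in\overline{\mathbb{Q}}[[x]]$ such that: (i) $F$ is a solution of a non-zero linear differential equation with coefficients in $\overline{\mathbb{Q}}(x)$; (ii) there is $C>0$ such that $|\sigma(a_n)|\le C^{n+1}$ for all $\sigma\in\mathrm{Gal}(\overline{\mathbb{Q}}/\mathbb{Q})$ and $n\ge0$; (iii) there are $D>0$ and integers $d_n$ with $1\le d_n\le D^{n+1}$ such that $d_na_m$ is an algebraic integer for all $m\le n$. Let $\delta=x\frac{d}{dx}$. For $\underline a=[a_1,\dots,a_p]$ and $\underline b=[b_1,\dots,b_{p-1}]$ (with $\underline b=\emptyset$ if $p=1$), the hypergeometric equation is $$\delta(\delta+b_1-1)\cdots(\delta+b_{p-1}-1)y-x(\delta+a_1)\cdots(\delta+a_p)y=0.$$ For non-constant $\lambda$, ${}_p\mathcal{H}_{p-1}[\underline a;\underline b;\lambda]$ denotes its pullback by $\lambda$: the monic linear differential equation having the functions $y(\lambda(x))$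 as a $\mathbb{C}$-basis of solutions, where the $y(x)$ run through a $\mathbb{C}$-basis of solutions of the hypergeometric equation. For $\lambda\in\mathbb{C}$ constant, ${}_p\mathcal{H}_{p-1}[\underline a;\underline b;\lambda]$ is by convention the equation $y'=0$. Elements of $\mathcal{F}_M$ are rational expressions, with coefficients that are algebraic functions over $\mathbb{C}(x)$, in finitely many such solutions; $p,\underline a,\underline b,\lambda$ may differ from one solution to another. All functions are understood as meromorphic functions on some common nonempty connected open subset of $\mathbb{C}$; that a $G$-function $F$ belongs to $\mathcal{F}_M$ means that $F$ (analytically continued) equals such a rational expression on some such open set. *)

theory Defs
  imports
    "HOL-Complex_Analysis.Complex_Analysis"
    "HOL-Computational_Algebra.Computational_Algebra"
    "HOL-Computational_Algebra.Field_as_Ring"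
    "HOL-Library.Nonpos_Ints"
begin

section \<open>G-functions\<close>

definition Qbar :: "complex set" where
  "Qbar = {z. algebraic z}"

text \<open>Only the restriction of such a function to \<open>Qbar\<close> is meaningful.\<close>

definition gal_Qbar :: "(complex \<Rightarrow> complex) set" where
  "gal_Qbar = {\<sigma>. bij_betw \<sigma> Qbar Qbar \<and> (\<forall>q\<in>\<rat>. \<sigma> q = q) \<and>
     (\<forall>x\<in>Qbar. \<forall>y\<in>Qbar. \<sigma> (x + y) = \<sigma> x + \<sigma> y \<and> \<sigma> (x * y) = \<sigma> x * \<sigma> y)}"

text \<open>The field of rational functions over \<open>Qbar\<close>, as a subfield of the formal Laurent series.\<close>

definition Qbar_ratfun :: "complex fls set" where
  "Qbar_ratfun = {fps_to_fls (fps_of_poly p) / fps_to_fls (fps_of_poly q) | p q.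
     (\<forall>i. coeff p i \<in> Qbar) \<and> (\<forall>i. coeff q i \<in> Qbar) \<and> q \<noteq> 0}"

definition G_function :: "complex fps \<Rightarrow> bool" where
  "G_function F \<longleftrightarrow>
     (\<forall>n. fps_nth F n \<in> Qbar) \<and>
     (\<exists>r A. (\<forall>i\<le>r. A i \<in> Qbar_ratfun) \<and> (\<exists>i\<le>r. A i \<noteq> 0) \<and>
        (\<Sum>i\<le>r. A i * fps_to_fls ((fps_deriv ^^ i) F)) = 0) \<and>
     (\<exists>C>0. \<forall>\<sigma>\<in>gal_Qbar. \<forall>n. norm (\<sigma> (fps_nth F n)) \<le> C ^ (n + 1)) \<and>
     (\<exists>D>0. \<exists>d::nat \<Rightarrow> int. \<forall>n. 1 \<le> d n \<and> real_of_int (d n) \<le> D ^ (n + 1) \<and>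
        (\<forall>m\<le>n. algebraic_int (of_int (d n) * fps_nth F m)))"

section \<open>Linear differential equations and their solutions\<close>

text \<open>
  The type \<open>complex poly fract\<close> is the field of rational functions over the complex numbers.
  The function \<open>quot_of_fract\<close> gives the numerator and denominator in lowest terms.
\<close>

type_synonym ratfun = "complex poly fract"

definition ratfun_num :: "ratfun \<Rightarrow> complex poly" where
  "ratfun_num r = fst (quot_of_fract r)"

definition ratfun_den :: "ratfun \<Rightarrow> complex poly" where
  "ratfun_den r = snd (quot_of_fract r)"

definition ratfun_eval :: "ratfun \<Rightarrow> complex \<Rightarrow> complex" where
  "ratfun_eval r x = poly (ratfun_num r) x / poly (ratfun_den r) x"

text \<open>
  Meromorphic functions have no prescribed values at isolated points, so equality of
  meromorphic functions on \<open>U\<close> is equality outside of a set that is sparse in \<open>U\<close>. This also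
  makes the values of \<open>ratfun_eval\<close> at poles irrelevant.
\<close>

definition algebraic_function_on :: "complex set \<Rightarrow> (complex \<Rightarrow> complex) \<Rightarrow> bool" where
  "algebraic_function_on U g \<longleftrightarrow> g meromorphic_on U \<and>
     (\<exists>P :: ratfun poly. P \<noteq> 0 \<and>
        (\<forall>\<^sub>\<approx>x\<in>U. (\<Sum>i\<le>degree P. ratfun_eval (coeff P i) x * g x ^ i) = 0))"

text \<open>
  The list \<open>[c\<^sub>0, \<dots>, c\<^sub>n\<^sub>-\<^sub>1]\<close> encodes the monic equation
  \<open>y\<^sup>(\<^sup>n\<^sup>) + c\<^sub>n\<^sub>-\<^sub>1 y\<^sup>(\<^sup>n\<^sup>-\<^sup>1\<^sup>) + \<dots> + c\<^sub>0 y = 0\<close>.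
\<close>

definition ode_solutions :: "ratfun list \<Rightarrow> complex set \<Rightarrow> (complex \<Rightarrow> complex) set" where
  "ode_solutions cs U = {y. y meromorphic_on U \<and>
     (\<forall>\<^sub>\<approx>x\<in>U. (deriv ^^ length cs) y x
        + (\<Sum>i<length cs. ratfun_eval (cs ! i) x * (deriv ^^ i) y x) = 0)}"

definition delta :: "(complex \<Rightarrow> complex) \<Rightarrow> complex \<Rightarrow> complex" where
  "delta y = (\<lambda>x. x * deriv y x)"

text \<open>\<open>delta_prod [c\<^sub>1, \<dots>, c\<^sub>k]\<close> is the operator \<open>(\<delta> + c\<^sub>1) \<cdots> (\<delta> + c\<^sub>k)\<close>.\<close>

definition delta_prod :: "complex list \<Rightarrow> (complex \<Rightarrow> complex) \<Rightarrow> complex \<Rightarrow> complex" where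
  "delta_prod cs y = foldr (\<lambda>c u x. delta u x + c * u x) cs y"

definition hypergeom_solutions ::
    "complex list \<Rightarrow> complex list \<Rightarrow> complex set \<Rightarrow> (complex \<Rightarrow> complex) set" where
  "hypergeom_solutions a b U = {y. y meromorphic_on U \<and>
     (\<forall>\<^sub>\<approx>x\<in>U. delta (delta_prod (map (\<lambda>b. b - 1) b) y) x - x * delta_prod a y x = 0)}"

text \<open>
  \<open>ys\<close> is a basis over the complex numbers of the space \<open>S\<close> of meromorphic functions on \<open>U\<close>.
\<close>

definition basis_on ::
    "complex set \<Rightarrow> (complex \<Rightarrow> complex) set \<Rightarrow> (complex \<Rightarrow> complex) list \<Rightarrow> bool" where
  "basis_on U S ys \<longleftrightarrow> set ys \<subseteq> S \<and>
     (\<forall>c::nat \<Rightarrow> complex. (\<forall>\<^sub>\<approx>x\<in>U. (\<Sum>i<length ys. c i * (ys ! i) x) = 0)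
        \<longrightarrow> (\<forall>i<length ys. c i = 0)) \<and>
     (\<forall>f\<in>S. \<exists>c::nat \<Rightarrow> complex. \<forall>\<^sub>\<approx>x\<in>U. f x = (\<Sum>i<length ys. c i * (ys ! i) x))"

text \<open>
  The monic equation \<open>cs\<close> is the pullback by \<open>\<lambda>\<close> of the hypergeometric equation with parameters
  \<open>a\<close>, \<open>b\<close>. The bases are local, on a domain \<open>W\<close> and on a domain \<open>V\<close> that \<open>\<lambda>\<close> maps into \<open>W\<close>.
  Demanding \<open>length a\<close> basis elements (the order of both equations) rules out domains on
  which monodromy or singularities make the solution space too small. Since the coefficients are
  rational functions, \<open>cs\<close> does not depend on the choice of \<open>V\<close> and \<open>W\<close>.
\<close>

definition is_pullback :: "complex list \<Rightarrow> complex list \<Rightarrow> ratfun \<Rightarrow> ratfun list \<Rightarrow> bool" where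
  "is_pullback a b l cs \<longleftrightarrow> length cs = length a \<and>
     (\<exists>V W ys. open V \<and> connected V \<and> V \<noteq> {} \<and> open W \<and> connected W \<and> W \<noteq> {} \<and>
        (\<forall>x\<in>V. poly (ratfun_den l) x \<noteq> 0 \<and> ratfun_eval l x \<in> W) \<and>
        length ys = length a \<and>
        basis_on W (hypergeom_solutions a b W) ys \<and>
        basis_on V (ode_solutions cs V) (map (\<lambda>y. y \<circ> ratfun_eval l) ys))"

text \<open>
  For constant \<open>\<lambda>\<close> the hypergeometric equation is \<open>y' = 0\<close> by convention.
\<close>

definition is_hypergeom_eq :: "complex list \<Rightarrow> complex list \<Rightarrow> ratfun \<Rightarrow> ratfun list \<Rightarrow> bool" where
  "is_hypergeom_eq a b l cs \<longleftrightarrow>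
     (if \<exists>c. l = to_fract [:c:] then cs = [0] else is_pullback a b l cs)"

section \<open>The field generated by the solutions\<close>

inductive_set hypergeom_field_on :: "nat \<Rightarrow> complex set \<Rightarrow> (complex \<Rightarrow> complex) set"
  for M :: nat and U :: "complex set" where
  algebraic: "algebraic_function_on U g \<Longrightarrow> g \<in> hypergeom_field_on M U"
| solution: "\<lbrakk>length a \<ge> 1; length b = length a - 1; set b \<inter> \<int>\<^sub>\<le>\<^sub>0 = {};
     degree (ratfun_num l) < M; degree (ratfun_den l) < M;
     is_hypergeom_eq a b l cs; y \<in> ode_solutions cs U\<rbrakk> \<Longrightarrow> y \<in> hypergeom_field_on M U"
| add: "\<lbrakk>f \<in> hypergeom_field_on M U; g \<in> hypergeom_field_on M U\<rbrakk>
     \<Longrightarrow> (\<lambda>x. f x + g x) \<in> hypergeom_field_on M U"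
| diff: "\<lbrakk>f \<in> hypergeom_field_on M U; g \<in> hypergeom_field_on M U\<rbrakk>
     \<Longrightarrow> (\<lambda>x. f x - g x) \<in> hypergeom_field_on M U"
| mult: "\<lbrakk>f \<in> hypergeom_field_on M U; g \<in> hypergeom_field_on M U\<rbrakk>
     \<Longrightarrow> (\<lambda>x. f x * g x) \<in> hypergeom_field_on M U"
| divide: "\<lbrakk>f \<in> hypergeom_field_on M U; g \<in> hypergeom_field_on M U;
     \<not> (\<forall>\<^sub>\<approx>x\<in>U. g x = 0)\<rbrakk> \<Longrightarrow> (\<lambda>x. f x / g x) \<in> hypergeom_field_on M U"

text \<open>
  A function element is a holomorphic function on a domain. Analytic continuation is along
  finite chains of function elements in which neighbours agree on a nonempty open set.
\<close>

definition direct_continuation ::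
    "complex set \<times> (complex \<Rightarrow> complex) \<Rightarrow> complex set \<times> (complex \<Rightarrow> complex) \<Rightarrow> bool" where
  "direct_continuation = (\<lambda>(U, f) (V, g).
     open U \<and> connected U \<and> f holomorphic_on U \<and> open V \<and> connected V \<and> g holomorphic_on V \<and>
     (\<exists>W. open W \<and> W \<noteq> {} \<and> W \<subseteq> U \<inter> V \<and> (\<forall>x\<in>W. f x = g x)))"

definition analytic_continuation ::
    "complex set \<times> (complex \<Rightarrow> complex) \<Rightarrow> complex set \<times> (complex \<Rightarrow> complex) \<Rightarrow> bool" where
  "analytic_continuation = direct_continuation\<^sup>*\<^sup>*"

definition in_hypergeom_field :: "nat \<Rightarrow> complex fps \<Rightarrow> bool" where
  "in_hypergeom_field M F \<longleftrightarrow>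
     (\<exists>U f \<Phi>. open U \<and> connected U \<and> U \<noteq> {} \<and>
        analytic_continuation (eball 0 (fps_conv_radius F), eval_fps F) (U, f) \<and>
        \<Phi> \<in> hypergeom_field_on M U \<and> (\<forall>\<^sub>\<approx>x\<in>U. f x = \<Phi> x))"

end

theory Submission
  imports Defs
begin

text \<open>
  The witness is the hyperlogarithm \<open>F\<close> with \<open>n = 3M\<close> letters: \<open>F\<^sub>n = 1\<close>,
  \<open>F\<^sub>k\<^sub>-\<^sub>1' = F\<^sub>k / (1 - k x)\<close>, \<open>F = F\<^sub>0\<close>, with singular points \<open>t\<^sub>k = 1 / k\<close>. Let \<open>\<gamma>\<^sub>k\<close> be a loop around
  \<open>t\<^sub>k\<close> and consider the nested commutator
  \<open>\<gamma> = [\<gamma>\<^sub>1\<^sup>m, [\<gamma>\<^sub>2\<^sup>m, \<dots>, \<gamma>\<^sub>n\<^sup>m]]\<close>. A solution of a pullback of a hypergeometric equation by \<open>\<lambda>\<close> of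
  degree less than \<open>M\<close> branches only over the at most \<open>3(M - 1)\<close> points of \<open>\<lambda>\<^sup>-\<^sup>1({0, 1, \<infinity>})\<close>. Hence some
  \<open>\<gamma>\<^sub>k\<close> acts trivially on all its branches, and so does \<open>\<gamma>\<close>. An algebraic function has finitely many
  branches, so for suitable \<open>m\<close> every \<open>\<gamma>\<^sub>k\<^sup>m\<close> acts trivially on them. Therefore \<open>\<gamma>\<close> fixes the
  whole field generated by these functions, whereas it adds the nonzero constant
  \<open>\<plusminus>(2 \<pi> i m)\<^sup>n / n!\<close> to \<open>F\<close>.

  To avoid homotopies, continuation takes place in the complement of slits that run
  radially from the singular points away from a generic base point; the monodromy around \<open>t\<close> is the
  relation between two functions on this star-shaped domain that are glued along the slit at \<open>t\<close>.
\<close>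

subsection \<open>Linear differential systems\<close>

text \<open>One loop has to act trivially on all generators of a rational expression at once,
  although each pullback misses a different letter. A nested commutator achieves this because it
  collapses as soon as any one entry is trivial, whichever it is. The monodromy of \<open>F\<close>
  is unipotent, and a commutator of depth \<open>n\<close> still reaches its last step, where only a
  constant is added.

  Three obstacles shape the development. Crossing a slit is no map on holomorphic functions, since a
  continuation need not exist; so crossings are relations, and they are composed on solution spaces
  of linear systems, where continuations exist. This is why algebraic functions, too, are made
  solutions of linear equations. The coefficients of a pulled back equation may have poles outside
  the fibres over 0, 1 and \<infinity>, which would spoil the count of branch points; so its
  solutions are continued through another system. Finally, the base point, the singular set and the
  exponent depend on the functions involved; triviality is therefore demanded for all larger
  singular sets, all generic base points and all multiples of an exponent.\<close>

definition lin_sol ::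
    "nat \<Rightarrow> (nat \<Rightarrow> nat \<Rightarrow> complex \<Rightarrow> complex) \<Rightarrow> complex set \<Rightarrow> (nat \<Rightarrow> complex \<Rightarrow> complex) \<Rightarrow> bool" where
  "lin_sol n B D Z \<longleftrightarrow>
     (\<forall>i<n. \<forall>z\<in>D. (Z i has_field_derivative (\<Sum>j<n. B i j z * Z j z)) (at z))"

lemma lin_solD: "lin_sol n B D Z \<Longrightarrow> i < n \<Longrightarrow> z \<in> D \<Longrightarrow>
    (Z i has_field_derivative (\<Sum>j<n. B i j z * Z j z)) (at z)"
  by (simp add: lin_sol_def)

lemma lin_sol_subset: "lin_sol n B D Z \<Longrightarrow> D' \<subseteq> D \<Longrightarrow> lin_sol n B D' Z"
  by (auto simp: lin_sol_def)

lemma lin_sol_holomorphic: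
  assumes "lin_sol n B D Z" "i < n" "open D"
  shows "Z i holomorphic_on D"
  using assms by (auto simp: lin_sol_def holomorphic_on_open)

lemma lin_sol_diff:
  assumes "lin_sol n B D Z" "lin_sol n B D Z'"
  shows "lin_sol n B D (\<lambda>i z. Z i z - Z' i z)"
  unfolding lin_sol_def
proof (intro allI impI ballI)
  fix i z assume "i < n" "z \<in> D"
  from DERIV_diff[OF lin_solD[OF assms(1) this] lin_solD[OF assms(2) this]]
  show "((\<lambda>z. Z i z - Z' i z) has_field_derivative (\<Sum>j<n. B i j z * (Z j z - Z' j z))) (at z)"
    by (simp add: algebra_simps sum_subtractf)
qed

lemma lin_sol_lincomb:
  assumes "\<And>k. k \<in> K \<Longrightarrow> lin_sol n B D (Z k)"
  shows "lin_sol n B D (\<lambda>i z. \<Sum>k\<in>K. c k * Z k i z)"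
  unfolding lin_sol_def
proof (intro allI impI ballI)
  fix i z assume i: "i < n" "z \<in> D"
  have "((\<lambda>z. \<Sum>k\<in>K. c k * Z k i z) has_field_derivative
          (\<Sum>k\<in>K. c k * (\<Sum>j<n. B i j z * Z k j z))) (at z)"
    by (intro DERIV_sum DERIV_cmult lin_solD[OF assms i])
  also have "(\<Sum>k\<in>K. c k * (\<Sum>j<n. B i j z * Z k j z)) = (\<Sum>j<n. B i j z * (\<Sum>k\<in>K. c k * Z k j z))"
    by (simp add: sum_distrib_left mult_ac) (rule sum.swap)
  finally show "((\<lambda>z. \<Sum>k\<in>K. c k * Z k i z) has_field_derivative
          (\<Sum>j<n. B i j z * (\<Sum>k\<in>K. c k * Z k j z))) (at z)" .
qed

lemma open_nonzero:
  fixes g :: "complex \<Rightarrow> complex"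
  assumes "continuous_on W g" "open W" shows "open {x \<in> W. g x \<noteq> 0}"
proof -
  have "open (W \<inter> g -` (- {0}))"
    using continuous_open_preimage[OF assms, of "- {0}"] by (simp add: open_Compl)
  moreover have "W \<inter> g -` (- {0}) = {x \<in> W. g x \<noteq> 0}" by auto
  ultimately show ?thesis by simp
qed

text \<open>Integration along the segment raises the power of the distance by one and divides by the
  new exponent; iterated, this yields the factorials of the Picard estimate.\<close>

lemma segment_growth:
  fixes F f :: "complex \<Rightarrow> complex"
  assumes deriv: "\<And>w. w \<in> closed_segment a z \<Longrightarrow> (F has_field_derivative f w) (at w)"
    and "F a = 0"
    and bound: "\<And>w. w \<in> closed_segment a z \<Longrightarrow> norm (f w) \<le> C * norm (w - a) ^ k"
  shows "norm (F z) \<le> C * norm (z - a) ^ Suc k / Suc k"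
proof -
  define r where "r = norm (z - a)"
  define p where "p = (\<lambda>s::real. a + of_real s * (z - a))"
  have p: "p s \<in> closed_segment a z" if "0 \<le> s" "s \<le> 1" for s
    using that unfolding p_def in_segment by (intro exI[of _ s]) (auto simp: algebra_simps scaleR_conv_of_real)
  have np: "norm (p s - a) = s * r" if "0 \<le> s" for s
    using that by (simp add: p_def r_def norm_mult)
  have dF: "((\<lambda>s. F (p s)) has_vector_derivative f (p s) * (z - a)) (at s)" if "0 \<le> s" "s \<le> 1" for s
  proof -
    have "(p has_vector_derivative (z - a)) (at s)"
      unfolding p_def by (auto intro!: derivative_eq_intros)
    then show ?thesis
      using field_vector_diff_chain_at[of p "z - a" s F "f (p s)"] deriv[OF p[OF that]]
      by (simp add: o_def mult.commute)
  qed
  define phi where "phi = (\<lambda>s::real. C * r ^ Suc k * s ^ Suc k / Suc k)"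
  have dphi: "(phi has_vector_derivative C * r ^ Suc k * s ^ k) (at s)" for s
    unfolding phi_def has_real_derivative_iff_has_vector_derivative[symmetric]
    by (rule DERIV_cong, (rule derivative_intros)+) (auto simp: field_simps simp del: of_nat_Suc)
  have "norm (F (p 1) - F (p 0)) \<le> phi 1 - phi 0"
  proof (rule differentiable_bound_general[OF zero_less_one])
    show "continuous_on {0..1} (\<lambda>s. F (p s))"
      by (rule continuous_at_imp_continuous_on) (auto intro!: has_vector_derivative_continuous dF)
    show "continuous_on {0..1} phi"
      by (rule continuous_at_imp_continuous_on) (auto intro!: has_vector_derivative_continuous dphi)
    fix s :: real assume s: "0 < s" "s < 1"
    show "((\<lambda>s. F (p s)) has_vector_derivative f (p s) * (z - a)) (at s)" using s dF by simp
    show "(phi has_vector_derivative C * r ^ Suc k * s ^ k) (at s)" by (rule dphi)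
    have "norm (f (p s) * (z - a)) \<le> (C * (s * r) ^ k) * r"
      using bound[OF p, of s] s np[of s] unfolding norm_mult r_def[symmetric]
      by (intro mult_right_mono) (auto simp: r_def)
    then show "norm (f (p s) * (z - a)) \<le> C * r ^ Suc k * s ^ k"
      by (simp add: power_mult_distrib mult_ac)
  qed
  then show ?thesis using assms(2) by (simp add: p_def phi_def r_def)
qed

lemma compact_matrix_bound:
  fixes B :: "nat \<Rightarrow> nat \<Rightarrow> complex \<Rightarrow> complex"
  assumes "compact K" "\<And>i j. i < n \<Longrightarrow> j < m \<Longrightarrow> continuous_on K (B i j)"
  shows "\<exists>L\<ge>0. \<forall>i<n. \<forall>w\<in>K. (\<Sum>j<m. norm (B i j w)) \<le> L"
proof -
  have "compact ((\<lambda>w. \<Sum>i<n. \<Sum>j<m. norm (B i j w)) ` K)"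
    using assms by (intro compact_continuous_image continuous_intros) auto
  then obtain L where L: "\<forall>x\<in>(\<lambda>w. \<Sum>i<n. \<Sum>j<m. norm (B i j w)) ` K. norm x \<le> L"
    using compact_imp_bounded bounded_iff by metis
  have "(\<Sum>j<m. norm (B i j w)) \<le> max L 0" if "i < n" "w \<in> K" for i w
  proof -
    have "(\<Sum>j<m. norm (B i j w)) \<le> (\<Sum>i<n. \<Sum>j<m. norm (B i j w))"
      using that by (intro member_le_sum) (auto intro!: sum_nonneg)
    also have "\<dots> \<le> L" using L that(2) by force
    finally show ?thesis by simp
  qed
  then show ?thesis by (intro exI[of _ "max L 0"]) simp
qed

text \<open>One estimate with two uses: the sequence may consist of Picard iterates, for existence,
  or be the constant sequence of a solution that vanishes at \<open>a\<close>, for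
  uniqueness.\<close>

lemma picard_bound:
  assumes star: "\<And>w. w \<in> K \<Longrightarrow> closed_segment a w \<subseteq> K"
    and L: "L \<ge> 0" "\<And>i w. i < n \<Longrightarrow> w \<in> K \<Longrightarrow> (\<Sum>j<n. norm (B i j w)) \<le> L" and "V \<ge> 0"
    and X0: "\<And>i w. i < n \<Longrightarrow> w \<in> K \<Longrightarrow> norm (X 0 i w) \<le> V"
    and X: "\<And>k i w. i < n \<Longrightarrow> w \<in> K \<Longrightarrow>
      (X (Suc k) i has_field_derivative (\<Sum>j<n. B i j w * X k j w)) (at w)" "\<And>k i. i < n \<Longrightarrow> X (Suc k) i a = 0"
    and "i < n" "w \<in> K"
  shows "norm (X k i w) \<le> V * L ^ k / fact k * norm (w - a :: complex) ^ k"
  using assms(8,9)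
proof (induction k arbitrary: i w)
  case 0
  then show ?case using X0 by simp
next
  case (Suc k)
  have "norm (X (Suc k) i w) \<le> (V * L ^ Suc k / fact k) * norm (w - a) ^ Suc k / Suc k"
  proof (rule segment_growth[where f = "\<lambda>w. \<Sum>j<n. B i j w * X k j w"])
    fix u assume "u \<in> closed_segment a w"
    then have u: "u \<in> K" using star[OF Suc.prems(2)] by auto
    then show "(X (Suc k) i has_field_derivative (\<Sum>j<n. B i j u * X k j u)) (at u)" by (intro X(1) Suc.prems)
    have "norm (\<Sum>j<n. B i j u * X k j u) \<le> (\<Sum>j<n. norm (B i j u) * (V * L ^ k / fact k * norm (u - a) ^ k))"
      using Suc.IH[OF _ u]
      by (intro sum_norm_le) (auto simp: norm_mult simp del: times_divide_eq_right times_divide_eq_left intro!: mult_left_mono)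
    also have "\<dots> = (\<Sum>j<n. norm (B i j u)) * (V * L ^ k / fact k * norm (u - a) ^ k)"
      by (rule sum_distrib_right[symmetric])
    also have "\<dots> \<le> L * (V * L ^ k / fact k * norm (u - a) ^ k)"
      using L(2)[OF Suc.prems(1) u] \<open>V \<ge> 0\<close> \<open>L \<ge> 0\<close> by (intro mult_right_mono) auto
    finally show "norm (\<Sum>j<n. B i j u * X k j u) \<le> (V * L ^ Suc k / fact k) * norm (u - a) ^ k"
      by (simp add: mult_ac)
  qed (use X(2) Suc.prems in auto)
  then show ?case by (simp add: field_simps)
qed

text \<open>Such a solution is a fixed point of the Picard integral operator, so the estimate holds
  for it with every \<open>k\<close>; the bound is a multiple of a term of the exponential series
  and tends to 0.\<close>

lemma lin_sol_unique_segment: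
  assumes "lin_sol n B D Z" "closed_segment a z \<subseteq> D" "open D"
    and hol: "\<And>i j. i < n \<Longrightarrow> j < n \<Longrightarrow> B i j holomorphic_on D"
    and init: "\<And>i. i < n \<Longrightarrow> Z i a = 0"
    and "i < n"
  shows "Z i z = 0"
proof -
  let ?S = "closed_segment a z"
  have cont: "continuous_on ?S g" if "g holomorphic_on D" for g
    using holomorphic_on_subset[OF that assms(2)] by (rule holomorphic_on_imp_continuous_on)
  obtain L where L: "L \<ge> 0" "\<forall>i<n. \<forall>w\<in>?S. (\<Sum>j<n. norm (B i j w)) \<le> L"
    using compact_matrix_bound[of ?S n n B] cont hol by auto
  \<comment> \<open>The matrix bound with a single column bounds the vector
    \<open>Z\<close>.\<close>
  obtain V where V: "V \<ge> 0" "\<forall>i<n. \<forall>w\<in>?S. norm (Z i w) \<le> V"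
    using compact_matrix_bound[of ?S n 1 "\<lambda>i j. Z i"] cont lin_sol_holomorphic[OF assms(1) _ assms(3)] by auto
  have "norm (Z i z) \<le> V * L ^ k / fact k * norm (z - a) ^ k" for k
    by (rule picard_bound[where K = ?S and X = "\<lambda>k. Z" and B = B and n = n])
      (use L V assms(2) init \<open>i < n\<close> in \<open>auto intro: lin_solD[OF assms(1)] simp: subset_closed_segment\<close>)
  then have "norm (Z i z) \<le> V * ((L * norm (z - a)) ^ k /\<^sub>R fact k)" for k
    by (simp add: power_mult_distrib field_simps)
  moreover have "(\<lambda>k. V * ((L * norm (z - a)) ^ k /\<^sub>R fact k)) \<longlonglongrightarrow> V * 0"
    by (intro tendsto_mult tendsto_const summable_LIMSEQ_zero summable_exp_generic)
  ultimately have "norm (Z i z) \<le> V * 0"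
    by (intro tendsto_lowerbound[OF _ always_eventually]) auto
  then show ?thesis by simp
qed

lemma lin_sol_unique:
  assumes "lin_sol n B D Z" "lin_sol n B D Z'" "open D" "connected D" "a \<in> D"
    and hol: "\<And>i j. i < n \<Longrightarrow> j < n \<Longrightarrow> B i j holomorphic_on D"
    and init: "\<And>i. i < n \<Longrightarrow> Z i a = Z' i a"
    and "i < n" "z \<in> D"
  shows "Z i z = Z' i z"
proof -
  obtain r where r: "r > 0" "ball a r \<subseteq> D" using \<open>open D\<close> \<open>a \<in> D\<close> open_contains_ball by metis
  have "Z i w = Z' i w" if "w \<in> ball a r" for w
  proof -
    have "closed_segment a w \<subseteq> ball a r"
      using that r by (intro closed_segment_subset) auto
    then have "Z i w - Z' i w = 0"
      using lin_sol_unique_segment[OF lin_sol_diff[OF assms(1,2)], of a w i] hol init r \<open>i < n\<close> \<open>open D\<close>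
      by auto
    then show ?thesis by simp
  qed
  then show ?thesis
    using analytic_continuation_open[of "ball a r" D "Z i" "Z' i" z] r assms lin_sol_holomorphic
    by (auto simp: lin_sol_holomorphic)
qed

text \<open>A star-shaped domain provides primitives of all holomorphic functions, so Picard
  iteration works on the whole of \<open>D\<close> at once and no local solutions have to be
  glued.\<close>

lemma lin_sol_exists_centre:
  assumes "open D" "a \<in> D" and star: "\<And>z. z \<in> D \<Longrightarrow> closed_segment a z \<subseteq> D"
    and hol: "\<And>i j. i < n \<Longrightarrow> j < n \<Longrightarrow> B i j holomorphic_on D"
  shows "\<exists>Z. lin_sol n B D Z \<and> (\<forall>i<n. Z i a = v i)"
proof -
  have sl: "starlike D" unfolding starlike_def using assms by blast
  have prim: "\<exists>G. (\<forall>x\<in>D. (G has_field_derivative g x) (at x)) \<and> G a = 0" if g: "g holomorphic_on D" for g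
  proof -
    obtain G where "\<forall>x\<in>D. (G has_field_derivative g x) (at x)"
      using holomorphic_starlike_primitive[OF holomorphic_on_imp_continuous_on[OF g] sl \<open>open D\<close>, of "{}"]
        g \<open>open D\<close> holomorphic_on_imp_differentiable_at by blast
    then show ?thesis
      by (intro exI[of _ "\<lambda>z. G z - G a"]) (auto intro!: derivative_eq_intros)
  qed
  define I where "I g = (SOME G. (\<forall>x\<in>D. (G has_field_derivative g x) (at x)) \<and> G a = 0)" for g
  have I: "x \<in> D \<Longrightarrow> (I g has_field_derivative g x) (at x)" "I g a = 0" if "g holomorphic_on D" for g x
    using someI_ex[OF prim[OF that]] unfolding I_def by auto
  \<comment> \<open>\<open>P k\<close> is the \<open>k\<close>-th term of the series and not its
    partial sum: each term is the integral of \<open>B\<close> against the preceding one.\<close>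
  define P where "P = rec_nat (\<lambda>i z. v i) (\<lambda>_ Y i. I (\<lambda>z. \<Sum>j<n. B i j z * Y j z))"
  have P0: "P 0 i = (\<lambda>z. v i)" and PS: "P (Suc k) i = I (\<lambda>z. \<Sum>j<n. B i j z * P k j z)" for i k
    by (simp_all add: P_def)
  have Phol: "i < n \<Longrightarrow> P k i holomorphic_on D" for k i
  proof (induction k arbitrary: i)
    case (Suc k)
    have "(\<lambda>z. \<Sum>j<n. B i j z * P k j z) holomorphic_on D"
      using Suc hol by (auto intro!: holomorphic_intros)
    from I(1)[OF this] show ?case unfolding PS using \<open>open D\<close> by (auto simp: holomorphic_on_open)
  qed (auto simp: P0)
  have Shol: "(\<lambda>z. \<Sum>j<n. B i j z * P k j z) holomorphic_on D" if "i < n" for i k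
    using that Phol hol by (auto intro!: holomorphic_intros)
  define P' where "P' k i = (case k of 0 \<Rightarrow> (\<lambda>z. 0) | Suc k \<Rightarrow> (\<lambda>z. \<Sum>j<n. B i j z * P k j z))" for k i
  have dP: "(P k i has_field_derivative P' k i z) (at z)" if "i < n" "z \<in> D" for k i z
    using I(1)[OF Shol[OF that(1)] that(2)] by (cases k) (auto simp: P0 PS P'_def)
  have loc: "\<exists>d h. 0 < d \<and> summable h \<and> (\<forall>\<^sub>F k in sequentially. \<forall>y\<in>ball x d \<inter> D. norm (P k i y) \<le> h k)"
    if "x \<in> D" "i < n" for x i
  proof -
    obtain d where d: "d > 0" "cball x d \<subseteq> D"
      using open_contains_cball_eq[OF \<open>open D\<close>] \<open>x \<in> D\<close> by blast
    \<comment> \<open>The estimate needs a compact set that contains a ball around \<open>x\<close>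
      and is star-shaped about \<open>a\<close>: the union of the segments from \<open>a\<close> to
      a closed ball.\<close>
    define K where "K = (\<lambda>(s, w). a + of_real s * (w - a)) ` ({0..1::real} \<times> cball x d)"
    have KD: "K \<subseteq> D"
    proof
      fix y assume "y \<in> K"
      then obtain s w where y: "0 \<le> s" "s \<le> 1" "w \<in> cball x d" "y = a + of_real s * (w - a)"
        by (auto simp: K_def)
      then have "y \<in> closed_segment a w"
        unfolding in_segment by (intro exI[of _ s]) (auto simp: algebra_simps scaleR_conv_of_real)
      then show "y \<in> D" using star y d by blast
    qed
    have "compact K" unfolding K_def split_def
      by (intro compact_continuous_image compact_Times continuous_intros) auto
    have Kstar: "closed_segment a y \<subseteq> K" if "y \<in> K" for y
    proof
      fix u assume "u \<in> closed_segment a y"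
      then obtain t where t: "0 \<le> t" "t \<le> 1" "u = a + of_real t * (y - a)"
        unfolding in_segment by (auto simp: algebra_simps scaleR_conv_of_real)
      obtain s w where y: "0 \<le> s" "s \<le> 1" "w \<in> cball x d" "y = a + of_real s * (w - a)"
        using \<open>y \<in> K\<close> by (auto simp: K_def)
      have "u = a + of_real (t * s) * (w - a)" using t y by (simp add: mult_ac)
      moreover have "t * s \<le> 1" using t y by (simp add: mult_le_one)
      ultimately show "u \<in> K" unfolding K_def using t y by (intro image_eqI[of _ _ "(t * s, w)"]) auto
    qed
    have "continuous_on K (B i j)" if "i < n" "j < n" for i j
      using holomorphic_on_subset[OF hol[OF that] KD] by (rule holomorphic_on_imp_continuous_on)
    then obtain L where L: "L \<ge> 0" "\<forall>i<n. \<forall>w\<in>K. (\<Sum>j<n. norm (B i j w)) \<le> L"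
      using compact_matrix_bound[OF \<open>compact K\<close>, of n n B] by auto
    define V where "V = (\<Sum>i<n. norm (v i))"
    have V: "norm (v i) \<le> V" if "i < n" for i
      unfolding V_def using that by (intro member_le_sum) auto
    have "V \<ge> 0" unfolding V_def by (auto intro!: sum_nonneg)
    have step: "norm (P k i w) \<le> V * L ^ k / fact k * norm (w - a) ^ k" if "i < n" "w \<in> K" for i w k
    proof (rule picard_bound[where K = K and B = B and n = n])
      show "(P (Suc k) i has_field_derivative (\<Sum>j<n. B i j w * P k j w)) (at w)" if "i < n" "w \<in> K" for k i w
        unfolding PS using that KD by (intro I(1) Shol) auto
    qed (use L V Kstar that \<open>V \<ge> 0\<close> I(2)[OF Shol] in \<open>auto simp: P0 PS\<close>)
    define R where "R = norm (x - a) + d"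
    have R: "norm (y - a) \<le> R" if "y \<in> ball x d" for y
      using that norm_triangle_ineq[of "y - x" "x - a"] by (simp add: R_def dist_norm norm_minus_commute)
    have inK: "y \<in> K" if "y \<in> ball x d" for y
      unfolding K_def using that by (intro image_eqI[of _ _ "(1, y)"]) auto
    have "norm (P k i y) \<le> V * ((L * R) ^ k /\<^sub>R fact k)" if "y \<in> ball x d" for k y
    proof -
      have "norm (P k i y) \<le> V * L ^ k / fact k * norm (y - a) ^ k"
        using step[OF \<open>i < n\<close> inK[OF that]] .
      also have "\<dots> \<le> V * L ^ k / fact k * R ^ k"
        using R[OF that] \<open>V \<ge> 0\<close> L(1) by (intro mult_left_mono power_mono) auto
      finally show ?thesis by (simp add: power_mult_distrib field_simps)
    qed
    moreover have "summable (\<lambda>k. V * ((L * R) ^ k /\<^sub>R fact k))"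
      by (intro summable_mult summable_exp_generic)
    ultimately show ?thesis using d by (intro exI[of _ d] exI[of _ "\<lambda>k. V * ((L * R) ^ k /\<^sub>R fact k)"]) auto
  qed
  have "\<exists>g g'. \<forall>x\<in>D. ((\<lambda>k. P k i x) sums g x) \<and> ((\<lambda>k. P' k i x) sums g' x) \<and>
          (g has_field_derivative g' x) (at x)" if "i < n" for i
    by (rule series_and_derivative_comparison_local[OF \<open>open D\<close>]) (use dP loc that in blast)+
  then obtain Z Z' where Z: "\<And>i x. i < n \<Longrightarrow> x \<in> D \<Longrightarrow> (\<lambda>k. P k i x) sums Z i x"
      "\<And>i x. i < n \<Longrightarrow> x \<in> D \<Longrightarrow> (\<lambda>k. P' k i x) sums Z' i x"
      "\<And>i x. i < n \<Longrightarrow> x \<in> D \<Longrightarrow> (Z i has_field_derivative Z' i x) (at x)"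
    by metis
  have "Z' i x = (\<Sum>j<n. B i j x * Z j x)" if "i < n" "x \<in> D" for i x
  proof -
    have "(\<lambda>k. P' (Suc k) i x) sums (Z' i x - P' 0 i x)"
      using Z(2)[OF that] by (subst sums_Suc_iff) simp
    moreover have "(\<lambda>k. P' (Suc k) i x) sums (\<Sum>j<n. B i j x * Z j x)"
      unfolding P'_def nat.case using that by (intro sums_sum sums_mult Z(1)) auto
    ultimately show ?thesis by (simp add: sums_unique2 P'_def)
  qed
  then have "lin_sol n B D Z" using Z(3) by (simp add: lin_sol_def)
  moreover have "Z i a = v i" if "i < n" for i
  proof -
    have "P (Suc k) i a = 0" for k using I(2)[OF Shol[OF that]] by (simp add: PS)
    then have "(\<lambda>k. P k i a) sums (0 + P 0 i a)"
      by (intro sums_Suc) simp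
    then show ?thesis using sums_unique2[OF Z(1)[OF that \<open>a \<in> D\<close>]] by (simp add: P0)
  qed
  ultimately show ?thesis by blast
qed

text \<open>Picard iteration starts at the star centre. Initial values prescribed at
  \<open>q\<close> are first transported to \<open>c\<close> inside a convex tube around the segment
  from \<open>c\<close> to \<open>q\<close>.\<close>

lemma lin_sol_exists:
  assumes "open D" "c \<in> D" and star: "\<And>z. z \<in> D \<Longrightarrow> closed_segment c z \<subseteq> D"
    and hol: "\<And>i j. i < n \<Longrightarrow> j < n \<Longrightarrow> B i j holomorphic_on D" and "q \<in> D"
  shows "\<exists>Z. lin_sol n B D Z \<and> (\<forall>i<n. Z i q = v i)"
proof -
  let ?s = "closed_segment c q"
  obtain e where e: "e > 0" "(\<Union>x\<in>?s. ball x e) \<subseteq> D"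
    using compact_subset_open_imp_ball_epsilon_subset[OF compact_segment \<open>open D\<close> star[OF \<open>q \<in> D\<close>]] by metis
  define E where "E = (\<Union>x\<in>?s. ball x e)"
  have E: "open E" "E \<subseteq> D" "c \<in> E" "q \<in> E" using e unfolding E_def by (auto intro: bexI[of _ c] bexI[of _ q])
  \<comment> \<open>The tube is the Minkowski sum of the segment and a ball, hence convex.\<close>
  have "E = (\<Union>x\<in>?s. \<Union>y\<in>ball 0 e. {x + y})"
  proof (intro equalityI subsetI)
    fix w assume "w \<in> E"
    then obtain x where "x \<in> ?s" "w \<in> ball x e" by (auto simp: E_def)
    then show "w \<in> (\<Union>x\<in>?s. \<Union>y\<in>ball 0 e. {x + y})"
      by (intro UN_I[of x] UN_I[of "w - x"]) (auto simp: dist_norm norm_minus_commute)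
  next
    fix w assume "w \<in> (\<Union>x\<in>?s. \<Union>y\<in>ball 0 e. {x + y})"
    then obtain x y where "x \<in> ?s" "norm y < e" "w = x + y" by auto
    then show "w \<in> E" unfolding E_def by (intro UN_I[of x]) (auto simp: dist_norm)
  qed
  then have "convex E" using convex_sums[of ?s "ball 0 e"] by auto
  then have seg: "closed_segment q z \<subseteq> E" if "z \<in> E" for z
    using that E closed_segment_subset by blast
  have holE: "B i j holomorphic_on E" if "i < n" "j < n" for i j
    using hol[OF that] E by (auto intro: holomorphic_on_subset)
  have "\<exists>Y. lin_sol n B E Y \<and> (\<forall>i<n. Y i q = v i)"
    by (rule lin_sol_exists_centre) (use E seg holE in auto)
  then obtain Y where Y: "lin_sol n B E Y" "\<forall>i<n. Y i q = v i" by blast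
  have "\<exists>Z. lin_sol n B D Z \<and> (\<forall>i<n. Z i c = Y i c)"
    by (rule lin_sol_exists_centre) (use assms in auto)
  then obtain Z where Z: "lin_sol n B D Z" "\<forall>i<n. Z i c = Y i c" by blast
  have "Z i q = Y i q" if "i < n" for i
    by (rule lin_sol_unique[OF lin_sol_subset[OF Z(1) E(2)] Y(1) E(1) convex_connected[OF \<open>convex E\<close>] E(3) holE])
      (use Z that E in auto)
  then show ?thesis using Y Z by auto
qed

subsection \<open>Slit planes and their gluing relations\<close>

type_synonym cfun = "complex \<Rightarrow> complex"

text \<open>The coordinate \<open>(z - c) / (t - c)\<close> sends \<open>c\<close> to 0 and
  \<open>t\<close> to 1, and the slit to the real ray from 1 to \<infinity>. For
  \<open>t = c\<close> the quotient is 0, so the slit is empty.\<close>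

definition slit :: "complex \<Rightarrow> complex \<Rightarrow> complex set" where
  "slit c t = {z. Im ((z - c) / (t - c)) = 0 \<and> Re ((z - c) / (t - c)) \<ge> 1}"

definition slit_plane :: "complex set \<Rightarrow> complex \<Rightarrow> complex set" where
  "slit_plane T c = - (\<Union>t\<in>T. slit c t)"

text \<open>No line through \<open>c\<close> contains two points of \<open>T\<close>, so the slits
  are disjoint. Points on the opposite ray are excluded as well, because such a point would make a
  sector empty.\<close>

definition generic_centre :: "complex set \<Rightarrow> complex \<Rightarrow> bool" where
  "generic_centre T c \<longleftrightarrow> finite T \<and> c \<notin> T \<and> (\<forall>s\<in>T. \<forall>t\<in>T. s \<noteq> t \<longrightarrow> Im ((s - c) / (t - c)) \<noteq> 0)"

text \<open>A convex neighbourhood of the slit at \<open>t\<close> without its end point, disjoint from all other slits.\<close>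

definition sector :: "complex set \<Rightarrow> complex \<Rightarrow> complex \<Rightarrow> complex set" where
  "sector T c t = {z. Re ((z - c) / (t - c)) > 1 \<and>
     (\<forall>s\<in>T - {t}. \<bar>Im ((z - c) / (t - c))\<bar> * \<bar>Re ((s - c) / (t - c))\<bar>
        < \<bar>Im ((s - c) / (t - c))\<bar> * Re ((z - c) / (t - c)))}"

definition half_sector :: "complex set \<Rightarrow> complex \<Rightarrow> complex \<Rightarrow> real \<Rightarrow> complex set" where
  "half_sector T c t \<sigma> = sector T c t \<inter> {z. \<sigma> * Im ((z - c) / (t - c)) > 0}"

text \<open>Continuation from the side of positive imaginary part through the slit to the other side
  and back to the centre, that is, a clockwise turn about \<open>t\<close>. It is a relation because
  \<open>f\<close> need not extend across the slit, and because the values of \<open>g\<close> off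
  the slit plane are arbitrary.\<close>

definition crossing :: "complex set \<Rightarrow> complex \<Rightarrow> complex \<Rightarrow> (cfun \<times> cfun) set" where
  "crossing T c t = {(f, g). f holomorphic_on slit_plane T c \<and> g holomorphic_on slit_plane T c \<and>
     (\<exists>h. h holomorphic_on sector T c t \<and> (\<forall>z\<in>half_sector T c t 1. h z = f z) \<and>
        (\<forall>z\<in>half_sector T c t (-1). h z = g z))}"

section \<open>Topology of slit planes and sectors\<close>

lemma generic_centre_subset: "generic_centre T c \<Longrightarrow> T' \<subseteq> T \<Longrightarrow> generic_centre T' c"
  by (auto simp: generic_centre_def intro: finite_subset)

lemma slit_plane_antimono: "T' \<subseteq> T \<Longrightarrow> slit_plane T c \<subseteq> slit_plane T' c"
  by (auto simp: slit_plane_def)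

lemma end_in_slit: "t \<noteq> c \<Longrightarrow> t \<in> slit c t"
  by (simp add: slit_def)

lemma slit_plane_subset_compl: "c \<notin> T \<Longrightarrow> slit_plane T c \<subseteq> - T"
proof
  fix x assume "c \<notin> T" "x \<in> slit_plane T c"
  then show "x \<in> - T" using end_in_slit[of x c] by (auto simp: slit_plane_def)
qed

lemma holomorphic_on_slit_plane:
  "f holomorphic_on - T \<Longrightarrow> generic_centre T c \<Longrightarrow> f holomorphic_on slit_plane T c"
  using slit_plane_subset_compl[of c T] by (auto simp: generic_centre_def intro: holomorphic_on_subset)

lemma open_slit_plane:
  assumes "generic_centre T c" shows "open (slit_plane T c)"
proof -
  have "closed (slit c t)" if "t \<in> T" for t
  proof -
    have "t - c \<noteq> 0" using assms that by (auto simp: generic_centre_def)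
    then show ?thesis unfolding slit_def
      by (intro closed_Collect_conj closed_Collect_eq closed_Collect_le continuous_intros) auto
  qed
  then have "closed (\<Union>t\<in>T. slit c t)"
    using assms by (intro closed_UN) (auto simp: generic_centre_def)
  then show ?thesis unfolding slit_plane_def by (rule open_Compl)
qed

lemma centre_in_slit_plane: "c \<in> slit_plane T c"
  by (auto simp: slit_plane_def slit_def)

lemma slit_plane_star:
  assumes "z \<in> slit_plane T c" shows "closed_segment c z \<subseteq> slit_plane T c"
proof
  fix w assume "w \<in> closed_segment c z"
  then obtain s where s: "0 \<le> s" "s \<le> 1" "w = c + of_real s * (z - c)"
    unfolding in_segment by (auto simp: algebra_simps scaleR_conv_of_real)
  show "w \<in> slit_plane T c"
  proof (rule ccontr)
    assume "w \<notin> slit_plane T c"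
    then obtain t where t: "t \<in> T" "w \<in> slit c t" by (auto simp: slit_plane_def)
    define u where "u = (z - c) / (t - c)"
    have "(w - c) / (t - c) = of_real s * u" using s by (simp add: u_def)
    then have su: "s * Im u = 0" "s * Re u \<ge> 1" using t by (auto simp: slit_def)
    then have "s \<noteq> 0" by auto
    then have "Im u = 0" using su by simp
    moreover have "Re u \<ge> 1"
    proof (rule ccontr)
      assume "\<not> Re u \<ge> 1"
      then have "s * Re u < s * 1" using \<open>s \<noteq> 0\<close> s by (intro mult_strict_left_mono) auto
      then show False using su s by auto
    qed
    ultimately have "z \<in> slit c t" by (simp add: slit_def u_def)
    then show False using assms t by (auto simp: slit_plane_def)
  qed
qed

lemma connected_slit_plane: "connected (slit_plane T c)"
proof -
  have "starlike (slit_plane T c)"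
    unfolding starlike_def using centre_in_slit_plane slit_plane_star by blast
  then show ?thesis by (rule starlike_imp_connected)
qed

text \<open>On the slit of \<open>s\<close> the coordinate of \<open>z\<close> is a multiple, by
  some \<open>r \<ge> 1\<close>, of the coordinate of \<open>s\<close>; the sector inequality would
  then make a number smaller than itself.\<close>

lemma sector_subset: "sector T c t \<subseteq> slit_plane (T - {t}) c"
proof
  fix z assume z: "z \<in> sector T c t"
  show "z \<in> slit_plane (T - {t}) c"
  proof (rule ccontr)
    assume "z \<notin> slit_plane (T - {t}) c"
    then obtain s where s: "s \<in> T - {t}" "z \<in> slit c s" by (auto simp: slit_plane_def)
    define r where "r = Re ((z - c) / (s - c))"
    have r: "r \<ge> 1" "(z - c) / (s - c) = of_real r" using s by (auto simp: slit_def r_def complex_eq_iff)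
    then have "s - c \<noteq> 0" by (cases "s = c") (auto simp: complex_eq_iff)
    with r have "z - c = of_real r * (s - c)" by (simp add: field_simps)
    define v where "v = (s - c) / (t - c)"
    have "(z - c) / (t - c) = of_real r * v" using \<open>z - c = _\<close> by (simp add: v_def)
    then have "Re ((z - c) / (t - c)) = r * Re v" "Im ((z - c) / (t - c)) = r * Im v"
      by simp_all
    moreover have "Re ((z - c) / (t - c)) > 1"
      "\<bar>Im ((z - c) / (t - c))\<bar> * \<bar>Re v\<bar> < \<bar>Im v\<bar> * Re ((z - c) / (t - c))"
      using z s(1) unfolding sector_def v_def by blast+
    ultimately have "r * Re v > 1" "\<bar>r * Im v\<bar> * \<bar>Re v\<bar> < \<bar>Im v\<bar> * (r * Re v)" by metis+
    moreover have "Re v > 0" using calculation(1) r(1) by (smt (verit) mult_nonneg_nonpos)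
    ultimately show False using r(1) by (simp add: abs_mult)
  qed
qed

lemma sector_disjoint:
  assumes "c \<notin> T" shows "sector T c t \<subseteq> - T"
proof -
  have "t \<notin> sector T c t" by (cases "t = c") (auto simp: sector_def)
  moreover have "sector T c t \<subseteq> - (T - {t})"
    using sector_subset[of T c t] slit_plane_subset_compl[of c "T - {t}"] assms by auto
  ultimately show ?thesis by auto
qed

lemma half_sector_subset: "half_sector T c t \<sigma> \<subseteq> slit_plane T c"
proof -
  have "half_sector T c t \<sigma> \<inter> slit c t = {}" by (auto simp: half_sector_def slit_def)
  moreover have "half_sector T c t \<sigma> \<subseteq> slit_plane (T - {t}) c"
    using sector_subset[of T c t] by (auto simp: half_sector_def)
  ultimately show ?thesis unfolding slit_plane_def by blast
qed

lemma half_sector_subset_sector: "half_sector T c t \<sigma> \<subseteq> sector T c t"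
  by (auto simp: half_sector_def)

lemma open_sector:
  assumes "generic_centre T c" "t \<in> T" shows "open (sector T c t)"
proof -
  have "t - c \<noteq> 0" using assms by (auto simp: generic_centre_def)
  moreover have "sector T c t = {z. Re ((z - c) / (t - c)) > 1} \<inter>
     (\<Inter>s\<in>T - {t}. {z. \<bar>Im ((z - c) / (t - c))\<bar> * \<bar>Re ((s - c) / (t - c))\<bar>
        < \<bar>Im ((s - c) / (t - c))\<bar> * Re ((z - c) / (t - c))})"
    by (auto simp: sector_def)
  ultimately show ?thesis using assms
    by (auto simp: generic_centre_def intro!: open_Int open_INT open_Collect_less continuous_intros)
qed

lemma open_half_sector:
  assumes "generic_centre T c" "t \<in> T" shows "open (half_sector T c t \<sigma>)"
proof -
  have "t - c \<noteq> 0" using assms by (auto simp: generic_centre_def)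
  then show ?thesis unfolding half_sector_def
    by (intro open_Int open_sector assms open_Collect_less continuous_intros) auto
qed

text \<open>Each defining condition says that a concave function of \<open>z\<close> is
  positive.\<close>

lemma convex_sector: "convex (sector T c t)"
proof (rule convexI)
  fix x y :: complex and u v :: real
  assume x: "x \<in> sector T c t" and y: "y \<in> sector T c t" and uv: "0 \<le> u" "0 \<le> v" "u + v = 1"
  define p where "p = (\<lambda>z. (z - c) / (t - c))"
  have "p (u *\<^sub>R x + v *\<^sub>R y) = of_real u * p x + of_real v * p y"
  proof -
    have "u *\<^sub>R x + v *\<^sub>R y - c = u *\<^sub>R (x - c) + v *\<^sub>R (y - c) + (of_real (u + v) - 1) * c"
      by (simp add: algebra_simps scaleR_conv_of_real)
    then show ?thesis using uv by (simp add: p_def scaleR_conv_of_real add_divide_distrib)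
  qed
  then have R: "Re (p (u *\<^sub>R x + v *\<^sub>R y)) = u * Re (p x) + v * Re (p y)"
    and I: "Im (p (u *\<^sub>R x + v *\<^sub>R y)) = u * Im (p x) + v * Im (p y)" by simp_all
  have less: "u * a + v * b > 0" if "a > 0" "b > 0" for a b :: real
    using that uv by (cases "u = 0") (auto intro!: add_pos_nonneg)
  have "Re (p (u *\<^sub>R x + v *\<^sub>R y)) > 1"
  proof -
    have "Re (p x) - 1 > 0" "Re (p y) - 1 > 0" using x y by (auto simp: sector_def p_def)
    from less[OF this] show ?thesis using uv R by (simp add: algebra_simps)
  qed
  moreover have "\<bar>Im (p (u *\<^sub>R x + v *\<^sub>R y))\<bar> * \<bar>Re (p s)\<bar> < \<bar>Im (p s)\<bar> * Re (p (u *\<^sub>R x + v *\<^sub>R y))"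
    if "s \<in> T - {t}" for s
  proof -
    have "\<bar>Im (p s)\<bar> * Re (p x) - \<bar>Im (p x)\<bar> * \<bar>Re (p s)\<bar> > 0" "\<bar>Im (p s)\<bar> * Re (p y) - \<bar>Im (p y)\<bar> * \<bar>Re (p s)\<bar> > 0"
      using x y that by (auto simp: sector_def p_def)
    from less[OF this]
    have "(u * \<bar>Im (p x)\<bar> + v * \<bar>Im (p y)\<bar>) * \<bar>Re (p s)\<bar> < \<bar>Im (p s)\<bar> * (u * Re (p x) + v * Re (p y))"
      by (simp add: algebra_simps)
    moreover have "\<bar>u * Im (p x) + v * Im (p y)\<bar> * \<bar>Re (p s)\<bar> \<le> (u * \<bar>Im (p x)\<bar> + v * \<bar>Im (p y)\<bar>) * \<bar>Re (p s)\<bar>"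
      using uv abs_triangle_ineq[of "u * Im (p x)" "v * Im (p y)"]
      by (intro mult_right_mono) (auto simp: abs_mult)
    ultimately show ?thesis unfolding R I by linarith
  qed
  ultimately show "u *\<^sub>R x + v *\<^sub>R y \<in> sector T c t" by (auto simp: sector_def p_def)
qed

lemma convex_half_sector: "convex (half_sector T c t \<sigma>)"
  unfolding half_sector_def
proof (rule convex_Int[OF convex_sector], rule convexI)
  fix x y :: complex and u v :: real
  assume x: "x \<in> {z. \<sigma> * Im ((z - c) / (t - c)) > 0}" and y: "y \<in> {z. \<sigma> * Im ((z - c) / (t - c)) > 0}"
    and uv: "0 \<le> u" "0 \<le> v" "u + v = 1"
  have "u *\<^sub>R x + v *\<^sub>R y - c = u *\<^sub>R (x - c) + v *\<^sub>R (y - c) + (of_real (u + v) - 1) * c"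
    by (simp add: algebra_simps scaleR_conv_of_real)
  then have "(u *\<^sub>R x + v *\<^sub>R y - c) / (t - c) = of_real u * ((x - c) / (t - c)) + of_real v * ((y - c) / (t - c))"
    using uv by (simp add: scaleR_conv_of_real add_divide_distrib)
  then have "Im ((u *\<^sub>R x + v *\<^sub>R y - c) / (t - c)) =
      u * Im ((x - c) / (t - c)) + v * Im ((y - c) / (t - c))"
    by (simp only: plus_complex.sel times_complex.sel Re_complex_of_real Im_complex_of_real)
  then have "\<sigma> * Im ((u *\<^sub>R x + v *\<^sub>R y - c) / (t - c)) =
      u * (\<sigma> * Im ((x - c) / (t - c))) + v * (\<sigma> * Im ((y - c) / (t - c)))"
    by (simp add: distrib_left mult.left_commute)
  also have "\<dots> > 0" using x y uv by (cases "u = 0") (auto intro!: add_pos_nonneg)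
  finally show "u *\<^sub>R x + v *\<^sub>R y \<in> {z. \<sigma> * Im ((z - c) / (t - c)) > 0}" by simp
qed

lemma half_sector_nonempty:
  assumes "generic_centre T c" "t \<in> T" "\<sigma> = 1 \<or> \<sigma> = -1"
  shows "half_sector T c t \<sigma> \<noteq> {}"
proof -
  have tc: "t - c \<noteq> 0" using assms by (auto simp: generic_centre_def)
  have "open (sector T c t)" by (rule open_sector[OF assms(1,2)])
  moreover have p: "(c + u * (t - c) - c) / (t - c) = u" for u using tc by simp
  have "c + 2 * (t - c) \<in> sector T c t"
    using assms unfolding sector_def mem_Collect_eq p by (auto simp: generic_centre_def)
  ultimately obtain e where e: "e > 0" "ball (c + 2 * (t - c)) e \<subseteq> sector T c t"
    using open_contains_ball by metis
  define r where "r = e / (2 * norm (t - c))"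
  have r: "r > 0" "r * norm (t - c) < e" using e tc by (auto simp: r_def)
  define w where "w = c + Complex 2 (\<sigma> * r) * (t - c)"
  have "w - (c + 2 * (t - c)) = Complex 0 (\<sigma> * r) * (t - c)"
    by (simp add: w_def algebra_simps complex_eq_iff)
  moreover have "norm (Complex 0 (\<sigma> * r)) = r" using assms(3) r by (auto simp: cmod_def)
  ultimately have "w \<in> ball (c + 2 * (t - c)) e"
    using r by (simp add: dist_norm norm_minus_commute norm_mult)
  then have "w \<in> sector T c t" using e by auto
  moreover have "\<sigma> * Im ((w - c) / (t - c)) > 0"
    unfolding w_def p using r assms(3) by auto
  ultimately show ?thesis by (auto simp: half_sector_def)
qed

text \<open>For one pair \<open>s\<close>, \<open>t\<close> the bad centres fill the line through
  both points, which has empty interior. The pairs are avoided one after the other by shrinking the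
  open set.\<close>

lemma exists_generic_centre:
  assumes "finite T" "open U" "U \<noteq> {}"
  shows "\<exists>c\<in>U. generic_centre T c"
proof -
  have line: "\<exists>U'\<subseteq>U. open U' \<and> U' \<noteq> {} \<and> (\<forall>c\<in>U'. Im ((s - c) * cnj (t - c)) \<noteq> 0)"
    if U: "open U" "U \<noteq> {}" and st: "s \<noteq> t" for s t U
  proof -
    let ?W = "U \<inter> {c. Im ((s - c) * cnj (t - c)) \<noteq> 0}"
    have "open ?W" using U by (intro open_Int open_Collect_neq continuous_intros) auto
    moreover have "?W \<noteq> {}"
    proof
      assume W: "?W = {}"
      obtain a where "a \<in> U" using U by auto
      then obtain e where e: "e > 0" "ball a e \<subseteq> U" using U open_contains_ball by metis
      define r where "r = e / (2 * norm (s - t))"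
      have r: "r > 0" "r * norm (s - t) < e" using e st by (auto simp: r_def)
      \<comment> \<open>A displacement perpendicular to the line changes the imaginary part by
        \<open>r * (norm (s - t))\<^sup>2\<close>, so \<open>a\<close> and \<open>b\<close> cannot
        both be bad.\<close>
      define b where "b = a + \<i> * of_real r * (s - t)"
      have "b \<in> U" using e r by (auto simp: b_def dist_norm norm_mult)
      have "Im ((s - b) * cnj (t - b)) = Im ((s - a) * cnj (t - a)) + r * (norm (s - t))\<^sup>2"
        unfolding cmod_power2 by (simp add: b_def algebra_simps power2_eq_square)
      moreover have "Im ((s - b) * cnj (t - b)) = 0" "Im ((s - a) * cnj (t - a)) = 0"
        using W \<open>a \<in> U\<close> \<open>b \<in> U\<close> by blast+
      ultimately show False using r st by simp
    qed
    ultimately show ?thesis by blast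
  qed
  have avoid: "\<exists>U'\<subseteq>U. open U' \<and> U' \<noteq> {} \<and> (\<forall>(s,t)\<in>P. \<forall>c\<in>U'. Im ((s - c) * cnj (t - c)) \<noteq> 0)"
    if "finite P" "\<forall>(s,t)\<in>P. s \<noteq> t" for P
    using that
  proof (induction P rule: finite_induct)
    case empty
    then show ?case using assms by auto
  next
    case (insert x P)
    obtain s t where x: "x = (s, t)" by (cases x)
    from insert obtain U' where U': "U' \<subseteq> U" "open U'" "U' \<noteq> {}"
      "\<forall>(s,t)\<in>P. \<forall>c\<in>U'. Im ((s - c) * cnj (t - c)) \<noteq> 0" by auto
    from insert.prems x have "s \<noteq> t" by auto
    from line[OF U'(2,3) this] obtain U'' where "U'' \<subseteq> U'" "open U''" "U'' \<noteq> {}"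
      "\<forall>c\<in>U''. Im ((s - c) * cnj (t - c)) \<noteq> 0" by blast
    then show ?case using U' x by (intro exI[of _ U'']) (auto; blast)
  qed
  define P where "P = {(s,t). s \<in> T \<and> t \<in> T \<and> s \<noteq> t}"
  have "finite P"
    by (rule finite_subset[of _ "T \<times> T"]) (use assms(1) in \<open>auto simp: P_def\<close>)
  from avoid[OF this] have "\<exists>U'\<subseteq>U. open U' \<and> U' \<noteq> {} \<and> (\<forall>(s,t)\<in>P. \<forall>c\<in>U'. Im ((s - c) * cnj (t - c)) \<noteq> 0)"
    by (auto simp: P_def)
  then obtain U' where U': "U' \<subseteq> U" "open U'" "U' \<noteq> {}"
    and gen: "\<forall>(s,t)\<in>P. \<forall>c\<in>U'. Im ((s - c) * cnj (t - c)) \<noteq> 0" by auto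
  have "open (U' - T)" using U' assms(1) by (intro open_Diff finite_imp_closed)
  moreover have "U' - T \<noteq> {}"
    using U' assms(1) finite_imp_not_open[of U'] finite_subset[of U' T] by auto
  ultimately obtain c where c: "c \<in> U'" "c \<notin> T" by auto
  have "Im ((s - c) / (t - c)) \<noteq> 0" if "s \<in> T" "t \<in> T" "s \<noteq> t" for s t
  proof -
    have "t - c \<noteq> 0" using that c by auto
    then have "norm (t - c) ^ 2 > 0" by simp
    moreover have "(s - c) / (t - c) = (s - c) * cnj (t - c) / of_real (norm (t - c) ^ 2)"
      by (simp add: complex_div_cnj[of "s - c" "t - c"])
    ultimately show ?thesis using gen that c(1) by (auto simp: P_def)
  qed
  then show ?thesis using c U' assms(1) by (auto simp: generic_centre_def)
qed

subsection \<open>Relations compatible with algebra and differentiation\<close>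

text \<open>These are the closure properties of the graph of a partial isomorphism of differential
  rings, taken up to equality on \<open>D\<close>: \<open>inject\<close> comprises uniqueness of
  images and injectivity, and \<open>refl\<close> says that functions holomorphic off
  \<open>T\<close> are single-valued.\<close>

locale monodromic =
  fixes T D :: "complex set" and A :: "(cfun \<times> cfun) set"
  assumes hol: "(f, g) \<in> A \<Longrightarrow> f holomorphic_on D" "(f, g) \<in> A \<Longrightarrow> g holomorphic_on D"
    and add: "(f, g) \<in> A \<Longrightarrow> (f', g') \<in> A \<Longrightarrow> (\<lambda>z. f z + f' z, \<lambda>z. g z + g' z) \<in> A"
    and mult: "(f, g) \<in> A \<Longrightarrow> (f', g') \<in> A \<Longrightarrow> (\<lambda>z. f z * f' z, \<lambda>z. g z * g' z) \<in> A"
    and deriv: "(f, g) \<in> A \<Longrightarrow> (deriv f, deriv g) \<in> A"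
    and cong: "(f, g) \<in> A \<Longrightarrow> \<forall>z\<in>D. f z = f' z \<Longrightarrow> \<forall>z\<in>D. g z = g' z \<Longrightarrow> (f', g') \<in> A"
    and inject: "(f, g) \<in> A \<Longrightarrow> (f', g') \<in> A \<Longrightarrow> (\<forall>z\<in>D. f z = f' z) = (\<forall>z\<in>D. g z = g' z)"
    and refl: "h holomorphic_on - T \<Longrightarrow> (h, h) \<in> A"

lemma monodromic_const: "monodromic T D A \<Longrightarrow> (\<lambda>_. a, \<lambda>_. a) \<in> A"
  by (erule monodromic.refl) (rule holomorphic_on_const)

lemma monodromic_crossing:
  assumes gen: "generic_centre T c" and t: "t \<in> T"
  shows "monodromic T (slit_plane T c) (crossing T c t)"
proof -
  let ?D = "slit_plane T c" and ?S = "sector T c t"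
  let ?H = "\<lambda>\<sigma>::real. half_sector T c t \<sigma>"
  have cT: "c \<notin> T" using gen by (simp add: generic_centre_def)
  note oD = open_slit_plane[OF gen]
  note oS = open_sector[OF gen t]
  have HD: "?H 1 \<subseteq> ?D" "?H (-1) \<subseteq> ?D" by (simp_all add: half_sector_subset)
  have oH: "open (?H 1)" "open (?H (-1))" by (simp_all add: open_half_sector gen t)
  have HS: "?H 1 \<subseteq> ?S" "?H (-1) \<subseteq> ?S" by (simp_all add: half_sector_subset_sector)
  have ne: "?H 1 \<noteq> {}" "?H (-1) \<noteq> {}" by (auto simp: half_sector_nonempty[OF gen t])
  have dv: "\<forall>z\<in>W. deriv f z = deriv g z" if "open W" "\<forall>z\<in>W. f z = g z" for W and f g :: cfun
  proof
    fix z assume "z \<in> W"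
    with that(1) have "\<forall>\<^sub>F x in nhds z. x \<in> W" by (simp add: eventually_nhds_in_open)
    then show "deriv f z = deriv g z"
      by (intro deriv_cong_ev) (auto elim!: eventually_mono simp: that)
  qed
  have id: "\<forall>z\<in>E. f z = g z" if "open W" "W \<noteq> {}" "W \<subseteq> E" "open E" "connected E" "f holomorphic_on E"
     "g holomorphic_on E" "\<forall>z\<in>W. f z = g z" for W E and f g :: cfun
    using analytic_continuation_open[of W E f g] that by blast
  \<comment> \<open>Equality passes from the slit plane to one half sector, by the identity theorem
    to the whole sector, and from its other half back to the slit plane. The sign \<sigma> serves
    both directions.\<close>
  have inj: "\<forall>z\<in>?D. g z = g' z"
    if "f holomorphic_on ?D" "f' holomorphic_on ?D" "g holomorphic_on ?D" "g' holomorphic_on ?D"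
      "h holomorphic_on ?S" "h' holomorphic_on ?S"
      "\<forall>z\<in>?H \<sigma>. h z = f z" "\<forall>z\<in>?H (-\<sigma>). h z = g z"
      "\<forall>z\<in>?H \<sigma>. h' z = f' z" "\<forall>z\<in>?H (-\<sigma>). h' z = g' z" "\<forall>z\<in>?D. f z = f' z" "\<sigma> = 1 \<or> \<sigma> = -1"
    for f g f' g' h h' \<sigma>
  proof -
    have sub: "?H \<sigma> \<subseteq> ?D" "?H (-\<sigma>) \<subseteq> ?D" "?H \<sigma> \<subseteq> ?S" "?H (-\<sigma>) \<subseteq> ?S"
      by (simp_all add: half_sector_subset half_sector_subset_sector)
    have ne': "?H \<sigma> \<noteq> {}" "?H (-\<sigma>) \<noteq> {}" using ne that(12) by auto
    have "\<forall>z\<in>?H \<sigma>. h z = h' z" using that(7,9,11) sub(1) by (metis subsetD)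
    from id[OF open_half_sector[OF gen t] ne'(1) sub(3) oS convex_connected[OF convex_sector] that(5,6) this]
    have "\<forall>z\<in>?S. h z = h' z" .
    then have "\<forall>z\<in>?H (-\<sigma>). g z = g' z" using that(8,10) sub(4) by (metis subsetD)
    from id[OF open_half_sector[OF gen t] ne'(2) sub(2) oD connected_slit_plane that(3,4) this]
    show ?thesis .
  qed
  show ?thesis
  proof
    fix f g f' g' assume a: "(f, g) \<in> crossing T c t" "(f', g') \<in> crossing T c t"
    then obtain h h' where h: "f holomorphic_on ?D" "f' holomorphic_on ?D" "g holomorphic_on ?D" "g' holomorphic_on ?D"
      "h holomorphic_on ?S" "\<forall>z\<in>?H 1. h z = f z" "\<forall>z\<in>?H (-1). h z = g z"
      "h' holomorphic_on ?S" "\<forall>z\<in>?H 1. h' z = f' z" "\<forall>z\<in>?H (-1). h' z = g' z"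
      by (auto simp: crossing_def)
    show "(\<lambda>z. f z + f' z, \<lambda>z. g z + g' z) \<in> crossing T c t"
      unfolding crossing_def using h
      by (auto intro!: holomorphic_intros exI[of _ "\<lambda>z. h z + h' z"])
    show "(\<lambda>z. f z * f' z, \<lambda>z. g z * g' z) \<in> crossing T c t"
      unfolding crossing_def using h
      by (auto intro!: holomorphic_intros exI[of _ "\<lambda>z. h z * h' z"])
    show "(\<forall>z\<in>?D. f z = f' z) = (\<forall>z\<in>?D. g z = g' z)"
    proof
      assume "\<forall>z\<in>?D. f z = f' z"
      from inj[OF h(1-5,8) h(6,7,9,10) this] show "\<forall>z\<in>?D. g z = g' z" by simp
    next
      assume gg: "\<forall>z\<in>?D. g z = g' z"
      have h': "\<forall>z\<in>?H (- (-1)). h z = f z" "\<forall>z\<in>?H (- (-1)). h' z = f' z" using h by simp_all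
      from inj[OF h(3,4,1,2,5,8) h(7) h'(1) h(10) h'(2) gg] show "\<forall>z\<in>?D. f z = f' z" by simp
    qed
  next
    fix f g assume "(f, g) \<in> crossing T c t"
    then obtain h where h: "f holomorphic_on ?D" "g holomorphic_on ?D"
      "h holomorphic_on ?S" "\<forall>z\<in>?H 1. h z = f z" "\<forall>z\<in>?H (-1). h z = g z"
      by (auto simp: crossing_def)
    then show "f holomorphic_on ?D" "g holomorphic_on ?D" by auto
    show "(deriv f, deriv g) \<in> crossing T c t"
      unfolding crossing_def using h dv[OF oH(1) h(4)] dv[OF oH(2) h(5)] oD oS
      by (auto intro!: holomorphic_deriv exI[of _ "deriv h"])
    fix f' g' assume "\<forall>z\<in>?D. f z = f' z" "\<forall>z\<in>?D. g z = g' z"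
    moreover from this h have "f' holomorphic_on ?D" "g' holomorphic_on ?D"
      using holomorphic_transform by metis+
    ultimately show "(f', g') \<in> crossing T c t"
      unfolding crossing_def using h HD by (auto intro!: exI[of _ h]; force)
  next
    fix h :: cfun assume "h holomorphic_on - T"
    then show "(h, h) \<in> crossing T c t"
      unfolding crossing_def
      using holomorphic_on_subset[OF _ slit_plane_subset_compl[OF cT]]
        holomorphic_on_subset[OF _ sector_disjoint[OF cT, of t]] by auto
  qed
qed

lemma monodromic_converse:
  assumes "monodromic T D A" shows "monodromic T D (A\<inverse>)"
proof -
  interpret monodromic T D A by fact
  show ?thesis
    by unfold_locales (simp_all add: hol add mult deriv inject refl, use cong in blast)
qed

lemma monodromic_relcomp:
  assumes "monodromic T D A" "monodromic T D B"
  shows "monodromic T D (A O B)"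
proof -
  interpret A: monodromic T D A by fact
  interpret B: monodromic T D B by fact
  show ?thesis
  proof
    fix f g f' g' assume "(f, g) \<in> A O B" "(f', g') \<in> A O B"
    then obtain m m' where m: "(f, m) \<in> A" "(m, g) \<in> B" "(f', m') \<in> A" "(m', g') \<in> B" by auto
    show "(\<lambda>z. f z + f' z, \<lambda>z. g z + g' z) \<in> A O B" "(\<lambda>z. f z * f' z, \<lambda>z. g z * g' z) \<in> A O B"
      using A.add[OF m(1,3)] B.add[OF m(2,4)] A.mult[OF m(1,3)] B.mult[OF m(2,4)] by blast+
    show "(\<forall>z\<in>D. f z = f' z) = (\<forall>z\<in>D. g z = g' z)"
      using A.inject[OF m(1,3)] B.inject[OF m(2,4)] by simp
  next
    fix f g assume "(f, g) \<in> A O B"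
    then obtain m where m: "(f, m) \<in> A" "(m, g) \<in> B" by auto
    then show "f holomorphic_on D" "g holomorphic_on D" using A.hol(1) B.hol(2) by blast+
    show "(deriv f, deriv g) \<in> A O B" using A.deriv[OF m(1)] B.deriv[OF m(2)] by blast
    fix f' g' assume "\<forall>z\<in>D. f z = f' z" "\<forall>z\<in>D. g z = g' z"
    then show "(f', g') \<in> A O B" using A.cong[OF m(1), of f' m] B.cong[OF m(2), of m g'] by blast
  next
    fix h :: cfun assume "h holomorphic_on - T"
    then show "(h, h) \<in> A O B" using A.refl B.refl by blast
  qed
qed

lemma monodromic_relpow:
  assumes A: "monodromic T D A" and "m > 0" shows "monodromic T D (A ^^ m)"
proof -
  have "monodromic T D (A ^^ Suc k)" for k
  proof (induction k)
    case 0
    show ?case using A by simp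
  next
    case (Suc k)
    from monodromic_relcomp[OF this A] show ?case by simp
  qed
  then show ?thesis using assms(2) by (cases m) auto
qed

section \<open>Relations total on a space of functions, and their nested commutators\<close>

definition total_on_both :: "('a \<times> 'a) set \<Rightarrow> 'a set \<Rightarrow> bool" where
  "total_on_both A V \<longleftrightarrow> (\<forall>v\<in>V. \<exists>w\<in>V. (v, w) \<in> A) \<and> (\<forall>w\<in>V. \<exists>v\<in>V. (v, w) \<in> A)"

lemma total_on_both_converse: "total_on_both A V \<Longrightarrow> total_on_both (A\<inverse>) V"
  by (auto simp: total_on_both_def)

lemma total_on_both_relcomp: "total_on_both A V \<Longrightarrow> total_on_both B V \<Longrightarrow> total_on_both (A O B) V"
  unfolding total_on_both_def by blast

lemma total_on_both_relpow:
  assumes "total_on_both A V" shows "total_on_both (A ^^ m) V"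
proof (induction m)
  case 0
  show ?case by (simp add: total_on_both_def)
next
  case (Suc m)
  from total_on_both_relcomp[OF this assms] show ?case by simp
qed

lemma relpow_refl_at: "(v, v) \<in> A \<Longrightarrow> (v, v) \<in> A ^^ m"
  by (induction m) auto

definition commutator :: "('a \<times> 'a) set \<Rightarrow> ('a \<times> 'a) set \<Rightarrow> ('a \<times> 'a) set" where
  "commutator A B = A O B O A\<inverse> O B\<inverse>"

lemma monodromic_commutator:
  "monodromic T D A \<Longrightarrow> monodromic T D B \<Longrightarrow> monodromic T D (commutator A B)"
  unfolding commutator_def by (intro monodromic_relcomp monodromic_converse)

lemma total_on_both_commutator:
  "total_on_both A V \<Longrightarrow> total_on_both B V \<Longrightarrow> total_on_both (commutator A B) V"
  unfolding commutator_def by (intro total_on_both_relcomp total_on_both_converse)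

text \<open>The path is \<open>v\<close>, \<open>v\<close>, \<open>w\<close>, \<open>w\<close>,
  \<open>v\<close>: both steps of \<open>A\<close> stand still and \<open>B\<inverse>\<close> undoes
  \<open>B\<close>. Totality of \<open>B\<close> guarantees that some \<open>w\<close>
  exists.\<close>

lemma commutator_fixes_left:
  assumes "\<And>v. v \<in> V \<Longrightarrow> (v, v) \<in> A" "total_on_both B V" "v \<in> V"
  shows "(v, v) \<in> commutator A B"
proof -
  obtain w where "w \<in> V" "(v, w) \<in> B" using assms by (auto simp: total_on_both_def)
  then show ?thesis using assms(1)[of v] assms(1)[of w] assms(3) unfolding commutator_def by blast
qed

lemma commutator_fixes_right:
  assumes "\<And>v. v \<in> V \<Longrightarrow> (v, v) \<in> B" "total_on_both A V" "v \<in> V"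
  shows "(v, v) \<in> commutator A B"
proof -
  obtain w where "w \<in> V" "(v, w) \<in> A" using assms by (auto simp: total_on_both_def)
  then show ?thesis using assms(1)[of v] assms(1)[of w] assms(3) unfolding commutator_def by blast
qed

text \<open>A one-letter word is a base case of its own, since a commutator with \<open>Id\<close>
  would collapse to \<open>R t O (R t)\<inverse>\<close>.\<close>

fun nested :: "(complex \<Rightarrow> ('a \<times> 'a) set) \<Rightarrow> complex list \<Rightarrow> ('a \<times> 'a) set" where
  "nested R [] = Id"
| "nested R [t] = R t"
| "nested R (t # s # ts) = commutator (R t) (nested R (s # ts))"

lemma monodromic_nested:
  "ts \<noteq> [] \<Longrightarrow> (\<And>t. t \<in> set ts \<Longrightarrow> monodromic T D (R t)) \<Longrightarrow> monodromic T D (nested R ts)"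
proof (induction R ts rule: nested.induct)
  case (3 R t s ts)
  show ?case unfolding nested.simps
    by (rule monodromic_commutator[OF "3.prems"(2) "3.IH"]) (simp_all add: "3.prems"(2))
qed simp_all

lemma total_on_both_nested:
  "(\<And>t. t \<in> set ts \<Longrightarrow> total_on_both (R t) V) \<Longrightarrow> total_on_both (nested R ts) V"
proof (induction R ts rule: nested.induct)
  case (1 R)
  show ?case by (simp add: total_on_both_def)
next
  case (3 R t s ts)
  show ?case unfolding nested.simps
    by (rule total_on_both_commutator[OF "3.prems" "3.IH"]) (simp_all add: "3.prems")
qed simp_all

text \<open>The position of the trivial letter is irrelevant: at the head it is a trivial left entry
  of the commutator, and further inside it makes the right entry trivial by induction. The other
  letters must be total on \<open>V\<close> so that the path can be followed.\<close>

lemma nested_fixes: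
  assumes "\<And>t. t \<in> set ts \<Longrightarrow> total_on_both (R t) V" "\<exists>t\<in>set ts. \<forall>v\<in>V. (v, v) \<in> R t" "v \<in> V"
  shows "(v, v) \<in> nested R ts"
  using assms
proof (induction R ts arbitrary: v rule: nested.induct)
  case (1 R)
  then show ?case by simp
next
  case (2 R t)
  then show ?case by simp
next
  case (3 R t s ts)
  show ?case
  proof (cases "\<forall>v\<in>V. (v, v) \<in> R t")
    case True
    have "total_on_both (nested R (s # ts)) V"
      by (rule total_on_both_nested) (simp add: "3.prems"(1))
    with True show ?thesis unfolding nested.simps
      using "3.prems"(3) by (intro commutator_fixes_left[of V]) blast+
  next
    case False
    then have ex: "\<exists>t\<in>set (s # ts). \<forall>v\<in>V. (v, v) \<in> R t" using "3.prems"(2) by auto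
    have "(w, w) \<in> nested R (s # ts)" if "w \<in> V" for w
      by (rule "3.IH"[OF _ ex that]) (simp add: "3.prems"(1))
    then show ?thesis unfolding nested.simps
      by (rule commutator_fixes_right[OF _ _ "3.prems"(3)]) (simp_all add: "3.prems"(1))
  qed
qed

abbreviation loop_rel :: "complex list \<Rightarrow> nat \<Rightarrow> complex set \<Rightarrow> complex \<Rightarrow> (cfun \<times> cfun) set" where
  "loop_rel ts m T c \<equiv> nested (\<lambda>t. crossing T c t ^^ m) ts"

subsection \<open>Monodromy of linear systems\<close>

definition sol_space :: "nat \<Rightarrow> (nat \<Rightarrow> nat \<Rightarrow> cfun) \<Rightarrow> complex set \<Rightarrow> cfun set" where
  "sol_space n B D = {f. \<exists>Z. lin_sol n B D Z \<and> (\<forall>z\<in>D. f z = Z 0 z)}"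

lemma lin_sol_exists_slit_plane:
  assumes "generic_centre T c" "\<And>i j. i < n \<Longrightarrow> j < n \<Longrightarrow> B i j holomorphic_on - T" "q \<in> slit_plane T c"
  shows "\<exists>Z. lin_sol n B (slit_plane T c) Z \<and> (\<forall>i<n. Z i q = v i)"
  by (rule lin_sol_exists[OF open_slit_plane[OF assms(1)] centre_in_slit_plane slit_plane_star
        holomorphic_on_slit_plane[OF assms(2,1)] assms(3)])

lemma lin_sol_unique_slit_plane:
  assumes gen: "generic_centre T c" and "\<And>i j. i < n \<Longrightarrow> j < n \<Longrightarrow> B i j holomorphic_on - T"
    and "lin_sol n B (slit_plane T c) Z" "lin_sol n B (slit_plane T c) Z'" "q \<in> slit_plane T c"
    and "\<And>i. i < n \<Longrightarrow> Z i q = Z' i q" "i < n" "z \<in> slit_plane T c"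
  shows "Z i z = Z' i z"
  by (rule lin_sol_unique[OF assms(3,4) open_slit_plane[OF gen] connected_slit_plane assms(5)
        holomorphic_on_slit_plane[OF assms(2) gen] assms(6,7,8)])

text \<open>The vector is restarted twice: in the sector with the value of \<open>Z\<close> at a
  point of one half, then on the slit plane with the resulting value at a point of the other half.
  The halves are convex, so uniqueness applies on each of them.\<close>

lemma lin_sol_cross:
  assumes gen: "generic_centre T c" and t: "t \<in> T"
    and hol: "\<And>i j. i < n \<Longrightarrow> j < n \<Longrightarrow> B i j holomorphic_on - T"
    and Z: "lin_sol n B (slit_plane T c) Z" and \<sigma>: "\<sigma> = 1 \<or> \<sigma> = -1"
  shows "\<exists>Z' H. lin_sol n B (slit_plane T c) Z' \<and> lin_sol n B (sector T c t) H \<and>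
     (\<forall>i<n. (\<forall>z\<in>half_sector T c t \<sigma>. H i z = Z i z) \<and> (\<forall>z\<in>half_sector T c t (-\<sigma>). H i z = Z' i z))"
proof -
  let ?D = "slit_plane T c" and ?S = "sector T c t" and ?P = "half_sector T c t \<sigma>" and ?Q = "half_sector T c t (-\<sigma>)"
  have cT: "c \<notin> T" using gen by (simp add: generic_centre_def)
  have holS: "B i j holomorphic_on ?S" if "i < n" "j < n" for i j
    using hol[OF that] sector_disjoint[OF cT, of t] by (rule holomorphic_on_subset)
  have holP: "B i j holomorphic_on half_sector T c t s" if "i < n" "j < n" for i j s
    using holS[OF that] half_sector_subset_sector by (rule holomorphic_on_subset)
  have seg: "closed_segment a z \<subseteq> ?S" if "a \<in> ?S" "z \<in> ?S" for a z
    using convex_sector that closed_segment_subset by blast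
  obtain p where p: "p \<in> ?P" using half_sector_nonempty[OF gen t \<sigma>] by auto
  then have pS: "p \<in> ?S" by (simp add: half_sector_def)
  have "\<exists>H. lin_sol n B ?S H \<and> (\<forall>i<n. H i p = Z i p)"
    by (rule lin_sol_exists_centre[OF open_sector[OF gen t] pS seg[OF pS] holS])
  then obtain H where H: "lin_sol n B ?S H" "\<forall>i<n. H i p = Z i p" by blast
  obtain q where q: "q \<in> ?Q" using half_sector_nonempty[OF gen t, of "-\<sigma>"] \<sigma> by auto
  then have qD: "q \<in> ?D" using half_sector_subset[of T c t "-\<sigma>"] by auto
  have "\<exists>Z'. lin_sol n B ?D Z' \<and> (\<forall>i<n. Z' i q = H i q)"
    by (rule lin_sol_exists_slit_plane[OF gen hol qD])
  then obtain Z' where Z': "lin_sol n B ?D Z'" "\<forall>i<n. Z' i q = H i q" by blast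
  have "H i z = Z i z" if "i < n" "z \<in> ?P" for i z
    by (rule lin_sol_unique[OF lin_sol_subset[OF H(1) half_sector_subset_sector]
          lin_sol_subset[OF Z half_sector_subset] open_half_sector[OF gen t]
          convex_connected[OF convex_half_sector] p holP _ that]) (use H in auto)
  moreover have "H i z = Z' i z" if "i < n" "z \<in> ?Q" for i z
    by (rule lin_sol_unique[OF lin_sol_subset[OF H(1) half_sector_subset_sector]
          lin_sol_subset[OF Z'(1) half_sector_subset] open_half_sector[OF gen t]
          convex_connected[OF convex_half_sector] q holP _ that]) (use Z' in auto)
  ultimately show ?thesis using H Z' by blast
qed

lemma total_on_both_crossing:
  assumes gen: "generic_centre T c" and t: "t \<in> T" and "n > 0"
    and hol: "\<And>i j. i < n \<Longrightarrow> j < n \<Longrightarrow> B i j holomorphic_on - T"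
  shows "total_on_both (crossing T c t) (sol_space n B (slit_plane T c))"
proof -
  let ?D = "slit_plane T c"
  note oD = open_slit_plane[OF gen] and oS = open_sector[OF gen t]
  \<comment> \<open>The sign 1 provides images under the crossing, the sign -1 preimages.\<close>
  have main: "\<exists>Z'. lin_sol n B ?D Z' \<and> f holomorphic_on ?D \<and> Z' 0 holomorphic_on ?D \<and>
      (\<exists>h. h holomorphic_on sector T c t \<and> (\<forall>z\<in>half_sector T c t \<sigma>. h z = f z) \<and>
        (\<forall>z\<in>half_sector T c t (-\<sigma>). h z = Z' 0 z))"
    if f: "f \<in> sol_space n B ?D" and \<sigma>: "\<sigma> = 1 \<or> \<sigma> = -1" for f \<sigma>
  proof -
    obtain Z where Z: "lin_sol n B ?D Z" "\<forall>z\<in>?D. f z = Z 0 z" using f by (auto simp: sol_space_def)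
    obtain Z' H where *: "lin_sol n B ?D Z'" "lin_sol n B (sector T c t) H"
      "\<forall>i<n. (\<forall>z\<in>half_sector T c t \<sigma>. H i z = Z i z) \<and> (\<forall>z\<in>half_sector T c t (-\<sigma>). H i z = Z' i z)"
      using lin_sol_cross[OF gen t hol Z(1) \<sigma>] by blast
    have "f holomorphic_on ?D"
      using lin_sol_holomorphic[OF Z(1) \<open>n > 0\<close> oD] Z(2) by (metis holomorphic_transform)
    moreover have "\<forall>z\<in>half_sector T c t \<sigma>. H 0 z = f z"
      using * Z(2) \<open>n > 0\<close> half_sector_subset[of T c t \<sigma>] by auto
    ultimately show ?thesis
      using * \<open>n > 0\<close> lin_sol_holomorphic[OF *(1) \<open>n > 0\<close> oD] lin_sol_holomorphic[OF *(2) \<open>n > 0\<close> oS] by blast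
  qed
  show ?thesis unfolding total_on_both_def
  proof (intro conjI ballI)
    fix f assume f: "f \<in> sol_space n B ?D"
    from main[OF f, of 1] obtain Z' where "lin_sol n B ?D Z'" "(f, Z' 0) \<in> crossing T c t"
      unfolding crossing_def by auto
    then show "\<exists>g\<in>sol_space n B ?D. (f, g) \<in> crossing T c t" by (auto simp: sol_space_def)
    from main[OF f, of "-1"] obtain Z' where "lin_sol n B ?D Z'" "(Z' 0, f) \<in> crossing T c t"
      unfolding crossing_def by auto
    then show "\<exists>g\<in>sol_space n B ?D. (g, f) \<in> crossing T c t" by (auto simp: sol_space_def)
  qed
qed

lemma crossing_refl_extends:
  assumes cT: "c \<notin> T" and "f holomorphic_on slit_plane (T - {t}) c"
  shows "(f, f) \<in> crossing T c t"
  using holomorphic_on_subset[OF assms(2) slit_plane_antimono, of T]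
    holomorphic_on_subset[OF assms(2) sector_subset] by (auto simp: crossing_def)

text \<open>The system has no pole at \<open>t\<close>. By uniqueness from the centre the solution
  is therefore the restriction of one on the larger plane slit only at \<open>S\<close>, which
  passes smoothly through the slit at \<open>t\<close>.\<close>

lemma crossing_fixes_sol_space:
  assumes gen: "generic_centre T c" and t: "t \<in> T - S" and "S \<subseteq> T" and "n > 0"
    and hol: "\<And>i j. i < n \<Longrightarrow> j < n \<Longrightarrow> B i j holomorphic_on - S"
    and f: "f \<in> sol_space n B (slit_plane T c)"
  shows "(f, f) \<in> crossing T c t"
proof -
  have genS: "generic_centre S c" using gen \<open>S \<subseteq> T\<close> by (rule generic_centre_subset)
  have holT: "B i j holomorphic_on - T" if "i < n" "j < n" for i j
    using hol[OF that] \<open>S \<subseteq> T\<close> by (auto intro: holomorphic_on_subset)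
  obtain Z where Z: "lin_sol n B (slit_plane T c) Z" "\<forall>z\<in>slit_plane T c. f z = Z 0 z"
    using f by (auto simp: sol_space_def)
  have "\<exists>Y. lin_sol n B (slit_plane S c) Y \<and> (\<forall>i<n. Y i c = Z i c)"
    by (rule lin_sol_exists_slit_plane[OF genS hol centre_in_slit_plane])
  then obtain Y where Y: "lin_sol n B (slit_plane S c) Y" "\<forall>i<n. Y i c = Z i c" by blast
  have "Y 0 z = Z 0 z" if "z \<in> slit_plane T c" for z
    by (rule lin_sol_unique_slit_plane[OF gen holT lin_sol_subset[OF Y(1) slit_plane_antimono[OF \<open>S \<subseteq> T\<close>]] Z(1)
          centre_in_slit_plane _ \<open>n > 0\<close> that]) (use Y in auto)
  moreover have "(Y 0, Y 0) \<in> crossing T c t"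
  proof (rule crossing_refl_extends)
    show "c \<notin> T" using gen by (simp add: generic_centre_def)
    have "Y 0 holomorphic_on slit_plane S c" by (rule lin_sol_holomorphic[OF Y(1) \<open>n > 0\<close> open_slit_plane[OF genS]])
    then show "Y 0 holomorphic_on slit_plane (T - {t}) c"
      by (rule holomorphic_on_subset) (use t \<open>S \<subseteq> T\<close> in \<open>auto intro!: slit_plane_antimono\<close>)
  qed
  ultimately show ?thesis
    using monodromic.cong[OF monodromic_crossing[OF gen], of t "Y 0" "Y 0" f f] t Z(2) by auto
qed

subsection \<open>Algebraic solutions have finite orbits\<close>

text \<open>The outer variable receives the function value \<open>y\<close>, as a constant
  polynomial, and the coefficients are then evaluated at \<open>z\<close>.\<close>

abbreviation poly2 :: "complex poly poly \<Rightarrow> complex \<Rightarrow> complex \<Rightarrow> complex" where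
  "poly2 P y z \<equiv> poly (poly P [:y:]) z"

lemma poly_poly_const: "poly2 P y z = poly (map_poly (\<lambda>p. poly p z) P) (y :: complex)"
  by (induction P) (auto simp: map_poly_pCons)

lemma holomorphic_poly_poly [holomorphic_intros]:
  "f holomorphic_on D \<Longrightarrow> (\<lambda>z. poly2 P (f z) z) holomorphic_on D"
  by (induction P) (auto intro!: holomorphic_intros)

lemma monodromic_poly_poly:
  assumes A: "monodromic T D A" and "(f, g) \<in> A"
  shows "(\<lambda>z. poly2 P (f z) z, \<lambda>z. poly2 P (g z) z) \<in> A"
proof (induction P)
  case 0
  show ?case using monodromic_const[OF A] by simp
next
  case (pCons p P)
  have "(poly p, poly p) \<in> A" by (rule monodromic.refl[OF A]) (auto intro!: holomorphic_intros)
  from monodromic.add[OF A this monodromic.mult[OF A assms(2) pCons.IH]] show ?case by simp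
qed

lemma exists_open_nonzero:
  assumes D: "open D" "connected D" and W: "open W" "W \<noteq> {}" "W \<subseteq> D" and "finite I"
    and "\<And>i. i \<in> I \<Longrightarrow> g i holomorphic_on D" "\<And>i. i \<in> I \<Longrightarrow> \<exists>z\<in>D. g i z \<noteq> 0"
  shows "\<exists>W'\<subseteq>W. open W' \<and> W' \<noteq> {} \<and> (\<forall>i\<in>I. \<forall>z\<in>W'. g i z \<noteq> (0::complex))"
  using assms(6-)
proof (induction I rule: finite_induct)
  case empty
  then show ?case using W by auto
next
  case (insert i I)
  then obtain W' where W': "W' \<subseteq> W" "open W'" "W' \<noteq> {}" "\<forall>i\<in>I. \<forall>z\<in>W'. g i z \<noteq> 0" by auto
  have hol: "g i holomorphic_on D" and ne: "\<exists>z\<in>D. g i z \<noteq> 0" using insert.prems by auto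
  have "\<exists>w\<in>W'. g i w \<noteq> 0"
  proof (rule ccontr)
    assume "\<not> (\<exists>w\<in>W'. g i w \<noteq> 0)"
    then have "g i z = 0" if "z \<in> D" for z
      using analytic_continuation_open[of W' D "g i" "\<lambda>_. 0" z] W' W D hol that by auto
    then show False using ne by auto
  qed
  moreover have "open {z \<in> W'. g i z \<noteq> 0}"
  proof -
    have "continuous_on W' (g i)"
      using hol W' W by (meson holomorphic_on_imp_continuous_on holomorphic_on_subset order_trans)
    from open_nonzero[OF this W'(2)] show ?thesis .
  qed
  ultimately show ?case using W' by (intro exI[of _ "{z \<in> W'. g i z \<noteq> 0}"]) auto
qed

text \<open>Pairwise different holomorphic functions take pairwise different values on some open
  set, and at a point of it \<open>degree P + 1\<close> values are too many roots for one
  polynomial.\<close>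

lemma few_algebraic_functions:
  assumes D: "open D" "connected D" "D \<noteq> {}" and "P \<noteq> 0"
    and f: "\<And>k. k \<le> degree P \<Longrightarrow> f k holomorphic_on D"
      "\<And>k z. k \<le> degree P \<Longrightarrow> z \<in> D \<Longrightarrow> poly2 P (f k z) z = 0"
  shows "\<exists>i j. i < j \<and> j \<le> degree P \<and> (\<forall>z\<in>D. f i z = f j z)"
proof (rule ccontr)
  assume neg: "\<not> ?thesis"
  let ?d = "degree P"
  let ?I = "{(i, j). i < j \<and> j \<le> ?d}"
  have "finite ?I" by (rule finite_subset[of _ "{..?d} \<times> {..?d}"]) auto
  moreover have "\<exists>z\<in>D. (case p of (i, j) \<Rightarrow> \<lambda>z. f i z - f j z) z \<noteq> 0" if "p \<in> ?I" for p
    using neg that by auto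
  moreover have "(case p of (i, j) \<Rightarrow> \<lambda>z. f i z - f j z) holomorphic_on D" if "p \<in> ?I" for p
    using that f(1) by (auto intro!: holomorphic_intros)
  ultimately obtain W where W: "W \<subseteq> D" "open W" "W \<noteq> {}"
    "\<forall>p\<in>?I. \<forall>z\<in>W. (case p of (i, j) \<Rightarrow> \<lambda>z. f i z - f j z) z \<noteq> 0"
    using exists_open_nonzero[OF D(1,2) D(1,3) subset_refl, of ?I "\<lambda>(i, j) z. f i z - f j z"] by auto
  \<comment> \<open>Away from the zeros of the leading coefficient the specialised polynomial
    \<open>Q\<close> below is nonzero, as the root count requires.\<close>
  have "finite {z. poly (lead_coeff P) z = 0}" using \<open>P \<noteq> 0\<close> by (simp add: poly_roots_finite)
  then obtain z where z: "z \<in> W" "poly (lead_coeff P) z \<noteq> 0"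
    using W(2,3) finite_imp_not_open[of W] finite_subset[of W "{z. poly (lead_coeff P) z = 0}"] by auto
  define Q where "Q = map_poly (\<lambda>p. poly p z) P"
  have "coeff Q ?d \<noteq> 0" using z by (simp add: Q_def coeff_map_poly)
  then have "Q \<noteq> 0" by auto
  have "degree Q \<le> ?d" unfolding Q_def by (intro degree_le) (simp add: coeff_map_poly coeff_eq_0)
  have "inj_on (\<lambda>k. f k z) {..?d}"
  proof (rule linorder_inj_onI)
    fix i j assume "i < j" "i \<in> {..?d}" "j \<in> {..?d}"
    then show "f i z \<noteq> f j z" using W(4)[rule_format, of "(i, j)" z] z(1) by auto
  qed auto
  then have "card ((\<lambda>k. f k z) ` {..?d}) = Suc ?d" by (simp add: card_image)
  moreover have "(\<lambda>k. f k z) ` {..?d} \<subseteq> {y. poly Q y = 0}"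
    using f(2) z W(1) unfolding Q_def poly_poly_const[symmetric] by auto
  ultimately have "Suc ?d \<le> card {y. poly Q y = 0}"
    using card_mono poly_roots_finite[OF \<open>Q \<noteq> 0\<close>] by metis
  then show False using card_poly_roots_bound[OF \<open>Q \<noteq> 0\<close>] \<open>degree Q \<le> ?d\<close> by linarith
qed

text \<open>Following \<open>f\<close> through the relation inside \<open>V\<close> gives a sequence
  of roots of \<open>P\<close>, of which the first \<open>degree P + 1\<close> cannot be distinct.
  The period is at most \<open>degree P\<close>, so it divides the factorial and hence
  \<open>m\<close>.\<close>

lemma relpow_fact_fixes:
  assumes A: "monodromic T D A" and D: "open D" "connected D" "D \<noteq> {}" and "P \<noteq> 0"
    and tot: "total_on_both A V" and V: "\<And>f z. f \<in> V \<Longrightarrow> z \<in> D \<Longrightarrow> poly2 P (f z) z = 0"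
    and "f \<in> V" and m: "fact (degree P) dvd m" "m > 0"
  shows "(f, f) \<in> A ^^ m"
proof -
  obtain F where F: "F 0 = f" "\<And>k. F k \<in> V" "\<And>k. (F k, F (Suc k)) \<in> A"
  proof -
    have "\<exists>F. \<forall>k. (F k \<in> V \<and> (k = 0 \<longrightarrow> F k = f)) \<and> (F k, F (Suc k)) \<in> A"
      by (rule dependent_nat_choice) (use tot \<open>f \<in> V\<close> in \<open>auto simp: total_on_both_def\<close>)
    then show ?thesis using that by blast
  qed
  have "F k holomorphic_on D" for k using monodromic.hol(1)[OF A F(3)] .
  then obtain i j where ij: "i < j" "j \<le> degree P" "\<forall>z\<in>D. F i z = F j z"
    using few_algebraic_functions[OF D \<open>P \<noteq> 0\<close>, of F] V F(2) by blast
  define p where "p = j - i"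
  have "p > 0" using ij by (simp add: p_def)
  \<comment> \<open>Injectivity of the relation moves the coincidence of \<open>F i\<close> and
    \<open>F j\<close> down to one of \<open>F 0\<close> and \<open>F (j - i)\<close>.\<close>
  have Fp: "\<forall>z\<in>D. F 0 z = F p z"
    using ij(1,3) unfolding p_def
  proof (induction i arbitrary: j)
    case (Suc i)
    obtain j' where j': "j = Suc j'" using Suc.prems by (cases j) auto
    have "\<forall>z\<in>D. F i z = F j' z"
      using monodromic.inject[OF A F(3)[of i] F(3)[of j']] Suc.prems j' by auto
    then show ?case using Suc.IH[of j'] Suc.prems j' by auto
  qed simp
  have "(F 0, F k) \<in> A ^^ k" for k
    by (induction k) (use F(3) in \<open>auto intro: relpow_Suc_I\<close>)
  from monodromic.cong[OF monodromic_relpow[OF A \<open>p > 0\<close>] this[of p], of f f]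
  have ff: "(f, f) \<in> A ^^ p" using F(1) Fp by metis
  have "p dvd fact (degree P)"
    using ij \<open>p > 0\<close> by (intro dvd_fact) (auto simp: p_def)
  with m obtain q where q: "m = p * q" by (meson dvdE dvd_trans)
  have "(f, f) \<in> A ^^ (p * q)"
  proof (induction q)
    case (Suc q)
    from relcompI[OF ff this] show ?case by (simp add: relpow_add)
  qed simp
  then show ?thesis using q by simp
qed

subsection \<open>Logarithms and hyperlogarithms\<close>

text \<open>For \<open>t \<noteq> c\<close> the argument equals \<open>(t - z) / (t - c)\<close> and
  is a nonpositive real exactly on the slit: a branch of the logarithm of \<open>z - t\<close>, up
  to a constant, cut along the slit.\<close>

definition slit_log :: "complex \<Rightarrow> complex \<Rightarrow> cfun" where
  "slit_log c t z = Ln (1 - (z - c) / (t - c))"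

lemma one_minus_mult_nonzero: "z \<noteq> inverse k \<Longrightarrow> 1 - k * z \<noteq> (0 :: complex)"
  by (metis eq_iff_diff_eq_0 inverse_unique)

lemma slit_log_arg:
  assumes "z \<notin> slit c t" shows "1 - (z - c) / (t - c) \<notin> \<real>\<^sub>\<le>\<^sub>0"
  using assms unfolding slit_def complex_nonpos_Reals_iff by auto

lemma slit_log_deriv:
  assumes "z \<notin> slit c t" "t \<noteq> c"
  shows "(slit_log c t has_field_derivative 1 / (z - t)) (at z)"
proof -
  have "z \<noteq> t" using assms end_in_slit by auto
  have "((\<lambda>z. Ln (1 - (z - c) / (t - c))) has_field_derivative
      inverse (1 - (z - c) / (t - c)) * (- 1 / (t - c))) (at z)"
    using assms slit_log_arg[OF assms(1)] by (auto intro!: derivative_eq_intros)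
  moreover have "inverse (1 - (z - c) / (t - c)) * (- 1 / (t - c)) = 1 / (z - t)"
    using assms(2) \<open>z \<noteq> t\<close> by (simp add: divide_simps)
  ultimately show ?thesis unfolding slit_log_def[abs_def] by simp
qed

lemma slit_log_holomorphic:
  assumes "t \<in> T" "c \<notin> T" shows "slit_log c t holomorphic_on slit_plane T c"
proof -
  have "\<exists>d. (slit_log c t has_field_derivative d) (at z within slit_plane T c)" if "z \<in> slit_plane T c" for z
    using slit_log_deriv[of z c t] that assms by (auto simp: slit_plane_def intro: has_field_derivative_at_within)
  then show ?thesis by (auto simp: holomorphic_on_def field_differentiable_def)
qed

lemma slit_log_crossing:
  assumes gen: "generic_centre T c" and t: "t \<in> T"
  shows "(slit_log c t, \<lambda>z. slit_log c t z - 2 * pi * \<i>) \<in> crossing T c t"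
proof -
  have tc: "t \<noteq> c" "c \<notin> T" using assms by (auto simp: generic_centre_def)
  \<comment> \<open>On the sector \<open>(z - c) / (t - c) - 1\<close> has positive real part. Its
    logarithm differs from \<open>slit_log\<close> by \<open>\<i> * pi\<close> on one side of the
    slit and by \<open>- \<i> * pi\<close> on the other.\<close>
  let ?h = "\<lambda>z. Ln ((z - c) / (t - c) - 1) - \<i> * pi"
  have "?h holomorphic_on sector T c t"
    using tc by (auto intro!: holomorphic_intros simp: sector_def complex_nonpos_Reals_iff)
  moreover have "?h z = slit_log c t z" if "z \<in> half_sector T c t 1" for z
  proof -
    have "Im ((z - c) / (t - c) - 1) > 0" using that by (simp add: half_sector_def)
    moreover from this have "(z - c) / (t - c) - 1 \<noteq> 0" by (metis less_irrefl zero_complex.sel(2))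
    ultimately show ?thesis using Ln_minus[of "(z - c) / (t - c) - 1"] by (simp add: slit_log_def)
  qed
  moreover have "?h z = slit_log c t z - 2 * pi * \<i>" if "z \<in> half_sector T c t (-1)" for z
  proof -
    have "Im ((z - c) / (t - c) - 1) < 0" using that by (simp add: half_sector_def)
    moreover from this have "(z - c) / (t - c) - 1 \<noteq> 0" by (metis less_irrefl zero_complex.sel(2))
    ultimately show ?thesis using Ln_minus[of "(z - c) / (t - c) - 1"]
      by (simp add: slit_log_def)
  qed
  moreover note slit_log_holomorphic[OF t tc(2)]
  ultimately show ?thesis unfolding crossing_def
    by (auto intro!: holomorphic_intros exI[of _ ?h])
qed

lemma slit_log_crossing_other:
  assumes gen: "generic_centre T c" and "t \<in> T" "s \<noteq> t"
  shows "(slit_log c t, slit_log c t) \<in> crossing T c s"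
  using assms by (intro crossing_refl_extends slit_log_holomorphic) (auto simp: generic_centre_def)

text \<open>The equation \<open>hyperlog_op ks f = 1\<close> leaves all constants of integration
  free, so it holds for every branch of the hyperlogarithm.\<close>

fun hyperlog_op :: "complex list \<Rightarrow> cfun \<Rightarrow> cfun" where
  "hyperlog_op [] f = f"
| "hyperlog_op (k # ks) f = hyperlog_op ks (\<lambda>z. (1 - k * z) * deriv f z)"

lemma hyperlog_op_append: "hyperlog_op (ks @ ls) f = hyperlog_op ls (hyperlog_op ks f)"
  by (induction ks arbitrary: f) auto

lemma hyperlog_op_cong:
  assumes "open W" "\<And>z. z \<in> W \<Longrightarrow> f z = g z" "z \<in> W"
  shows "hyperlog_op ks f z = hyperlog_op ks g z"
  using assms(2)
proof (induction ks arbitrary: f g)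
  case (Cons k ks)
  have "deriv f z = deriv g z" if "z \<in> W" for z
    using that \<open>open W\<close> Cons.prems
    by (intro deriv_cong_ev) (auto elim!: eventually_mono[OF eventually_nhds_in_open])
  then show ?case by (auto intro!: Cons.IH)
qed (use assms(3) in auto)

lemma hyperlog_op_holomorphic: "open D \<Longrightarrow> f holomorphic_on D \<Longrightarrow> hyperlog_op ks f holomorphic_on D"
proof (induction ks arbitrary: f)
  case (Cons k ks)
  have "(\<lambda>z. (1 - k * z) * deriv f z) holomorphic_on D"
    by (intro holomorphic_intros Cons.prems)
  then show ?case using Cons by simp
qed simp

text \<open>In size \<open>Suc (length ks)\<close> the matrix is strictly upper triangular. Its last
  row vanishes because the last function of the chain is the constant 1.\<close>

definition hyperlog_sys :: "complex list \<Rightarrow> nat \<Rightarrow> nat \<Rightarrow> cfun" where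
  "hyperlog_sys ks i j z = (if j = Suc i then 1 / (1 - ks ! i * z) else 0)"

lemma hyperlog_sys_holomorphic:
  assumes "i \<le> length ks" "j \<le> length ks" "0 \<notin> set ks"
  shows "hyperlog_sys ks i j holomorphic_on - inverse ` set ks"
proof (cases "j = Suc i")
  case True
  have "1 - ks ! i * z \<noteq> 0" if "z \<in> - inverse ` set ks" for z
    using that True assms by (intro one_minus_mult_nonzero) auto
  then show ?thesis using True by (auto simp: hyperlog_sys_def[abs_def] intro!: holomorphic_intros)
qed (auto simp: hyperlog_sys_def[abs_def])

lemma hyperlog_in_sol_space:
  assumes D: "open D" "f holomorphic_on D" "D \<subseteq> - inverse ` set ks" and "0 \<notin> set ks"
    and op: "\<And>z. z \<in> D \<Longrightarrow> hyperlog_op ks f z = 1"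
  shows "f \<in> sol_space (Suc (length ks)) (hyperlog_sys ks) D"
proof -
  define Z where "Z i = hyperlog_op (take i ks) f" for i
  have hol: "Z i holomorphic_on D" for i
    using D by (simp add: Z_def hyperlog_op_holomorphic)
  have "lin_sol (Suc (length ks)) (hyperlog_sys ks) D Z"
    unfolding lin_sol_def
  proof (intro allI impI ballI)
    fix i z assume i: "i < Suc (length ks)" and z: "z \<in> D"
    have "(Z i has_field_derivative deriv (Z i) z) (at z)"
      using hol D(1) z by (rule holomorphic_derivI)
    moreover have "deriv (Z i) z = (\<Sum>j<Suc (length ks). hyperlog_sys ks i j z * Z j z)"
    proof (cases "i < length ks")
      case True
      have "1 - ks ! i * z \<noteq> 0"
        using z True D(3) by (intro one_minus_mult_nonzero) auto
      moreover have "Z (Suc i) z = (1 - ks ! i * z) * deriv (Z i) z"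
        using True by (simp add: Z_def take_Suc_conv_app_nth hyperlog_op_append)
      moreover have "(\<Sum>j<Suc (length ks). hyperlog_sys ks i j z * Z j z) =
          (\<Sum>j<Suc (length ks). if j = Suc i then 1 / (1 - ks ! i * z) * Z j z else 0)"
        by (intro sum.cong) (auto simp: hyperlog_sys_def)
      ultimately show ?thesis using True by simp
    next
      case False
      then have "i = length ks" using i by simp
      have "deriv (Z i) z = deriv (\<lambda>_. 1) z"
        using z D(1) op \<open>i = length ks\<close>
        by (intro deriv_cong_ev) (auto elim!: eventually_mono[OF eventually_nhds_in_open] simp: Z_def)
      moreover have "(\<Sum>j<Suc (length ks). hyperlog_sys ks i j z * Z j z) = 0"
        using \<open>i = length ks\<close> by (intro sum.neutral) (auto simp: hyperlog_sys_def)
      ultimately show ?thesis by simp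
    qed
    ultimately show "(Z i has_field_derivative (\<Sum>j<Suc (length ks). hyperlog_sys ks i j z * Z j z)) (at z)"
      by simp
  qed
  then show ?thesis by (auto simp: sol_space_def Z_def intro!: exI[of _ Z])
qed

section \<open>Monodromy of logarithms and hyperlogarithms\<close>

lemma primitive_unique:
  assumes "open D" "connected D" "\<And>z. z \<in> D \<Longrightarrow> (f has_field_derivative h z) (at z)"
    "\<And>z. z \<in> D \<Longrightarrow> (g has_field_derivative h z) (at z)"
  shows "\<exists>a::complex. \<forall>z\<in>D. g z = f z + a"
proof -
  have "((\<lambda>z. g z - f z) has_field_derivative 0) (at z)" if "z \<in> D" for z
    using DERIV_diff[OF assms(4)[OF that] assms(3)[OF that]] by simp
  then have "(\<lambda>z. g z - f z) constant_on D"
    using assms(2,1) by (rule has_field_derivative_0_imp_constant_on)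
  then obtain a where "\<forall>z\<in>D. g z - f z = a" by (auto simp: constant_on_def)
  then show ?thesis by (intro exI[of _ a]) (auto simp: algebra_simps)
qed

lemma relpow_shift:
  assumes A: "monodromic T D A" and "(f, \<lambda>z. f z + j) \<in> A"
  shows "(f, \<lambda>z. f z + of_nat m * j) \<in> A ^^ m"
proof (induction m)
  case (Suc m)
  have "(\<lambda>z. f z + of_nat m * j, \<lambda>z. f z + j + of_nat m * j) \<in> A"
    using monodromic.add[OF A assms(2) monodromic_const[OF A]] .
  then have "(\<lambda>z. f z + of_nat m * j, \<lambda>z. f z + of_nat (Suc m) * j) \<in> A"
    by (simp add: algebra_simps)
  with Suc show ?case by auto
qed simp

text \<open>The primitive is \<open>- 1 / k\<close> times the logarithm at \<open>inverse k\<close>.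
  Its jump \<open>2 * pi * \<i> / k\<close> is where the factorial in the final constant comes
  from.\<close>

lemma simple_pole_primitive:
  assumes gen: "generic_centre T c" and t: "inverse k \<in> T" and "k \<noteq> 0"
  obtains L :: cfun and J where "J \<noteq> 0"
    "\<And>z. z \<in> slit_plane T c \<Longrightarrow> (L has_field_derivative 1 / (1 - k * z)) (at z)"
    "(L, \<lambda>z. L z + J) \<in> crossing T c (inverse k)"
    "\<And>s. s \<in> T \<Longrightarrow> s \<noteq> inverse k \<Longrightarrow> (L, L) \<in> crossing T c s"
proof -
  have cT: "c \<notin> T" using gen by (simp add: generic_centre_def)
  define t where "t = inverse k"
  define L where "L z = (- 1 / k) * slit_log c t z" for z
  have tT: "t \<in> T" using assms by (simp add: t_def)
  have mc: "monodromic T (slit_plane T c) (crossing T c s)" if "s \<in> T" for s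
    using monodromic_crossing[OF gen that] .
  have "(L has_field_derivative 1 / (1 - k * z)) (at z)" if z: "z \<in> slit_plane T c" for z
  proof -
    have "z \<notin> slit c t" "t \<noteq> c" using z tT cT by (auto simp: slit_plane_def)
    have "z \<noteq> t" using z slit_plane_subset_compl[OF cT] tT by auto
    have "(L has_field_derivative (- 1 / k) * (1 / (z - t))) (at z)"
      unfolding L_def[abs_def] by (intro DERIV_cmult slit_log_deriv) fact+
    moreover have "1 - k * z = - (k * (z - t))" using \<open>k \<noteq> 0\<close> by (simp add: t_def algebra_simps)
    ultimately show ?thesis by simp
  qed
  moreover have "(\<lambda>z. (- 1 / k) * slit_log c t z, \<lambda>z. (- 1 / k) * (slit_log c t z - 2 * pi * \<i>)) \<in> crossing T c t"
    by (intro monodromic.mult[OF mc[OF tT]] monodromic_const[OF mc[OF tT]] slit_log_crossing[OF gen tT])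
  then have "(L, \<lambda>z. L z + 2 * pi * \<i> / k) \<in> crossing T c t"
    by (rule monodromic.cong[OF mc[OF tT]]) (auto simp: L_def diff_divide_distrib right_diff_distrib)
  moreover have "(L, L) \<in> crossing T c s" if s: "s \<in> T" "s \<noteq> t" for s
    unfolding L_def[abs_def]
    by (intro monodromic.mult[OF mc[OF s(1)]] monodromic_const[OF mc[OF s(1)]] slit_log_crossing_other[OF gen tT s(2)])
  ultimately show ?thesis using that[of "2 * pi * \<i> / k" L] \<open>k \<noteq> 0\<close> by (simp add: t_def)
qed

text \<open>
  Peeling off the outermost letter: both factors of the commutator move \<open>f\<close> to another
  primitive, but the inner one adds a multiple of a logarithm that the outer one shifts.
\<close>

theorem hyperlog_monodromy:
  assumes "ks \<noteq> []" "distinct ks" "0 \<notin> set ks" "inverse ` set ks \<subseteq> T" and gen: "generic_centre T c" and "m > 0"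
  shows "\<exists>C\<noteq>0. \<forall>f. f holomorphic_on slit_plane T c \<longrightarrow> (\<forall>z\<in>slit_plane T c. hyperlog_op ks f z = 1) \<longrightarrow>
     (f, \<lambda>z. f z + C) \<in> loop_rel (map inverse ks) m T c"
  using assms(1-4)
proof (induction ks rule: list_nonempty_induct)
  case (single k)
  let ?D = "slit_plane T c" and ?t = "inverse k"
  note oD = open_slit_plane[OF gen]
  have k: "k \<noteq> 0" "?t \<in> T" using single by auto
  have cT: "c \<notin> T" using gen by (simp add: generic_centre_def)
  obtain L J where L: "J \<noteq> 0" "\<And>z. z \<in> ?D \<Longrightarrow> (L has_field_derivative 1 / (1 - k * z)) (at z)"
    "(L, \<lambda>z. L z + J) \<in> crossing T c ?t"
    using simple_pole_primitive[OF gen k(2,1)] by metis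
  have mc: "monodromic T ?D (crossing T c ?t)" using monodromic_crossing[OF gen k(2)] .
  have mp: "monodromic T ?D (crossing T c ?t ^^ m)" by (rule monodromic_relpow[OF mc \<open>m > 0\<close>])
  have "(f, \<lambda>z. f z + of_nat m * J) \<in> crossing T c ?t ^^ m"
    if f: "f holomorphic_on ?D" "\<forall>z\<in>?D. hyperlog_op [k] f z = 1" for f
  proof -
    have "(f has_field_derivative 1 / (1 - k * z)) (at z)" if "z \<in> ?D" for z
    proof -
      have "(1 - k * z) * deriv f z = 1" using f(2) that by simp
      then have "deriv f z = 1 / (1 - k * z)" by (metis mult_zero_left nonzero_eq_divide_eq mult.commute zero_neq_one)
      then show ?thesis using holomorphic_derivI[OF f(1) oD that] by simp
    qed
    then obtain a where a: "\<forall>z\<in>?D. f z = L z + a"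
      using primitive_unique[OF oD connected_slit_plane L(2)] by blast
    have "(\<lambda>z. L z + a, \<lambda>z. L z + of_nat m * J + a) \<in> crossing T c ?t ^^ m"
      by (intro monodromic.add[OF mp] relpow_shift[OF mc] L(3) monodromic_const[OF mp])
    then show ?thesis by (rule monodromic.cong[OF mp]) (use a in auto)
  qed
  then show ?case using L(1) \<open>m > 0\<close> by (intro exI[of _ "of_nat m * J"]) simp
next
  case (cons k ks)
  let ?D = "slit_plane T c" and ?t = "inverse k"
  let ?R = "\<lambda>t. crossing T c t ^^ m"
  note oD = open_slit_plane[OF gen]
  have k: "k \<noteq> 0" "?t \<in> T" using cons.prems by auto
  have cT: "c \<notin> T" using gen by (simp add: generic_centre_def)
  define A where "A = ?R ?t"
  define B where "B = nested ?R (map inverse ks)"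
  have nest: "nested ?R (map inverse (k # ks)) = commutator A B"
    using cons.hyps by (cases ks) (auto simp: A_def B_def)
  obtain C where C: "C \<noteq> 0" and IH: "\<And>f. f holomorphic_on ?D \<Longrightarrow> \<forall>z\<in>?D. hyperlog_op ks f z = 1 \<Longrightarrow>
      (f, \<lambda>z. f z + C) \<in> B"
    using cons.IH cons.prems unfolding B_def by auto
  obtain L J where L: "J \<noteq> 0" "\<And>z. z \<in> ?D \<Longrightarrow> (L has_field_derivative 1 / (1 - k * z)) (at z)"
    "(L, \<lambda>z. L z + J) \<in> crossing T c ?t" "\<And>s. s \<in> T \<Longrightarrow> s \<noteq> ?t \<Longrightarrow> (L, L) \<in> crossing T c s"
    using simple_pole_primitive[OF gen k(2,1)] by metis
  have mc: "monodromic T ?D (crossing T c s)" if "s \<in> T" for s using monodromic_crossing[OF gen that] .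
  have mR: "monodromic T ?D (?R s)" if "s \<in> T" for s by (rule monodromic_relpow[OF mc[OF that] \<open>m > 0\<close>])
  have mA: "monodromic T ?D A" unfolding A_def by (rule mR[OF k(2)])
  have mB: "monodromic T ?D B" unfolding B_def
    using cons.prems cons.hyps by (intro monodromic_nested mR) auto
  define j where "j = of_nat m * J"
  have j: "j \<noteq> 0" using L(1) \<open>m > 0\<close> by (simp add: j_def)
  have AL: "(L, \<lambda>z. L z + j) \<in> A" unfolding A_def j_def by (rule relpow_shift[OF mc[OF k(2)] L(3)])
  have tks: "?t \<notin> inverse ` set ks" using cons.prems by auto
  \<comment> \<open>The letters of \<open>ks\<close> differ from \<open>k\<close>, so every crossing
    that enters \<open>B\<close> fixes \<open>L\<close>.\<close>
  have BL: "(L, L) \<in> B"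
  proof -
    have s: "s \<in> T \<and> s \<noteq> ?t" if "s \<in> set (map inverse ks)" for s using that tks cons.prems by auto
    have LL: "(L, L) \<in> ?R s" if "s \<in> set (map inverse ks)" for s
      using s[OF that] by (intro relpow_refl_at L(4)) auto
    have "set (map inverse ks) \<noteq> {}" using cons.hyps by simp
    then show ?thesis unfolding B_def using LL
      by (intro nested_fixes[of _ _ "{L}"]) (auto simp: total_on_both_def)
  qed
  have nz: "1 - k * z \<noteq> 0" if "z \<in> - T" for z
    using that k by (intro one_minus_mult_nonzero) auto
  have DT: "?D \<subseteq> - T" by (rule slit_plane_subset_compl[OF cT])
  define q where "q z = 1 / (1 - k * z)" for z
  have q: "q holomorphic_on - T" unfolding q_def[abs_def] using nz by (auto intro!: holomorphic_intros)
  have "(f, \<lambda>z. f z - C * j) \<in> commutator A B"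
    if f: "f holomorphic_on ?D" and op: "\<forall>z\<in>?D. hyperlog_op (k # ks) f z = 1" for f
  proof -
    define f1 where "f1 z = (1 - k * z) * deriv f z" for z
    have f1: "f1 holomorphic_on ?D" "\<forall>z\<in>?D. hyperlog_op ks f1 z = 1"
      unfolding f1_def[abs_def] using op by ((intro holomorphic_intros f oD), simp)
    have df: "deriv f z = f1 z * q z" if "z \<in> ?D" for z
      using nz[of z] that DT by (auto simp: f1_def q_def)
    have sub: "inverse ` set ks \<subseteq> T" "inverse ` set (k # ks) \<subseteq> T" "0 \<notin> set ks" "0 \<notin> set (k # ks)"
      using cons.prems by auto
    have Dks: "?D \<subseteq> - inverse ` set ks" "?D \<subseteq> - inverse ` set (k # ks)" using DT sub by blast+
    \<comment> \<open>\<open>f1\<close> solves the system of the remaining letters, which is regular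
      at \<open>inverse k\<close> because the letters are distinct.\<close>
    have "(f1, f1) \<in> crossing T c ?t"
      by (rule crossing_fixes_sol_space[OF gen _ sub(1) _ hyperlog_sys_holomorphic
            hyperlog_in_sol_space[OF oD f1(1) Dks(1) sub(3)]]) (use k tks sub(3) f1(2) in auto)
    then have Af1: "(f1, f1) \<in> A" unfolding A_def by (rule relpow_refl_at)
    have Bf1: "(f1, \<lambda>z. f1 z + C) \<in> B" using IH f1 by blast
    let ?V = "sol_space (Suc (length (k # ks))) (hyperlog_sys (k # ks)) ?D"
    have fV: "f \<in> ?V"
      by (rule hyperlog_in_sol_space[OF oD f Dks(2) sub(4)]) (use op in auto)
    have tot: "total_on_both (?R s) ?V" if "s \<in> T" for s
    proof (intro total_on_both_relpow total_on_both_crossing[OF gen that])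
      fix i l assume "i < Suc (length (k # ks))" "l < Suc (length (k # ks))"
      then have "hyperlog_sys (k # ks) i l holomorphic_on - inverse ` set (k # ks)"
        using sub by (intro hyperlog_sys_holomorphic) auto
      then show "hyperlog_sys (k # ks) i l holomorphic_on - T"
        by (rule holomorphic_on_subset) (use sub in blast)
    qed simp
    have totB: "total_on_both B ?V" unfolding B_def
      using sub by (intro total_on_both_nested tot) auto
    \<comment> \<open>Totality only provides some images \<open>g\<close> and \<open>g'\<close>.
      Their derivatives determine them up to constants \<open>a\<close> and \<open>b\<close>, which
      cancel in the commutator.\<close>
    obtain g where g: "(f, g) \<in> A" using tot[OF k(2)] fV unfolding A_def total_on_both_def by blast
    obtain g' where g': "(f, g') \<in> B" using totB fV unfolding total_on_both_def by blast
    have hd: "(u has_field_derivative deriv u z) (at z)" if "u holomorphic_on ?D" "z \<in> ?D" for u z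
      using that oD holomorphic_derivI by blast
    have "(\<lambda>z. f1 z * q z, \<lambda>z. f1 z * q z) \<in> A"
      by (intro monodromic.mult[OF mA] Af1 monodromic.refl[OF mA] q)
    with monodromic.inject[OF mA monodromic.deriv[OF mA g] this] df
    have dg: "\<forall>z\<in>?D. deriv g z = deriv f z" by auto
    obtain a where a: "\<forall>z\<in>?D. g z = f z + a"
      using primitive_unique[OF oD connected_slit_plane hd[OF f], of g] dg hd[OF monodromic.hol(2)[OF mA g]] by force
    have "(\<lambda>z. f1 z * q z, \<lambda>z. (f1 z + C) * q z) \<in> B"
      by (intro monodromic.mult[OF mB] Bf1 monodromic.refl[OF mB] q)
    with monodromic.inject[OF mB monodromic.deriv[OF mB g'] this] df
    have dg': "\<forall>z\<in>?D. deriv g' z = deriv f z + C * q z" by (auto simp: algebra_simps)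
    have "((\<lambda>z. f z + C * L z) has_field_derivative deriv g' z) (at z)" if "z \<in> ?D" for z
      using DERIV_add[OF hd[OF f that] DERIV_cmult[OF L(2)[OF that], of C]] dg' that by (simp add: q_def)
    then obtain b where b: "\<forall>z\<in>?D. g' z = f z + C * L z + b"
      using primitive_unique[OF oD connected_slit_plane _ hd[OF monodromic.hol(2)[OF mB g']]] by blast
    have Af: "(f, \<lambda>z. f z + a) \<in> A"
      by (rule monodromic.cong[OF mA g]) (use a in auto)
    have Bf: "(f, \<lambda>z. f z + C * L z + b) \<in> B"
      by (rule monodromic.cong[OF mB g']) (use b in auto)
    have 2: "(\<lambda>z. f z + a, \<lambda>z. f z + C * L z + b + a) \<in> B"
      by (intro monodromic.add[OF mB] Bf monodromic_const[OF mB])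
    \<comment> \<open>\<open>A\<close> shifts \<open>L\<close> by \<open>j\<close>, hence
      \<open>C * L\<close> by \<open>C * j\<close>. Starting from a function lowered by
      \<open>C * j\<close> makes the two halves of the commutator path meet at
      \<open>f + C * L + b + a\<close>.\<close>
    have "(\<lambda>z. f z + C * L z + (b - C * j), \<lambda>z. f z + a + C * (L z + j) + (b - C * j)) \<in> A"
      by (intro monodromic.add[OF mA] monodromic.mult[OF mA] Af AL monodromic_const[OF mA])
    then have 3: "(\<lambda>z. f z + C * L z + b - C * j, \<lambda>z. f z + C * L z + b + a) \<in> A"
      by (rule monodromic.cong[OF mA]) (auto simp: algebra_simps)
    have "(\<lambda>z. f z + (- C * j), \<lambda>z. f z + C * L z + b + (- C * j)) \<in> B"
      by (intro monodromic.add[OF mB] Bf monodromic_const[OF mB])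
    then have 4: "(\<lambda>z. f z - C * j, \<lambda>z. f z + C * L z + b - C * j) \<in> B"
      by (rule monodromic.cong[OF mB]) auto
    show ?thesis unfolding commutator_def using Af 2 3 4 by blast
  qed
  then show ?case unfolding nest using C j by (intro exI[of _ "- C * j"]) simp
qed

subsection \<open>Functions fixed by the nested commutator\<close>

text \<open>The given function matters only near \<open>c\<close>; \<open>g\<close> is its
  continuation to the slit plane.\<close>

abbreviation fixes_germ :: "complex list \<Rightarrow> nat \<Rightarrow> complex set \<Rightarrow> complex \<Rightarrow> cfun \<Rightarrow> bool" where
  "fixes_germ ts m T c f \<equiv>
     \<exists>g r. r > 0 \<and> (\<forall>z\<in>ball c r. g z = f z) \<and> (g, g) \<in> loop_rel ts m T c"

text \<open>Validity for all larger \<open>T\<close> and all multiples of \<open>m0\<close> lets two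
  tame functions share one singular set, one base point and one exponent.\<close>

definition tame :: "complex list \<Rightarrow> complex set \<Rightarrow> cfun \<Rightarrow> bool" where
  "tame ts U f \<longleftrightarrow> (\<exists>T0 m0. finite T0 \<and> set ts \<subseteq> T0 \<and> m0 > 0 \<and>
     (\<forall>T c m. T0 \<subseteq> T \<longrightarrow> generic_centre T c \<longrightarrow> c \<in> U \<longrightarrow> m0 dvd m \<longrightarrow> m > 0 \<longrightarrow>
        fixes_germ ts m T c f))"

lemma tame_subset:
  assumes "tame ts U f" "U' \<subseteq> U" shows "tame ts U' f"
proof -
  from assms(1) obtain T0 m0 where "finite T0" "set ts \<subseteq> T0" "m0 > 0"
     "\<forall>T c m. T0 \<subseteq> T \<longrightarrow> generic_centre T c \<longrightarrow> c \<in> U \<longrightarrow> m0 dvd m \<longrightarrow> m > 0 \<longrightarrow>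
        (fixes_germ ts m T c f)"
    unfolding tame_def by auto
  with assms(2) show ?thesis unfolding tame_def
    by (intro exI[of _ T0] exI[of _ m0]) blast
qed

lemma monodromic_nested_crossing:
  assumes "ts \<noteq> []" "set ts \<subseteq> T" "generic_centre T c" "m > (0::nat)"
  shows "monodromic T (slit_plane T c) (loop_rel ts m T c)"
  using assms by (intro monodromic_nested monodromic_relpow monodromic_crossing) auto

lemma tame_binop:
  assumes ts: "ts \<noteq> []" and f: "tame ts U f" and g: "tame ts U g"
    and op: "\<And>T D A f g. monodromic T D A \<Longrightarrow> (f, f) \<in> A \<Longrightarrow> (g, g) \<in> A \<Longrightarrow> (\<lambda>z. op (f z) (g z), \<lambda>z. op (f z) (g z)) \<in> A"
  shows "tame ts U (\<lambda>z. op (f z) (g z))"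
proof -
  from f obtain T1 m1 where 1: "finite T1" "set ts \<subseteq> T1" "m1 > 0" and f':
     "\<And>T c m. T1 \<subseteq> T \<Longrightarrow> generic_centre T c \<Longrightarrow> c \<in> U \<Longrightarrow> m1 dvd m \<Longrightarrow> m > 0 \<Longrightarrow>
        fixes_germ ts m T c f"
    unfolding tame_def by auto
  from g obtain T2 m2 where 2: "finite T2" "set ts \<subseteq> T2" "m2 > 0" and g':
     "\<And>T c m. T2 \<subseteq> T \<Longrightarrow> generic_centre T c \<Longrightarrow> c \<in> U \<Longrightarrow> m2 dvd m \<Longrightarrow> m > 0 \<Longrightarrow>
        fixes_germ ts m T c g"
    unfolding tame_def by auto
  show ?thesis unfolding tame_def
  proof (intro exI[of _ "T1 \<union> T2"] exI[of _ "m1 * m2"] conjI allI impI)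
    fix T c m assume T: "T1 \<union> T2 \<subseteq> T" "generic_centre T c" "c \<in> U" "m1 * m2 dvd m" "m > (0::nat)"
    have "m1 dvd m" "m2 dvd m" using T(4) by (auto intro: dvd_mult_left dvd_mult_right)
    obtain h1 r1 where h1: "r1 > 0" "\<forall>z\<in>ball c r1. h1 z = f z"
      "(h1, h1) \<in> loop_rel ts m T c"
      using f'[of T c m] T \<open>m1 dvd m\<close> by auto
    obtain h2 r2 where h2: "r2 > 0" "\<forall>z\<in>ball c r2. h2 z = g z"
      "(h2, h2) \<in> loop_rel ts m T c"
      using g'[of T c m] T \<open>m2 dvd m\<close> by auto
    have "monodromic T (slit_plane T c) (loop_rel ts m T c)"
      using ts T 1 by (intro monodromic_nested_crossing) auto
    from op[OF this h1(3) h2(3)] show "\<exists>h r. r > 0 \<and> (\<forall>z\<in>ball c r. h z = op (f z) (g z)) \<and>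
        (h, h) \<in> loop_rel ts m T c"
      using h1 h2 by (intro exI[of _ "\<lambda>z. op (h1 z) (h2 z)"] exI[of _ "min r1 r2"]) auto
  qed (use 1 2 in auto)
qed

lemma tame_add: "ts \<noteq> [] \<Longrightarrow> tame ts U f \<Longrightarrow> tame ts U g \<Longrightarrow> tame ts U (\<lambda>z. f z + g z)"
  by (rule tame_binop[where op = "(+)"]) (auto intro: monodromic.add)

lemma tame_mult: "ts \<noteq> [] \<Longrightarrow> tame ts U f \<Longrightarrow> tame ts U g \<Longrightarrow> tame ts U (\<lambda>z. f z * g z)"
  by (rule tame_binop[where op = "(*)"]) (auto intro: monodromic.mult)

lemma tame_locally_const:
  assumes "ts \<noteq> []" "\<And>c. c \<in> U \<Longrightarrow> \<exists>r>0. \<forall>z\<in>ball c r. f z = f c"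
  shows "tame ts U f"
  unfolding tame_def
proof (intro exI[of _ "set ts"] exI[of _ 1] conjI allI impI)
  fix T c m assume T: "set ts \<subseteq> T" "generic_centre T c" "c \<in> U" "m > (0::nat)"
  obtain r where r: "r > 0" "\<forall>z\<in>ball c r. f z = f c" using assms(2)[OF T(3)] by auto
  have "(\<lambda>_. f c, \<lambda>_. f c) \<in> loop_rel ts m T c"
    by (rule monodromic_const[OF monodromic_nested_crossing[OF assms(1) T(1,2,4)]])
  then show "fixes_germ ts m T c f"
    using r by (intro exI[of _ "\<lambda>_. f c"] exI[of _ r] conjI ballI) (blast intro: sym)+
qed auto

lemma tame_diff:
  assumes "ts \<noteq> []" "tame ts U f" "tame ts U g" shows "tame ts U (\<lambda>z. f z - g z)"
proof -
  have "tame ts U (\<lambda>_. -1)" by (rule tame_locally_const[OF assms(1)]) (auto intro: zero_less_one)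
  from tame_add[OF assms(1,2) tame_mult[OF assms(1) this assms(3)]] show ?thesis by simp
qed

text \<open>Some letter is not a pole of the system, so its crossing fixes the whole solution space,
  and with it the nested commutator does. The function has to agree with a solution only near
  generic centres, so it may come from a different equation with more poles.\<close>

lemma tame_few_poles:
  assumes ts: "ts \<noteq> []" "\<not> set ts \<subseteq> S" and "finite T1" "S \<subseteq> T1" "n > 0"
    and hol: "\<And>i j. i < n \<Longrightarrow> j < n \<Longrightarrow> B i j holomorphic_on - S"
    and ext: "\<And>c. c \<in> U \<Longrightarrow> generic_centre T1 c \<Longrightarrow>
      \<exists>Z r. r > 0 \<and> lin_sol n B (slit_plane S c) Z \<and> (\<forall>z\<in>ball c r. Z 0 z = f z)"
  shows "tame ts U f"
  unfolding tame_def
proof (intro exI[of _ "T1 \<union> set ts"] exI[of _ 1] conjI allI impI)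
  fix T c m assume T: "T1 \<union> set ts \<subseteq> T" "generic_centre T c" "c \<in> U" "m > (0::nat)"
  have ST: "S \<subseteq> T" using T assms by auto
  have holT: "B i j holomorphic_on - T" if "i < n" "j < n" for i j
    using hol[OF that] ST by (auto intro: holomorphic_on_subset)
  obtain Z r where Z: "r > 0" "lin_sol n B (slit_plane S c) Z" "\<forall>z\<in>ball c r. Z 0 z = f z"
    using ext[OF T(3)] T generic_centre_subset[OF T(2), of T1] by auto
  let ?V = "sol_space n B (slit_plane T c)"
  have "Z 0 \<in> ?V"
    using lin_sol_subset[OF Z(2) slit_plane_antimono[OF ST]] by (auto simp: sol_space_def)
  moreover obtain t where t: "t \<in> set ts" "t \<notin> S" using ts by auto
  have "\<forall>v\<in>?V. (v, v) \<in> crossing T c t ^^ m"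
  proof
    fix v assume "v \<in> ?V"
    then have "(v, v) \<in> crossing T c t"
      by (intro crossing_fixes_sol_space[OF T(2) _ ST \<open>n > 0\<close> hol]) (use t T in auto)
    then show "(v, v) \<in> crossing T c t ^^ m" by (rule relpow_refl_at)
  qed
  moreover have "total_on_both (crossing T c s ^^ m) ?V" if "s \<in> set ts" for s
    by (rule total_on_both_relpow, rule total_on_both_crossing[OF T(2) _ \<open>n > 0\<close> holT]) (use that T in auto)
  ultimately have "(Z 0, Z 0) \<in> loop_rel ts m T c"
    using t by (intro nested_fixes[of _ _ ?V]) auto
  then show "fixes_germ ts m T c f"
    using Z by blast
qed (use assms in auto)

text \<open>Two structures cooperate: the linear system guarantees that continuations exist, and the
  polynomial bounds their number. The space \<open>V\<close> consists of the solutions that are also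
  roots of \<open>P\<close>; it is stable because crossings preserve polynomial identities.\<close>

lemma tame_algebraic_solution:
  assumes ts: "ts \<noteq> []" and "finite S" "n > 0" "open U"
    and hol: "\<And>i j. i < n \<Longrightarrow> j < n \<Longrightarrow> B i j holomorphic_on - S"
    and Y: "lin_sol n B U Y" "\<And>z. z \<in> U \<Longrightarrow> f z = Y 0 z"
    and P: "P \<noteq> 0" "\<And>z. z \<in> U \<Longrightarrow> poly2 P (f z) z = 0"
  shows "tame ts U f"
  unfolding tame_def
proof (intro exI[of _ "S \<union> set ts"] exI[of _ "fact (degree P)"] conjI allI impI)
  fix T c m assume T: "S \<union> set ts \<subseteq> T" "generic_centre T c" "c \<in> U" "fact (degree P) dvd m" "m > (0::nat)"
  let ?D = "slit_plane T c"
  note oD = open_slit_plane[OF T(2)]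
  have holT: "B i j holomorphic_on - T" if "i < n" "j < n" for i j
    using hol[OF that] T(1) by (auto intro: holomorphic_on_subset)
  have holD: "B i j holomorphic_on ?D" if "i < n" "j < n" for i j
    by (rule holomorphic_on_slit_plane[OF holT[OF that] T(2)])
  have "\<exists>Z. lin_sol n B ?D Z \<and> (\<forall>i<n. Z i c = Y i c)"
    by (rule lin_sol_exists_slit_plane[OF T(2) holT centre_in_slit_plane])
  then obtain Z where Z: "lin_sol n B ?D Z" "\<forall>i<n. Z i c = Y i c" by blast
  have "open (U \<inter> ?D)" "c \<in> U \<inter> ?D" using oD \<open>open U\<close> T(3) centre_in_slit_plane by auto
  then obtain r where r: "r > 0" "ball c r \<subseteq> U \<inter> ?D" using open_contains_ball by metis
  have ZY: "Z 0 z = Y 0 z" if "z \<in> ball c r" for z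
  proof (rule lin_sol_unique[OF lin_sol_subset[OF Z(1)] lin_sol_subset[OF Y(1)] open_ball connected_ball _ _ _ \<open>n > 0\<close> that])
    show "B i j holomorphic_on ball c r" if "i < n" "j < n" for i j
      using holD[OF that] r(2) by (auto intro: holomorphic_on_subset)
  qed (use r Z in auto)
  define V where "V = {v \<in> sol_space n B ?D. \<forall>z\<in>?D. poly2 P (v z) z = 0}"
  have Z0: "Z 0 holomorphic_on ?D" by (rule lin_sol_holomorphic[OF Z(1) \<open>n > 0\<close> oD])
  have ZP: "poly2 P (Z 0 z) z = 0" if "z \<in> ?D" for z
  proof (rule analytic_continuation_open[of "ball c r" ?D "\<lambda>z. poly2 P (Z 0 z) z" "\<lambda>_. 0"])
    show "poly2 P (Z 0 w) w = 0" if "w \<in> ball c r" for w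
      using P(2)[of w] Y(2)[of w] ZY[OF that] that r(2) by auto
  qed (use r oD connected_slit_plane that in \<open>auto intro!: holomorphic_poly_poly Z0\<close>)
  have "Z 0 \<in> V" using Z(1) ZP by (auto simp: V_def sol_space_def)
  moreover have tot: "total_on_both (crossing T c t) V" if "t \<in> set ts" for t
  proof -
    have tT: "t \<in> T" using that T(1) by auto
    note mc = monodromic_crossing[OF T(2) tT]
    have tt: "total_on_both (crossing T c t) (sol_space n B ?D)"
      by (rule total_on_both_crossing[OF T(2) tT \<open>n > 0\<close> holT])
    have iff: "(\<forall>z\<in>?D. poly2 P (v z) z = 0) \<longleftrightarrow> (\<forall>z\<in>?D. poly2 P (w z) z = 0)"
      if "(v, w) \<in> crossing T c t" for v w
      using monodromic.inject[OF mc monodromic_poly_poly[OF mc that, of P] monodromic_const[OF mc, of 0]] .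
    show ?thesis unfolding total_on_both_def
    proof (intro conjI ballI)
      fix v assume "v \<in> V"
      then have v: "v \<in> sol_space n B ?D" "\<forall>z\<in>?D. poly2 P (v z) z = 0" by (auto simp: V_def)
      then obtain w u where "w \<in> sol_space n B ?D" "(v, w) \<in> crossing T c t"
        "u \<in> sol_space n B ?D" "(u, v) \<in> crossing T c t"
        using tt unfolding total_on_both_def by blast
      then show "\<exists>w\<in>V. (v, w) \<in> crossing T c t" "\<exists>u\<in>V. (u, v) \<in> crossing T c t"
        using iff v(2) unfolding V_def by blast+
    qed
  qed
  have fixd: "(v, v) \<in> crossing T c t ^^ m" if "t \<in> set ts" "v \<in> V" for t v
  proof (rule relpow_fact_fixes[OF monodromic_crossing[OF T(2)] oD connected_slit_plane _ P(1) tot[OF that(1)] _ that(2) T(4,5)])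
    show "t \<in> T" using that T by auto
    show "?D \<noteq> {}" using centre_in_slit_plane by blast
  qed (simp add: V_def)
  ultimately have "(Z 0, Z 0) \<in> loop_rel ts m T c"
    using ts tot by (intro nested_fixes[of _ _ V]) (auto intro!: total_on_both_relpow simp: neq_Nil_conv)
  moreover have "\<forall>z\<in>ball c r. Z 0 z = f z" using ZY Y(2) r(2) by auto
  ultimately show "fixes_germ ts m T c f"
    using r(1) by blast
qed (use assms in auto)

subsection \<open>Scalar equations\<close>

definition companion :: "nat \<Rightarrow> (nat \<Rightarrow> cfun) \<Rightarrow> nat \<Rightarrow> nat \<Rightarrow> cfun" where
  "companion n b i j z = (if Suc i < n then (if j = Suc i then 1 else 0) else b j z)"

lemma companion_sum:
  "i < n \<Longrightarrow> (\<Sum>j<n. companion n b i j z * y j) = (if Suc i < n then y (Suc i) else (\<Sum>j<n. b j z * y j))"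
proof -
  assume "i < n"
  have "(\<Sum>j<n. companion n b i j z * y j) = (\<Sum>j<n. if j = Suc i then y j else 0)" if "Suc i < n"
    using that by (intro sum.cong) (auto simp: companion_def)
  then show ?thesis by (auto simp: companion_def)
qed

lemma companion_holomorphic:
  "(\<And>j. j < n \<Longrightarrow> b j holomorphic_on D) \<Longrightarrow> j < n \<Longrightarrow> companion n b i j holomorphic_on D"
  by (cases "Suc i < n"; cases "j = Suc i") (simp_all add: companion_def[abs_def])

lemma lin_sol_companion:
  assumes "open D" "y holomorphic_on D"
    and "\<And>z. z \<in> D \<Longrightarrow> (deriv ^^ n) y z = (\<Sum>j<n. b j z * (deriv ^^ j) y z)"
  shows "lin_sol n (companion n b) D (\<lambda>i. (deriv ^^ i) y)"
  unfolding lin_sol_def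
proof (intro allI impI ballI)
  fix i z assume i: "i < n" and z: "z \<in> D"
  have "((deriv ^^ i) y has_field_derivative (deriv ^^ Suc i) y z) (at z)"
    using holomorphic_derivI[OF holomorphic_higher_deriv[OF assms(2,1)] assms(1) z] by simp
  moreover have "(\<Sum>j<n. companion n b i j z * (deriv ^^ j) y z) = (deriv ^^ Suc i) y z"
  proof (cases "Suc i < n")
    case False
    then have "Suc i = n" using i by simp
    then show ?thesis using companion_sum[OF i] assms(3)[OF z] by simp
  qed (use companion_sum[OF i] in simp)
  ultimately show "((deriv ^^ i) y has_field_derivative (\<Sum>j<n. companion n b i j z * (deriv ^^ j) y z)) (at z)"
    by simp
qed

text \<open>Elimination of the last coordinate without division, so that it serves for coefficients
  in a polynomial ring as well as for complex numbers.\<close>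

lemma linear_dependence:
  fixes v :: "'b \<Rightarrow> nat \<Rightarrow> 'a::idom"
  assumes "finite I" "card I > n"
  shows "\<exists>c. (\<exists>i\<in>I. c i \<noteq> 0) \<and> (\<forall>j<n. (\<Sum>i\<in>I. c i * v i j) = 0)"
  using assms
proof (induction n arbitrary: I v)
  case 0
  then obtain i where "i \<in> I" by (metis card_gt_0_iff ex_in_conv)
  then show ?case by (intro exI[of _ "\<lambda>_. 1"]) auto
next
  case (Suc n)
  show ?case
  proof (cases "\<forall>i\<in>I. v i n = 0")
    case True
    obtain c where "\<exists>i\<in>I. c i \<noteq> 0" "\<forall>j<n. (\<Sum>i\<in>I. c i * v i j) = 0"
      using Suc.IH[of I v] Suc.prems by auto
    with True show ?thesis by (intro exI[of _ c]) (auto simp: less_Suc_eq)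
  next
    case False
    then obtain p where p: "p \<in> I" "v p n \<noteq> 0" by auto
    define w where "w i j = v p n * v i j - v i n * v p j" for i j
    have "card (I - {p}) > n" using p Suc.prems by simp
    then obtain c where c: "\<exists>i\<in>I - {p}. c i \<noteq> 0" "\<forall>j<n. (\<Sum>i\<in>I - {p}. c i * w i j) = 0"
      using Suc.IH[of "I - {p}" w] Suc.prems by auto
    \<comment> \<open>The coefficient at the pivot is chosen so that coordinate \<open>n\<close>
      cancels.\<close>
    define d where "d i = (if i = p then - (\<Sum>i\<in>I - {p}. c i * v i n) else v p n * c i)" for i
    have "(\<Sum>i\<in>I. d i * v i j) = (\<Sum>i\<in>I - {p}. c i * w i j)" for j
    proof -
      have "(\<Sum>i\<in>I. d i * v i j) = d p * v p j + (\<Sum>i\<in>I - {p}. d i * v i j)"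
        using p Suc.prems by (simp add: sum.remove)
      also have "(\<Sum>i\<in>I - {p}. d i * v i j) = (\<Sum>i\<in>I - {p}. v p n * c i * v i j)"
        by (intro sum.cong) (auto simp: d_def)
      also have "d p * v p j = - (\<Sum>i\<in>I - {p}. c i * v i n * v p j)"
        by (simp add: d_def sum_distrib_right)
      finally show ?thesis
        by (simp add: w_def algebra_simps sum_subtractf)
    qed
    moreover have "(\<Sum>i\<in>I - {p}. c i * w i n) = 0" by (simp add: w_def mult.commute)
    moreover have "\<exists>i\<in>I. d i \<noteq> 0" using c(1) p(2) by (auto simp: d_def)
    ultimately show ?thesis using c(2) by (intro exI[of _ d]) (auto simp: less_Suc_eq)
  qed
qed

subsection \<open>Algebraic functions satisfy linear differential equations\<close>

text \<open>The chain rule in two variables: \<open>map_poly pderiv\<close> is the partial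
  derivative in \<open>x\<close>, and \<open>pderiv\<close> the one in the outer variable.\<close>

lemma poly_poly_deriv:
  assumes "(g has_field_derivative g') (at x)"
  shows "((\<lambda>x. poly2 R (g x) x) has_field_derivative
    (poly2 (map_poly pderiv R) (g x) x + poly2 (pderiv R) (g x) x * g')) (at (x::complex))"
proof (induction R)
  case 0
  show ?case by simp
next
  case (pCons a R)
  have "((\<lambda>x. poly a x + g x * poly2 R (g x) x) has_field_derivative
     poly (pderiv a) x + (g x * (poly2 (map_poly pderiv R) (g x) x + poly2 (pderiv R) (g x) x * g')
       + g' * poly2 R (g x) x)) (at x)"
    by (intro DERIV_add poly_DERIV DERIV_mult'[OF assms pCons.IH])
  moreover have "map_poly pderiv (pCons a R) = pCons (pderiv a) (map_poly pderiv R)"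
    by (simp add: map_poly_pCons)
  ultimately show ?case by (simp add: pderiv_pCons algebra_simps)
qed


text \<open>Differentiating the equation of \<open>g\<close> gives \<open>P_y g' = - P_x\<close> in
  terms of partial derivatives. So every derivative of \<open>g\<close> is a polynomial in
  \<open>x\<close> and \<open>g\<close> over a power of \<open>P_y\<close>; the form without
  division stays meaningful where \<open>P_y\<close> vanishes.\<close>

lemma algebraic_derivatives:
  assumes "open D" "g holomorphic_on D" and kill: "\<And>x. x \<in> D \<Longrightarrow> poly2 P (g x) x = 0"
  shows "\<exists>k R. \<forall>x\<in>D. poly2 (pderiv P) (g x) x ^ k * (deriv ^^ j) g x = poly2 R (g x) x"
proof (induction j)
  case 0
  show ?case by (intro exI[of _ 0] exI[of _ "[:0, 1:]"]) auto
next
  case (Suc j)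
  define E where "E R x = poly2 R (g x) x" for R x
  define m where "m = map_poly (pderiv :: complex poly \<Rightarrow> _)"
  define Q where "Q = pderiv P"
  obtain k R where R: "\<And>x. x \<in> D \<Longrightarrow> E Q x ^ k * (deriv ^^ j) g x = E R x"
    using Suc by (auto simp: E_def Q_def)
  \<comment> \<open>\<open>Q\<close> times the total derivative of \<open>A (x, g)\<close> is again
    a polynomial expression, \<open>Q A_x - A_y P_x\<close>. \<open>R1\<close> and \<open>R2\<close>
    are this expression for \<open>R\<close> and for \<open>Q\<close>; one \<open>Q\<close> for it
    and one for the derivative of \<open>Q ^ k\<close> make the exponent
    \<open>k + 2\<close>.\<close>
  define R1 where "R1 = Q * m R - pderiv R * m P"
  define R2 where "R2 = Q * m Q - pderiv Q * m P"
  have E: "E (A + B) x = E A x + E B x" "E (A - B) x = E A x - E B x" "E (A * B) x = E A x * E B x" 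
    "E (of_nat n) x = of_nat n" for A B x n
    by (simp_all add: E_def of_nat_poly)
  have dE: "(E A has_field_derivative E (m A) x + E (pderiv A) x * deriv g x) (at x)" if "x \<in> D" for A x
    unfolding E_def m_def using holomorphic_derivI[OF assms(2,1) that] by (rule poly_poly_deriv)
  have g': "E Q x * deriv g x = - E (m P) x" if x: "x \<in> D" for x
  proof -
    have "(E P has_field_derivative 0) (at x)"
      by (rule has_field_derivative_transform_within_open[of "\<lambda>_. 0" _ _ D]) (use assms x in \<open>auto simp: E_def\<close>)
    from DERIV_unique[OF dE[OF x] this] show ?thesis by (simp add: Q_def add_eq_0_iff2 mult.commute)
  qed
  have QdE: "E Q x * (E (m A) x + E (pderiv A) x * deriv g x) = E (Q * m A - pderiv A * m P) x" if x: "x \<in> D" for A x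
  proof -
    have "E Q x * (E (m A) x + E (pderiv A) x * deriv g x) = E Q x * E (m A) x + E (pderiv A) x * (E Q x * deriv g x)"
      by (simp add: algebra_simps)
    also have "\<dots> = E (Q * m A - pderiv A * m P) x" unfolding g'[OF x] by (simp add: E)
    finally show ?thesis .
  qed
  have "E Q x ^ (k + 2) * (deriv ^^ Suc j) g x = E (Q * R1 - of_nat k * R2 * R) x" if x: "x \<in> D" for x
  proof -
    define q u u' q' r' where "q = E Q x" and "u = (deriv ^^ j) g x" and "u' = (deriv ^^ Suc j) g x"
      and "q' = E (m Q) x + E (pderiv Q) x * deriv g x" and "r' = E (m R) x + E (pderiv R) x * deriv g x"
    have du: "((deriv ^^ j) g has_field_derivative u') (at x)"
      using holomorphic_derivI[OF holomorphic_higher_deriv[OF assms(2,1)] assms(1) x] by (simp add: u'_def)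
    define w where "w = of_nat k * q ^ (k - 1) * q'"
    have "((\<lambda>x. E Q x ^ k) has_field_derivative w) (at x)"
      using DERIV_power[OF dE[OF x, of Q], of k] by (simp add: w_def q_def q'_def mult_ac)
    from DERIV_mult'[OF this du]
    have "((\<lambda>x. E Q x ^ k * (deriv ^^ j) g x) has_field_derivative q ^ k * u' + w * u) (at x)"
      by (simp add: q_def u_def)
    then have "(E R has_field_derivative q ^ k * u' + w * u) (at x)"
      by (rule has_field_derivative_transform_within_open[OF _ assms(1) x R])
    from DERIV_unique[OF this dE[OF x]] have 1: "q ^ k * u' + w * u = r'" by (simp add: r'_def)
    have wq: "w * q = of_nat k * q ^ k * q'" by (cases k) (auto simp: w_def)
    have "q ^ (k + 2) * u' = q * (q * r') - q * (w * q) * u"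
      unfolding 1[symmetric] by (simp add: algebra_simps power2_eq_square)
    also have "q * (w * q) * u = of_nat k * (q * q') * (q ^ k * u)" unfolding wq by simp
    also have "q * r' = E R1 x" unfolding R1_def q_def r'_def by (rule QdE[OF x])
    also have "q * q' = E R2 x" unfolding R2_def q_def q'_def by (rule QdE[OF x])
    also have "q ^ k * u = E R x" unfolding q_def u_def by (rule R[OF x])
    finally show ?thesis by (simp add: q_def u'_def E)
  qed
  then show ?case unfolding E_def Q_def by blast
qed

text \<open>Modulo \<open>P\<close>, and up to denominators in \<open>x\<close> and a power of
  \<open>pderiv P\<close>, each derivative of \<open>g\<close> is a polynomial in \<open>g\<close>
  of degree below \<open>d\<close>. The \<open>d + 1\<close> derivatives of orders 0 to
  \<open>d\<close> are therefore linearly dependent over polynomials in \<open>x\<close>.\<close>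

lemma algebraic_imp_scalar_ode:
  assumes U: "open U" "U \<noteq> {}" "g holomorphic_on U" and P: "P \<noteq> 0" "\<And>x. x \<in> U \<Longrightarrow> poly2 P (g x) x = 0"
  shows "\<exists>U' d q. U' \<subseteq> U \<and> open U' \<and> U' \<noteq> {} \<and> (\<exists>j\<le>d. q j \<noteq> (0 :: complex poly)) \<and>
    (\<forall>x\<in>U'. (\<Sum>j\<le>d. poly (q j) x * (deriv ^^ j) g x) = 0)"
proof -
  \<comment> \<open>The degree is minimised over open subsets of \<open>U\<close> as well. Then
    \<open>pderiv P\<close>, of smaller degree, cannot vanish along \<open>g\<close> on all of
    \<open>W\<close>, and its zeros can be removed.\<close>
  define kills where "kills d \<longleftrightarrow> (\<exists>P W. P \<noteq> 0 \<and> degree P = d \<and> W \<subseteq> U \<and> open W \<and> W \<noteq> {} \<and>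
     (\<forall>x\<in>W. poly2 P (g x) x = 0))" for d
  have "kills (degree P)" unfolding kills_def using U P by blast
  define d where "d = (LEAST d. kills d)"
  have "kills d" unfolding d_def by (rule LeastI) fact
  then obtain P W where PW: "P \<noteq> 0" "degree P = d" "W \<subseteq> U" "open W" "W \<noteq> {}"
     "\<And>x. x \<in> W \<Longrightarrow> poly2 P (g x) x = 0" unfolding kills_def by blast
  have min: "\<not> kills e" if "e < d" for e using that not_less_Least unfolding d_def by blast
  define E where "E R x = poly2 R (g x) x" for R x
  have "d \<noteq> 0"
  proof
    assume "d = 0"
    then obtain p where p: "P = [:p:]" using PW(2) degree_eq_zeroE by blast
    then have "W \<subseteq> {x. poly p x = 0}" using PW(6) by auto
    moreover have "p \<noteq> 0" using p PW(1) by auto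
    ultimately show False using PW(4,5) finite_imp_not_open finite_subset poly_roots_finite by metis
  qed
  then have "pderiv P \<noteq> 0" "degree (pderiv P) < d" using PW(2) by (auto simp: pderiv_eq_0_iff degree_pderiv)
  then have "\<exists>x\<in>W. E (pderiv P) x \<noteq> 0"
    using min[of "degree (pderiv P)"] PW unfolding kills_def E_def by blast
  define W' where "W' = {x \<in> W. E (pderiv P) x \<noteq> 0}"
  have gW: "g holomorphic_on W" using U(3) PW(3) by (rule holomorphic_on_subset)
  have W': "W' \<noteq> {}" "W' \<subseteq> W" using \<open>\<exists>x\<in>W. _\<close> by (auto simp: W'_def)
  have "open W'"
  proof -
    have "continuous_on W (E (pderiv P))" unfolding E_def
      by (intro holomorphic_on_imp_continuous_on holomorphic_poly_poly gW)
    from open_nonzero[OF this PW(4)] show ?thesis unfolding W'_def .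
  qed
  have gW': "g holomorphic_on W'" using gW W'(2) by (rule holomorphic_on_subset)
  have "\<exists>k R. \<forall>x\<in>W'. E (pderiv P) x ^ k * (deriv ^^ j) g x = E R x" for j
    unfolding E_def using algebraic_derivatives[OF \<open>open W'\<close> gW', of P j] PW(6) W'(2) by auto
  then obtain k R where R: "\<And>j x. x \<in> W' \<Longrightarrow> E (pderiv P) x ^ k j * (deriv ^^ j) g x = E (R j) x" by metis
  \<comment> \<open>A common exponent, so that all derivatives are multiplied by the same power of
    \<open>pderiv P\<close>.\<close>
  define K where "K = (\<Sum>j\<le>d. k j)"
  have kK: "k j \<le> K" if "j \<le> d" for j unfolding K_def using that by (intro member_le_sum) auto
  define R' where "R' j = pderiv P ^ (K - k j) * R j" for j
  define lc where "lc = coeff P (degree P)"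
  \<comment> \<open>Pseudo-division multiplies the dividend by this power of the leading coefficient
    instead of dividing by it; the factor reappears in the coefficients \<open>q\<close>.\<close>
  define e where "e j = Suc (degree (R' j)) - degree P" for j
  define r where "r j = snd (pseudo_divmod (R' j) P)" for j
  have E_mult: "E (A * B) x = E A x * E B x" "E (A ^ n) x = E A x ^ n" "E (A + B) x = E A x + E B x"
    "E (smult a B) x = poly a x * E B x" "E (\<Sum>i\<in>I. f i) x = (\<Sum>i\<in>I. E (f i) x)" for A B x n a I and f :: "nat \<Rightarrow> _"
    by (simp_all add: E_def poly_sum)
  have R': "E (pderiv P) x ^ K * (deriv ^^ j) g x = E (R' j) x" if "x \<in> W'" "j \<le> d" for x j
  proof -
    have "E (pderiv P) x ^ K = E (pderiv P) x ^ (K - k j) * E (pderiv P) x ^ k j"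
      using kK[OF that(2)] by (simp flip: power_add)
    then show ?thesis using R[OF that(1), of j] by (simp add: R'_def E_mult mult.assoc)
  qed
  have r: "smult (lc ^ e j) (R' j) = P * fst (pseudo_divmod (R' j) P) + r j" "r j = 0 \<or> degree (r j) < d" for j
    using pseudo_divmod[OF PW(1), of "R' j" "fst (pseudo_divmod (R' j) P)" "r j"] PW(2)
    by (simp_all add: lc_def e_def r_def)
  have Er: "poly (lc ^ e j) x * E (R' j) x = E (r j) x" if "x \<in> W'" for x j
  proof -
    have "E P x = 0" using PW(6) that W'(2) by (auto simp: E_def)
    then show ?thesis using arg_cong[OF r(1)[of j], of "\<lambda>A. E A x"] by (simp add: E_mult)
  qed
  obtain c where c: "\<exists>j\<in>{..d}. c j \<noteq> 0" "\<forall>i<d. (\<Sum>j\<in>{..d}. c j * coeff (r j) i) = 0"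
    using linear_dependence[of "{..d}" d "\<lambda>j i. coeff (r j) i"] by auto
  have "(\<Sum>j\<le>d. smult (c j) (r j)) = 0"
  proof (rule poly_eqI)
    fix i
    have "coeff (r j) i = 0" if "\<not> i < d" for j using r(2)[of j] that by (auto intro: coeff_eq_0)
    then show "coeff (\<Sum>j\<le>d. smult (c j) (r j)) i = coeff 0 i"
      using c(2) by (cases "i < d") (auto simp: coeff_sum)
  qed
  then have s0: "(\<Sum>j\<le>d. poly (c j) x * E (r j) x) = 0" for x
    using E_mult(5)[of "\<lambda>j. smult (c j) (r j)" "{..d}" x] by (simp add: E_mult) (simp add: E_def)
  define q where "q j = c j * lc ^ e j" for j
  have "lc \<noteq> 0" using PW(1) by (simp add: lc_def)
  have "(\<Sum>j\<le>d. poly (q j) x * (deriv ^^ j) g x) = 0" if x: "x \<in> W'" for x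
  proof -
    have "E (pderiv P) x ^ K * (\<Sum>j\<le>d. poly (q j) x * (deriv ^^ j) g x) =
        (\<Sum>j\<le>d. poly (c j) x * (poly (lc ^ e j) x * (E (pderiv P) x ^ K * (deriv ^^ j) g x)))"
      by (simp add: sum_distrib_left q_def mult_ac)
    also have "\<dots> = (\<Sum>j\<le>d. poly (c j) x * E (r j) x)"
      by (intro sum.cong refl) (simp only: R'[OF x] Er[OF x] atMost_iff)
    finally show ?thesis using s0 x by (simp add: W'_def)
  qed
  moreover have "\<exists>j\<le>d. q j \<noteq> 0" using c(1) \<open>lc \<noteq> 0\<close> by (auto simp: q_def)
  ultimately show ?thesis using W' \<open>open W'\<close> PW(3) by (intro exI[of _ W'] exI[of _ d] exI[of _ q]) blast
qed

lemma open_minus_roots: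
  assumes "open U" "U \<noteq> {}" "(p :: complex poly) \<noteq> 0"
  shows "open (U - {x. poly p x = 0})" "U - {x. poly p x = 0} \<noteq> {}"
proof -
  have fin: "finite {x. poly p x = 0}" using assms(3) by (rule poly_roots_finite)
  then show "open (U - {x. poly p x = 0})" using assms(1) by (simp add: open_Diff finite_imp_closed)
  show "U - {x. poly p x = 0} \<noteq> {}"
    using fin assms(1,2) finite_imp_not_open[of U] finite_subset[of U] by auto
qed

lemma tame_algebraic:
  assumes ts: "ts \<noteq> []" and U: "open U" "U \<noteq> {}" "g holomorphic_on U"
    and P: "P \<noteq> 0" "\<And>x. x \<in> U \<Longrightarrow> poly2 P (g x) x = 0"
  shows "\<exists>U'\<subseteq>U. open U' \<and> U' \<noteq> {} \<and> tame ts U' g"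
proof -
  obtain W d q where W: "W \<subseteq> U" "open W" "W \<noteq> {}" "\<exists>j\<le>d. q j \<noteq> (0 :: complex poly)"
    "\<And>x. x \<in> W \<Longrightarrow> (\<Sum>j\<le>d. poly (q j) x * (deriv ^^ j) g x) = 0"
    using algebraic_imp_scalar_ode[OF U P] by blast
  \<comment> \<open>The true order of the equation, whose leading coefficient can be divided out.
    Order 0 means that \<open>g\<close> vanishes on \<open>W'\<close>.\<close>
  define n where "n = Max {j. j \<le> d \<and> q j \<noteq> 0}"
  have "n \<in> {j. j \<le> d \<and> q j \<noteq> 0}" unfolding n_def using W(4) by (intro Max_in) auto
  then have n: "n \<le> d" "q n \<noteq> 0" by auto
  have nmax: "j \<le> n" if "j \<le> d" "q j \<noteq> 0" for j unfolding n_def using that by (intro Max_ge) auto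
  define S where "S = {x. poly (q n) x = 0}"
  define W' where "W' = W - S"
  have W': "open W'" "W' \<noteq> {}" unfolding W'_def S_def using open_minus_roots W n by blast+
  have gW': "g holomorphic_on W'" using U(3) by (rule holomorphic_on_subset) (use W in \<open>auto simp: W'_def\<close>)
  define b where "b j x = - poly (q j) x / poly (q n) x" for j x
  have ode: "(deriv ^^ n) g x = (\<Sum>j<n. b j x * (deriv ^^ j) g x)" if x: "x \<in> W'" for x
  proof -
    have "(\<Sum>j\<le>d. poly (q j) x * (deriv ^^ j) g x) = (\<Sum>j\<le>n. poly (q j) x * (deriv ^^ j) g x)"
      using n(1) nmax by (intro sum.mono_neutral_right) force+
    also have "\<dots> = (\<Sum>j<n. poly (q j) x * (deriv ^^ j) g x) + poly (q n) x * (deriv ^^ n) g x"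
      by (simp add: lessThan_Suc_atMost[symmetric])
    finally have "(\<Sum>j<n. poly (q j) x * (deriv ^^ j) g x) + poly (q n) x * (deriv ^^ n) g x = 0"
      using W(5)[of x] x by (simp add: W'_def)
    moreover have "(\<Sum>j<n. b j x * (deriv ^^ j) g x) = - (\<Sum>j<n. poly (q j) x * (deriv ^^ j) g x) / poly (q n) x"
      by (simp add: b_def sum_divide_distrib sum_negf)
    moreover have "poly (q n) x \<noteq> 0" using x by (simp add: W'_def S_def)
    ultimately have "poly (q n) x * (deriv ^^ n) g x = poly (q n) x * (\<Sum>j<n. b j x * (deriv ^^ j) g x)"
      by (simp add: add_eq_0_iff)
    with \<open>poly (q n) x \<noteq> 0\<close> show ?thesis by simp
  qed
  show ?thesis
  proof (cases "n = 0")
    case True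
    then have "g x = 0" if "x \<in> W'" for x using ode[OF that] by simp
    then have "tame ts W' g"
      using W'(1) unfolding open_contains_ball by (intro tame_locally_const[OF ts]) (metis subsetD centre_in_ball)
    then show ?thesis using W W' by (intro exI[of _ W']) (auto simp: W'_def)
  next
    case False
    have hol: "companion n b i j holomorphic_on - S" if "i < n" "j < n" for i j
      by (rule companion_holomorphic[OF _ that(2)])
        (auto simp: b_def[abs_def] S_def intro!: holomorphic_intros)
    have "tame ts W' g"
      by (rule tame_algebraic_solution[OF ts _ _ W'(1) hol lin_sol_companion[OF W'(1) gW' ode] _ P(1)])
        (use False P(2) W n in \<open>auto simp: S_def W'_def poly_roots_finite\<close>)
    then show ?thesis using W W' by (intro exI[of _ W']) (auto simp: W'_def)
  qed
qed

text \<open>The property holds on a punctured neighbourhood of any point of \<open>W\<close>, which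
  contains a nonempty open set. In this way identities up to sparse sets become identities without
  exceptions.\<close>

lemma cosparse_open_subset:
  assumes "\<forall>\<^sub>\<approx>x\<in>U. Q x" "open W" "W \<noteq> {}" "W \<subseteq> U"
  shows "\<exists>W'\<subseteq>W. open W' \<and> W' \<noteq> {} \<and> (\<forall>x\<in>W'. Q (x::complex))"
proof -
  obtain w where w: "w \<in> W" using assms by auto
  then have "eventually Q (at w)" using eventually_cosparse_imp_eventually_at[OF assms(1)] assms(4) by auto
  then obtain A where A: "open A" "w \<in> A" "\<forall>x\<in>A. x \<noteq> w \<longrightarrow> Q x" by (auto simp: eventually_at_topological)
  have "open (A \<inter> W - {w})" using A assms by (intro open_Diff open_Int) auto
  moreover have "A \<inter> W - {w} \<noteq> {}"
  proof
    assume "A \<inter> W - {w} = {}"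
    then have "A \<inter> W = {w}" using A w by auto
    moreover have "open (A \<inter> W)" using A assms by auto
    ultimately show False using not_open_singleton[of w] by simp
  qed
  ultimately show ?thesis using A by (intro exI[of _ "A \<inter> W - {w}"]) auto
qed

lemma ratfun_den_nonzero: "ratfun_den r \<noteq> 0"
  by (simp add: ratfun_den_def)

lemma ratfun_num_nonzero: "r \<noteq> 0 \<Longrightarrow> ratfun_num r \<noteq> 0"
  using Fract_quot_of_fract[of r] by (auto simp: ratfun_num_def fract_collapse)

lemma tame_algebraic_function:
  assumes ts: "ts \<noteq> []" and g: "algebraic_function_on U g" and W: "open W" "W \<noteq> {}" "W \<subseteq> U"
  shows "\<exists>U'\<subseteq>W. open U' \<and> U' \<noteq> {} \<and> tame ts U' g"
proof -
  obtain P :: "ratfun poly" where P: "P \<noteq> 0"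
    "\<forall>\<^sub>\<approx>x\<in>U. (\<Sum>i\<le>degree P. ratfun_eval (coeff P i) x * g x ^ i) = 0" and mero: "g meromorphic_on U"
    using g by (auto simp: algebraic_function_on_def)
  let ?n = "degree P"
  define nu de where "nu i = ratfun_num (coeff P i)" and "de i = ratfun_den (coeff P i)" for i
  have "\<forall>\<^sub>\<approx>x\<in>U. g analytic_on {x} \<and> (\<Sum>i\<le>?n. ratfun_eval (coeff P i) x * g x ^ i) = 0"
    by (intro eventually_conj meromorphic_on_imp_analytic_cosparse mero P(2))
  from cosparse_open_subset[OF this W] obtain W1 where W1: "W1 \<subseteq> W" "open W1" "W1 \<noteq> {}"
    "\<And>x. x \<in> W1 \<Longrightarrow> g analytic_on {x}"
    "\<And>x. x \<in> W1 \<Longrightarrow> (\<Sum>i\<le>?n. ratfun_eval (coeff P i) x * g x ^ i) = 0" by blast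
  define pd where "pd = (\<Prod>i\<le>?n. de i)"
  have "pd \<noteq> 0" by (simp add: pd_def de_def ratfun_den_nonzero)
  define W2 where "W2 = W1 - {x. poly pd x = 0}"
  have W2: "open W2" "W2 \<noteq> {}" unfolding W2_def using open_minus_roots[OF W1(2,3) \<open>pd \<noteq> 0\<close>] by auto
  \<comment> \<open>\<open>P\<close> multiplied by the product of all denominators: term
    \<open>i\<close> retains the denominators of the other terms.\<close>
  define Q where "Q = (\<Sum>i\<le>?n. monom (nu i * (\<Prod>l\<in>{..?n} - {i}. de l)) i)"
  have "coeff Q ?n = nu ?n * (\<Prod>l\<in>{..?n} - {?n}. de l)" by (simp add: Q_def coeff_sum)
  moreover have "nu ?n \<noteq> 0" unfolding nu_def using P(1) by (intro ratfun_num_nonzero) simp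
  ultimately have "Q \<noteq> 0" by (auto simp: de_def ratfun_den_nonzero)
  have "poly2 Q (g x) x = 0" if x: "x \<in> W2" for x
  proof -
    have nz: "poly (de i) x \<noteq> 0" if "i \<le> ?n" for i
      using x that by (auto simp: W2_def pd_def poly_prod)
    have "poly2 Q (g x) x = (\<Sum>i\<le>?n. poly (nu i) x * (\<Prod>l\<in>{..?n} - {i}. poly (de l) x) * g x ^ i)"
      by (simp add: Q_def poly_sum poly_monom poly_prod)
    also have "\<dots> = (\<Sum>i\<le>?n. (\<Prod>l\<le>?n. poly (de l) x) * (ratfun_eval (coeff P i) x * g x ^ i))"
    proof (intro sum.cong refl)
      fix i assume i: "i \<in> {..?n}"
      have "(\<Prod>l\<le>?n. poly (de l) x) = poly (de i) x * (\<Prod>l\<in>{..?n} - {i}. poly (de l) x)"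
        using i by (simp add: prod.remove)
      then show "poly (nu i) x * (\<Prod>l\<in>{..?n} - {i}. poly (de l) x) * g x ^ i =
          (\<Prod>l\<le>?n. poly (de l) x) * (ratfun_eval (coeff P i) x * g x ^ i)"
        using nz[of i] i by (simp add: ratfun_eval_def nu_def[symmetric] de_def[symmetric])
    qed
    also have "\<dots> = (\<Prod>l\<le>?n. poly (de l) x) * (\<Sum>i\<le>?n. ratfun_eval (coeff P i) x * g x ^ i)"
      by (simp add: sum_distrib_left)
    also have "\<dots> = 0" using W1(5) x by (simp add: W2_def)
    finally show ?thesis .
  qed
  moreover have "g holomorphic_on W2"
    using W1(4) unfolding W2_def by (intro analytic_imp_holomorphic) (auto simp: analytic_on_def)
  ultimately obtain U' where "U' \<subseteq> W2" "open U'" "U' \<noteq> {}" "tame ts U' g"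
    using tame_algebraic[OF ts W2] \<open>Q \<noteq> 0\<close> by blast
  then show ?thesis using W1(1) by (intro exI[of _ U']) (auto simp: W2_def)
qed

subsection \<open>Hypergeometric equations\<close>

abbreviation ode_residual :: "ratfun list \<Rightarrow> cfun \<Rightarrow> cfun" where
  "ode_residual cs y x \<equiv> (deriv ^^ length cs) y x + (\<Sum>i<length cs. ratfun_eval (cs ! i) x * (deriv ^^ i) y x)"

abbreviation hypergeom_residual :: "complex list \<Rightarrow> complex list \<Rightarrow> cfun \<Rightarrow> cfun" where
  "hypergeom_residual a b y x \<equiv> delta (delta_prod (map (\<lambda>b. b - 1) b) y) x - x * delta_prod a y x"

text \<open>\<open>\<delta>\<close> commutes with constants, so \<open>delta_prod cs\<close> is this
  polynomial evaluated at \<open>\<delta>\<close>.\<close>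

definition linear_factors :: "complex list \<Rightarrow> complex poly" where
  "linear_factors cs = prod_list (map (\<lambda>c. [:c, 1:]) cs)"

lemma linear_factors_simps [simp]:
  "linear_factors [] = 1" "linear_factors (c # cs) = [:c, 1:] * linear_factors cs"
  by (simp_all add: linear_factors_def)

lemma linear_factors_monic: "degree (linear_factors cs) = length cs \<and> coeff (linear_factors cs) (length cs) = 1"
proof (induction cs)
  case (Cons c cs)
  then have "linear_factors cs \<noteq> 0" by auto
  then have deg: "degree ([:c, 1:] * linear_factors cs) = Suc (length cs)"
    using Cons by (subst degree_mult_eq) auto
  have "lead_coeff ([:c, 1:] * linear_factors cs) = 1"
    unfolding lead_coeff_mult using Cons by simp
  with deg show ?case by simp
qed simp

lemma delta_iter_holomorphic: "open D \<Longrightarrow> y holomorphic_on D \<Longrightarrow> (delta ^^ i) y holomorphic_on D"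
proof (induction i)
  case (Suc i)
  then have "(\<lambda>x. x * deriv ((delta ^^ i) y) x) holomorphic_on D" by (intro holomorphic_intros) auto
  then show ?case by (simp add: delta_def[of "(delta ^^ i) y"])
qed simp

lemma delta_prod_expand:
  assumes D: "open D" "y holomorphic_on D" and "x \<in> D"
  shows "delta_prod cs y x = (\<Sum>i\<le>length cs. coeff (linear_factors cs) i * (delta ^^ i) y x)"
  using \<open>x \<in> D\<close>
proof (induction cs arbitrary: x)
  case Nil
  show ?case by (simp add: delta_prod_def)
next
  case (Cons c cs)
  let ?q = "linear_factors cs" and ?n = "length cs"
  let ?S = "\<lambda>x. \<Sum>i\<le>?n. coeff ?q i * (delta ^^ i) y x"
  have "(?S has_field_derivative (\<Sum>i\<le>?n. coeff ?q i * deriv ((delta ^^ i) y) x)) (at x)"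
    by (intro DERIV_sum DERIV_cmult holomorphic_derivI[OF delta_iter_holomorphic[OF D] D(1) Cons.prems])
  then have "(delta_prod cs y has_field_derivative (\<Sum>i\<le>?n. coeff ?q i * deriv ((delta ^^ i) y) x)) (at x)"
    by (rule has_field_derivative_transform_within_open[OF _ D(1) Cons.prems]) (simp add: Cons.IH)
  then have "delta (delta_prod cs y) x = x * (\<Sum>i\<le>?n. coeff ?q i * deriv ((delta ^^ i) y) x)"
    by (simp add: delta_def DERIV_imp_deriv)
  also have "\<dots> = (\<Sum>i\<le>?n. coeff ?q i * (delta ^^ Suc i) y x)"
    by (simp add: delta_def sum_distrib_left mult_ac)
  finally have d: "delta (delta_prod cs y) x = (\<Sum>i\<le>?n. coeff ?q i * (delta ^^ Suc i) y x)" .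
  have "delta_prod (c # cs) y x = delta (delta_prod cs y) x + c * delta_prod cs y x"
    by (simp add: delta_prod_def)
  also have "\<dots> = (\<Sum>i\<le>?n. coeff ?q i * (delta ^^ Suc i) y x) + (\<Sum>i\<le>?n. c * coeff ?q i * (delta ^^ i) y x)"
    unfolding d Cons.IH[OF Cons.prems] by (simp add: sum_distrib_left mult_ac)
  also have "(\<Sum>i\<le>?n. coeff ?q i * (delta ^^ Suc i) y x) =
      (\<Sum>i\<le>Suc ?n. coeff (pCons 0 ?q) i * (delta ^^ i) y x)"
    by (simp add: sum.atMost_Suc_shift del: sum.atMost_Suc)
  also have "(\<Sum>i\<le>?n. c * coeff ?q i * (delta ^^ i) y x) = (\<Sum>i\<le>Suc ?n. coeff (smult c ?q) i * (delta ^^ i) y x)"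
    by (simp add: coeff_eq_0 linear_factors_monic)
  finally show ?case by (simp add: sum.distrib[symmetric] distrib_right add.commute)
qed

text \<open>Written in powers of \<open>\<delta>\<close>, the equation has leading coefficient
  \<open>1 - x\<close>, since both products of linear factors are monic of order \<open>p\<close>.
  Replacing the derivative by \<open>\<delta> / x\<close> adds the pole at 0, and there are no
  others.\<close>

lemma lin_sol_hypergeom:
  assumes "length a = p" "p \<ge> 1" "length b = p - 1"
  defines "\<gamma> \<equiv> \<lambda>i x. (x * coeff (linear_factors a) i -
     (if i = 0 then 0 else coeff (linear_factors (map (\<lambda>b. b - 1) b)) (i - 1))) / (1 - x)"
  assumes D: "open D" "y holomorphic_on D" and sing: "0 \<notin> D" "1 \<notin> D"
    and eq: "\<And>x. x \<in> D \<Longrightarrow> hypergeom_residual a b y x = 0"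
  shows "lin_sol p (\<lambda>i j x. companion p \<gamma> i j x / x) D (\<lambda>i. (delta ^^ i) y)"
  unfolding lin_sol_def
proof (intro allI impI ballI)
  fix i x assume i: "i < p" and x: "x \<in> D"
  let ?q = "linear_factors (map (\<lambda>b. b - 1) b)" and ?r = "linear_factors a"
  let ?d = "\<lambda>i. (delta ^^ i) y x"
  have "x \<noteq> 0" "x \<noteq> 1" using x sing by auto
  have der: "((delta ^^ i) y has_field_derivative ?d (Suc i) / x) (at x)"
    using holomorphic_derivI[OF delta_iter_holomorphic[OF D] D(1) x, of i] \<open>x \<noteq> 0\<close> by (simp add: delta_def)
  obtain n where n: "p = Suc n" using \<open>p \<ge> 1\<close> by (cases p) auto
  have "delta (delta_prod (map (\<lambda>b. b - 1) b) y) x = delta_prod (0 # map (\<lambda>b. b - 1) b) y x"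
    by (simp add: delta_prod_def)
  also have "\<dots> = (\<Sum>i\<le>p. coeff (pCons 0 ?q) i * ?d i)"
    using delta_prod_expand[OF D x, of "0 # map (\<lambda>b. b - 1) b"] assms(3) n by simp
  finally have "(\<Sum>i\<le>p. coeff (pCons 0 ?q) i * ?d i) - x * (\<Sum>i\<le>p. coeff ?r i * ?d i) = 0"
    using eq[OF x] delta_prod_expand[OF D x, of a] assms(1) by simp
  moreover have "coeff (pCons 0 ?q) p = 1" "coeff ?r p = 1"
    using linear_factors_monic[of "map (\<lambda>b. b - 1) b"] linear_factors_monic[of a] assms(1,3) n by simp_all
  ultimately have "(1 - x) * ?d p = x * (\<Sum>i<p. coeff ?r i * ?d i) - (\<Sum>i<p. coeff (pCons 0 ?q) i * ?d i)"
    by (simp add: lessThan_Suc_atMost[symmetric] algebra_simps)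
  also have "\<dots> = (1 - x) * (\<Sum>i<p. \<gamma> i x * ?d i)"
  proof -
    have "(1 - x) * \<gamma> i x = x * coeff ?r i - coeff (pCons 0 ?q) i" for i
      using \<open>x \<noteq> 1\<close> by (cases i) (simp_all add: \<gamma>_def)
    then have "(1 - x) * (\<gamma> i x * ?d i) = x * (coeff ?r i * ?d i) - coeff (pCons 0 ?q) i * ?d i" for i
      by (simp add: mult.assoc[symmetric] left_diff_distrib)
    then show ?thesis by (simp add: sum_distrib_left sum_subtractf)
  qed
  finally have top: "?d p = (\<Sum>i<p. \<gamma> i x * ?d i)" using \<open>x \<noteq> 1\<close> by simp
  have "(\<Sum>j<p. companion p \<gamma> i j x / x * ?d j) = (\<Sum>j<p. companion p \<gamma> i j x * ?d j) / x"
    by (simp add: sum_divide_distrib)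
  also have "(\<Sum>j<p. companion p \<gamma> i j x * ?d j) = ?d (Suc i)"
  proof (cases "Suc i < p")
    case False
    then have "Suc i = p" using i by simp
    then show ?thesis using companion_sum[OF i, of \<gamma> x ?d] top by simp
  qed (use companion_sum[OF i, of \<gamma> x ?d] in simp)
  finally show "((delta ^^ i) y has_field_derivative (\<Sum>j<p. companion p \<gamma> i j x / x * ?d j)) (at x)"
    using der by simp
qed

lemma lin_sol_compose:
  assumes Y: "lin_sol n B W Y" and l: "open D" "l holomorphic_on D" "l ` D \<subseteq> W"
  shows "lin_sol n (\<lambda>i j z. deriv l z * B i j (l z)) D (\<lambda>i. Y i \<circ> l)"
  unfolding lin_sol_def
proof (intro allI impI ballI)
  fix i z assume "i < n" "z \<in> D"
  then have "(Y i has_field_derivative (\<Sum>j<n. B i j (l z) * Y j (l z))) (at (l z))"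
    using l(3) by (intro lin_solD[OF Y]) auto
  from DERIV_chain[OF this holomorphic_derivI[OF l(2,1) \<open>z \<in> D\<close>]]
  show "(Y i \<circ> l has_field_derivative (\<Sum>j<n. deriv l z * B i j (l z) * (Y j \<circ> l) z)) (at z)"
    by (simp add: sum_distrib_left mult_ac)
qed

text \<open>A point on the slit of \<open>t\<close> is collinear with \<open>c\<close> and
  \<open>t\<close>, so a point in general position with respect to \<open>insert c T\<close> lies on
  no slit.\<close>

lemma slit_plane_meets_open:
  assumes "finite T" "c \<notin> T" "open V" "V \<noteq> {}"
  shows "V \<inter> slit_plane T c \<noteq> {}"
proof -
  obtain z where z: "z \<in> V" "generic_centre (insert c T) z"
    using exists_generic_centre[of "insert c T" V] assms by auto
  have "z \<notin> slit c t" if t: "t \<in> T" for t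
  proof
    assume "z \<in> slit c t"
    define r where "r = Re ((z - c) / (t - c))"
    have r: "r \<ge> 1" "(z - c) / (t - c) = of_real r"
      using \<open>z \<in> slit c t\<close> by (auto simp: slit_def r_def complex_eq_iff)
    have tc: "t \<noteq> c" using t assms by auto
    have zc: "z \<noteq> c" using z by (auto simp: generic_centre_def)
    have e: "z - c = of_real r * (t - c)" using r tc by (simp add: field_simps)
    have "t - z = (1 - of_real r) * (t - c)" using e by (simp add: algebra_simps)
    moreover have "c - z = - of_real r * (t - c)" using e by (simp add: algebra_simps)
    ultimately have "(t - z) / (c - z) = (1 - of_real r) / (- of_real r)" using tc by simp
    also have "\<dots> = of_real ((1 - r) / (- r))" by simp
    finally have "Im ((t - z) / (c - z)) = 0" by (simp only: Im_complex_of_real)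
    then show False using z(2) t tc by (auto simp: generic_centre_def)
  qed
  then show ?thesis using z(1) by (auto simp: slit_plane_def)
qed

text \<open>The values of \<open>p + 1\<close> vector solutions at one point are dependent, and
  uniqueness propagates the relation to all of \<open>V\<close>. Independence of the first
  components forces \<open>G\<close> to occur in it.\<close>

lemma solutions_span:
  assumes V: "open V" "connected V" "V \<noteq> {}"
    and hol: "\<And>i j. i < p \<Longrightarrow> j < p \<Longrightarrow> B i j holomorphic_on V" and "p > 0"
    and Y: "\<And>k. k < p \<Longrightarrow> lin_sol p B V (Y k)" and G: "lin_sol p B V G"
    and indep: "\<And>c. \<forall>z\<in>V. (\<Sum>k<p. c k * Y k 0 z) = 0 \<Longrightarrow> \<forall>k<p. c k = 0"
  shows "\<exists>e. \<forall>z\<in>V. G 0 z = (\<Sum>k<p. e k * Y k 0 z)"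
proof -
  obtain v where v: "v \<in> V" using V(3) by auto
  define Z where "Z k = (if k < p then Y k else G)" for k
  have Zsol: "lin_sol p B V (Z k)" for k using Y G by (simp add: Z_def)
  obtain c where c: "\<exists>k\<in>{..p}. c k \<noteq> 0" "\<forall>i<p. (\<Sum>k\<in>{..p}. c k * Z k i v) = 0"
    using linear_dependence[of "{..p}" p "\<lambda>k i. Z k i v"] by auto
  have "lin_sol p B V (\<lambda>i z. \<Sum>k\<in>{..p}. c k * Z k i z)" using Zsol by (rule lin_sol_lincomb)
  moreover have "lin_sol p B V (\<lambda>i z. 0)" by (simp add: lin_sol_def)
  ultimately have "(\<Sum>k\<in>{..p}. c k * Z k 0 z) = 0" if "z \<in> V" for z
    by (rule lin_sol_unique[OF _ _ V(1,2) v hol _ \<open>p > 0\<close> that]) (use c(2) in auto)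
  then have zero: "(\<Sum>k<p. c k * Y k 0 z) + c p * G 0 z = 0" if "z \<in> V" for z
    using that by (simp add: Z_def lessThan_Suc_atMost[symmetric])
  have "c p \<noteq> 0"
  proof
    assume "c p = 0"
    then have "\<forall>k<p. c k = 0" using zero by (intro indep) auto
    then show False using c(1) \<open>c p = 0\<close> by (auto simp: le_less)
  qed
  then have "G 0 z = (\<Sum>k<p. (- c k / c p) * Y k 0 z)" if "z \<in> V" for z
    using zero[OF that] by (simp add: sum_negf sum_divide_distrib[symmetric] field_simps add_eq_0_iff)
  then show ?thesis by (intro exI[of _ "\<lambda>k. - c k / c p"]) blast
qed

text \<open>With \<open>c = 0\<close> and \<open>c = 1\<close> this makes the fibres over 0 and 1
  finite; with arbitrary \<open>c\<close> it makes \<open>\<lambda>\<close> an open map.\<close>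

lemma ratfun_nonconstant:
  assumes "\<nexists>c. l = to_fract [:c:]"
  shows "ratfun_num l \<noteq> smult c (ratfun_den l)"
proof
  assume "ratfun_num l = smult c (ratfun_den l)"
  then have "l = Fract (smult c (ratfun_den l)) (ratfun_den l)"
    using Fract_quot_of_fract[of l] by (simp add: ratfun_num_def ratfun_den_def)
  also have "\<dots> = to_fract [:c:]"
    unfolding to_fract_def using ratfun_den_nonzero[of l] by (simp add: eq_fract)
  finally show False using assms by blast
qed

lemma ratfun_eval_holomorphic:
  "ratfun_eval l holomorphic_on - {x. poly (ratfun_den l) x = 0}"
  unfolding ratfun_eval_def[abs_def] by (intro holomorphic_intros) auto

lemma ode_solution_lin_sol:
  assumes D: "open D" "y holomorphic_on D"
    and eq: "\<And>x. x \<in> D \<Longrightarrow> ode_residual cs y x = 0"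
  shows "lin_sol (length cs) (companion (length cs) (\<lambda>j x. - ratfun_eval (cs ! j) x)) D (\<lambda>i. (deriv ^^ i) y)"
proof (rule lin_sol_companion[OF D])
  fix z assume "z \<in> D"
  from eq[OF this] show "(deriv ^^ length cs) y z = (\<Sum>j<length cs. - ratfun_eval (cs ! j) z * (deriv ^^ j) y z)"
    by (simp add: sum_negf add_eq_0_iff2)
qed

text \<open>
  A solution of the pulled back equation extends across the apparent singularities: near the
  domain where the pullback was formed it is \<open>Y \<circ> \<lambda>\<close> for a solution \<open>Y\<close> of the hypergeometric
  equation, and this solves a linear system whose only poles lie over \<open>0\<close>, \<open>1\<close> and \<open>\<infinity>\<close>.
\<close>

lemma pullback_extends:
  assumes p: "length a \<ge> 1" "length b = length a - 1" and pull: "is_pullback a b l cs"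
    and nc: "\<nexists>c. l = to_fract [:c:]"
  defines "S \<equiv> {x. poly (ratfun_num l) x = 0 \<or> poly (ratfun_den l) x = 0 \<or> poly (ratfun_num l - ratfun_den l) x = 0}"
  defines "T1 \<equiv> S \<union> (\<Union>i<length cs. {x. poly (ratfun_den (cs ! i)) x = 0})"
  shows "\<exists>B. (\<forall>i<length a. \<forall>j<length a. B i j holomorphic_on - S) \<and>
    (\<forall>U y c. open U \<longrightarrow> y holomorphic_on U \<longrightarrow> c \<in> U \<longrightarrow> generic_centre T1 c \<longrightarrow>
      (\<forall>x\<in>U. ode_residual cs y x = 0) \<longrightarrow>
      (\<exists>Z r. r > 0 \<and> lin_sol (length a) B (slit_plane S c) Z \<and> (\<forall>z\<in>ball c r. Z 0 z = y z)))"
proof -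
  let ?p = "length a" and ?l = "ratfun_eval l"
  define \<gamma> where "\<gamma> i x = (x * coeff (linear_factors a) i -
     (if i = 0 then 0 else coeff (linear_factors (map (\<lambda>b. b - 1) b)) (i - 1))) / (1 - x)" for i and x :: complex
  define H where "H i j x = companion ?p \<gamma> i j x / x" for i j x
  define B where "B i j z = deriv ?l z * H i j (?l z)" for i j z
  define C where "C = companion (length cs) (\<lambda>j x. - ratfun_eval (cs ! j) x)"
  have nd: "ratfun_num l \<noteq> 0" "ratfun_num l - ratfun_den l \<noteq> 0"
    using ratfun_nonconstant[OF nc, of 0] ratfun_nonconstant[OF nc, of 1] by auto
  have "finite S" unfolding S_def using nd ratfun_den_nonzero[of l]
    by (simp add: Collect_disj_eq poly_roots_finite del: poly_diff)
  then have finT: "finite T1" unfolding T1_def by (auto simp: poly_roots_finite ratfun_den_nonzero)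
  have lS: "?l holomorphic_on - S"
    by (rule holomorphic_on_subset[OF ratfun_eval_holomorphic]) (auto simp: S_def)
  have oS: "open (- S)" using \<open>finite S\<close> by (simp add: finite_imp_closed open_Compl)
  have l01: "?l z \<noteq> 0 \<and> ?l z \<noteq> 1" if "z \<notin> S" for z using that by (auto simp: S_def ratfun_eval_def)
  have "\<gamma> i holomorphic_on - {0, 1}" for i
    unfolding \<gamma>_def[abs_def] by (cases "i = 0") (auto intro!: holomorphic_intros)
  then have "H i j holomorphic_on - {0, 1}" if "j < ?p" for i j
    unfolding H_def[abs_def] using that by (intro holomorphic_on_divide companion_holomorphic holomorphic_intros) auto
  then have HS: "(H i j \<circ> ?l) holomorphic_on - S" if "j < ?p" for i j
    using that l01 by (intro holomorphic_on_compose_gen[OF lS]) auto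
  have holB: "B i j holomorphic_on - S" if "i < ?p" "j < ?p" for i j
    unfolding B_def[abs_def] using HS[OF that(2), of i]
    by (intro holomorphic_on_mult holomorphic_deriv lS oS) (simp add: o_def)
  have len: "length cs = ?p" using pull by (simp add: is_pullback_def)
  have holC: "C i j holomorphic_on - T1" if "i < ?p" "j < ?p" for i j
    unfolding C_def len
    by (rule companion_holomorphic[OF _ that(2)])
      (intro holomorphic_on_minus holomorphic_on_subset[OF ratfun_eval_holomorphic], auto simp: T1_def len)
  obtain V W ys where V: "open V" "connected V" "V \<noteq> {}" and W: "open W" "connected W" "W \<noteq> {}"
    and lV: "\<forall>x\<in>V. poly (ratfun_den l) x \<noteq> 0 \<and> ?l x \<in> W" and lys: "length ys = ?p"
    and bW: "basis_on W (hypergeom_solutions a b W) ys"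
    and bV: "basis_on V (ode_solutions cs V) (map (\<lambda>y. y \<circ> ?l) ys)"
    using pull unfolding is_pullback_def by blast
  have indV: "\<forall>c::nat \<Rightarrow> complex. (\<forall>\<^sub>\<approx>x\<in>V. (\<Sum>i<length (map (\<lambda>y. y \<circ> ?l) ys). c i * (map (\<lambda>y. y \<circ> ?l) ys ! i) x) = 0)
      \<longrightarrow> (\<forall>i<length (map (\<lambda>y. y \<circ> ?l) ys). c i = 0)"
    using bV unfolding basis_on_def by (elim conjE)
  have ysW: "ys ! k \<in> hypergeom_solutions a b W" if "k < ?p" for k
    using bW that lys nth_mem[of k ys] unfolding basis_on_def by auto
  have ysV: "ys ! k \<circ> ?l \<in> ode_solutions cs V" if "k < ?p" for k
    using bV that lys nth_mem[of k ys] unfolding basis_on_def by auto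
  show ?thesis
  proof (intro exI[of _ B] conjI allI impI holB)
    fix U y c assume U: "open U" "y holomorphic_on U" "c \<in> U" "generic_centre T1 c"
      and ode: "\<forall>x\<in>U. ode_residual cs y x = 0"
    let ?D = "slit_plane T1 c"
    note oD = open_slit_plane[OF U(4)]
    have cT: "c \<notin> T1" using U(4) by (simp add: generic_centre_def)
    have "S \<subseteq> T1" by (auto simp: T1_def)
    have genS: "generic_centre S c" using U(4) \<open>S \<subseteq> T1\<close> by (rule generic_centre_subset)
    have DT: "?D \<subseteq> - T1" by (rule slit_plane_subset_compl[OF cT])
    have holCD: "C i j holomorphic_on ?D" if "i < ?p" "j < ?p" for i j
      using holC[OF that] DT by (rule holomorphic_on_subset)
    \<comment> \<open>\<open>G\<close> continues \<open>y\<close> from \<open>c\<close> to the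
      possibly distant domain \<open>V\<close>. At this stage the poles of all coefficients of
      \<open>cs\<close> carry slits as well.\<close>
    have "\<exists>G. lin_sol ?p C ?D G \<and> (\<forall>i<?p. G i c = (deriv ^^ i) y c)"
      by (rule lin_sol_exists_slit_plane[OF U(4) holC centre_in_slit_plane])
    then obtain G where G: "lin_sol ?p C ?D G" "\<forall>i<?p. G i c = (deriv ^^ i) y c" by blast
    have ysol: "lin_sol ?p C U (\<lambda>i. (deriv ^^ i) y)"
      using ode_solution_lin_sol[OF U(1,2), of cs] ode unfolding C_def len by simp
    have "open (U \<inter> ?D)" "c \<in> U \<inter> ?D" using oD U(1,3) centre_in_slit_plane by auto
    then obtain r where r: "r > 0" "ball c r \<subseteq> U \<inter> ?D" using open_contains_ball by metis
    have p0: "0 < ?p" using p(1) by linarith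
    have Gy: "G 0 z = y z" if "z \<in> ball c r" for z
    proof -
      have "G 0 z = (deriv ^^ 0) y z"
      proof (rule lin_sol_unique[OF lin_sol_subset[OF G(1)] lin_sol_subset[OF ysol] open_ball connected_ball _ _ _ p0 that])
        show "C i j holomorphic_on ball c r" if "i < ?p" "j < ?p" for i j
          using holCD[OF that] r(2) by (auto intro: holomorphic_on_subset)
      qed (use r G in auto)
      then show ?thesis by simp
    qed
    have V1: "open (V \<inter> ?D)" "V \<inter> ?D \<noteq> {}"
      using V oD slit_plane_meets_open[OF finT cT V(1,3)] by auto
    define f where "f k = ys ! k \<circ> ?l" for k
    have "\<forall>\<^sub>\<approx>x\<in>V. \<forall>k\<in>{..<?p}. f k analytic_on {x} \<and>
        ode_residual cs (f k) x = 0"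
      using ysV unfolding f_def ode_solutions_def
      by (intro eventually_ball_finite ballI eventually_conj meromorphic_on_imp_analytic_cosparse) auto
    from cosparse_open_subset[OF this V1] obtain V2 where V2: "V2 \<subseteq> V \<inter> ?D" "open V2" "V2 \<noteq> {}"
      and fV2: "\<forall>x\<in>V2. \<forall>k\<in>{..<?p}. f k analytic_on {x} \<and>
        ode_residual cs (f k) x = 0"
      by blast
    have f_an: "f k analytic_on {x}"
      and f_ode: "ode_residual cs (f k) x = 0"
      if "x \<in> V2" "k < ?p" for x k
      using fV2 that by blast+
    obtain v0 where "v0 \<in> V2" using V2(3) by auto
    then obtain \<rho>0 where r0: "\<rho>0 > 0" "ball v0 \<rho>0 \<subseteq> V2" using V2(2) open_contains_ball by metis
    let ?b0 = "ball v0 \<rho>0"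
    have b0S: "?b0 \<subseteq> - S" using r0 V2(1) DT \<open>S \<subseteq> T1\<close> by blast
    have lb0: "?l holomorphic_on ?b0" using lS b0S by (rule holomorphic_on_subset)
    \<comment> \<open>Being nonconstant, \<open>\<lambda>\<close> maps the ball onto an open set, in
      which there is room to avoid the sparse set where the hypergeometric equation fails.\<close>
    have ncb: "\<not> ?l constant_on ?b0"
    proof
      assume "?l constant_on ?b0"
      then obtain d where d: "\<forall>x\<in>?b0. ?l x = d" by (auto simp: constant_on_def)
      have "?b0 \<subseteq> {x. poly (ratfun_num l - smult d (ratfun_den l)) x = 0}"
      proof
        fix x assume x: "x \<in> ?b0"
        then have "poly (ratfun_den l) x \<noteq> 0" using b0S by (auto simp: S_def)
        then show "x \<in> {x. poly (ratfun_num l - smult d (ratfun_den l)) x = 0}"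
          using bspec[OF d x] by (simp add: ratfun_eval_def field_simps)
      qed
      moreover have "ratfun_num l - smult d (ratfun_den l) \<noteq> 0" using ratfun_nonconstant[OF nc, of d] by auto
      ultimately show False
        using poly_roots_finite finite_subset finite_imp_not_open[of ?b0] r0(1) by (metis ball_eq_empty not_less open_ball)
    qed
    have oL: "open (?l ` ?b0)"
      by (rule open_mapping_thm[OF lb0 open_ball connected_ball open_ball subset_refl ncb])
    have LW: "?l ` ?b0 \<subseteq> W" using lV r0 V2(1) by auto
    have Lne: "?l ` ?b0 \<noteq> {}" using r0(1) by auto
    have "\<forall>\<^sub>\<approx>x\<in>W. \<forall>k\<in>{..<?p}. ys ! k analytic_on {x} \<and>
        hypergeom_residual a b (ys ! k) x = 0"
      using ysW unfolding hypergeom_solutions_def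
      by (intro eventually_ball_finite ballI eventually_conj meromorphic_on_imp_analytic_cosparse) auto
    from cosparse_open_subset[OF this oL Lne LW] obtain W2 where W2: "W2 \<subseteq> ?l ` ?b0" "open W2" "W2 \<noteq> {}"
      and yW2: "\<forall>x\<in>W2. \<forall>k\<in>{..<?p}. ys ! k analytic_on {x} \<and>
        hypergeom_residual a b (ys ! k) x = 0"
      by blast
    have y_an: "ys ! k analytic_on {x}"
      and y_eq: "hypergeom_residual a b (ys ! k) x = 0"
      if "x \<in> W2" "k < ?p" for x k
      using yW2 that by blast+
    have W201: "0 \<notin> W2" "1 \<notin> W2" using W2(1) l01 b0S by force+
    have y_hol: "ys ! k holomorphic_on W2" if "k < ?p" for k
      using y_an[OF _ that] by (intro analytic_imp_holomorphic) (auto simp: analytic_on_def)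
    have ylin: "lin_sol ?p H W2 (\<lambda>i. (delta ^^ i) (ys ! k))" if "k < ?p" for k
      using lin_sol_hypergeom[OF refl p W2(2) y_hol[OF that] W201 y_eq[OF _ that]]
      unfolding H_def[abs_def] \<gamma>_def[abs_def] by simp
    have "continuous_on ?b0 ?l" using lb0 by (rule holomorphic_on_imp_continuous_on)
    then have oV3: "open (?b0 \<inter> ?l -` W2)" using W2(2) by (intro continuous_open_preimage) auto
    have "?b0 \<inter> ?l -` W2 \<noteq> {}" using W2(1,3) by blast
    then obtain v where v: "v \<in> ?b0 \<inter> ?l -` W2" by blast
    then obtain \<rho> where \<rho>: "\<rho> > 0" "ball v \<rho> \<subseteq> ?b0 \<inter> ?l -` W2" using oV3 open_contains_ball by metis
    let ?b = "ball v \<rho>"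
    have b: "open ?b" "connected ?b" "?b \<noteq> {}" "v \<in> ?b" using \<rho>(1) by auto
    have bV2: "?b \<subseteq> V2" using \<rho>(2) r0(2) by blast
    have bD: "?b \<subseteq> ?D" using bV2 V2(1) by blast
    have bSD: "?b \<subseteq> slit_plane S c" using bD slit_plane_antimono[OF \<open>S \<subseteq> T1\<close>] by blast
    have f_hol: "f k holomorphic_on ?b" if "k < ?p" for k
      using f_an[OF _ that] bV2 by (intro analytic_imp_holomorphic) (auto simp: analytic_on_def)
    have flin: "lin_sol ?p C ?b (\<lambda>i. (deriv ^^ i) (f k))" if "k < ?p" for k
    proof -
      have "lin_sol (length cs) (companion (length cs) (\<lambda>j x. - ratfun_eval (cs ! j) x)) ?b (\<lambda>i. (deriv ^^ i) (f k))"
        by (rule ode_solution_lin_sol[OF b(1) f_hol[OF that]], rule f_ode[OF _ that]) (use bV2 in blast)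
      then show ?thesis by (simp add: C_def len)
    qed
    have "\<exists>e. \<forall>z\<in>?b. G 0 z = (\<Sum>k<?p. e k * (deriv ^^ 0) (f k) z)"
    proof (rule solutions_span[OF b(1-3) _ p0 flin lin_sol_subset[OF G(1) bD]])
      show "C i j holomorphic_on ?b" if "i < ?p" "j < ?p" for i j
        using holCD[OF that] bD by (rule holomorphic_on_subset)
      fix d assume d: "\<forall>z\<in>?b. (\<Sum>k<?p. d k * (deriv ^^ 0) (f k) z) = 0"
      have mero: "(\<lambda>z. \<Sum>k<?p. d k * f k z) meromorphic_on V"
      proof (intro meromorphic_intros)
        fix k assume "k \<in> {..<?p}"
        then show "f k meromorphic_on V" using ysV[of k] by (simp add: f_def ode_solutions_def)
      qed
      \<comment> \<open>A meromorphic function on the connected set \<open>V\<close> that vanishes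
        on a ball vanishes almost everywhere; this carries the independence of the basis from
        \<open>V\<close> to the ball.\<close>
      have "\<not> (\<forall>\<^sub>\<approx>z\<in>V. (\<Sum>k<?p. d k * f k z) \<noteq> 0)"
      proof
        assume "\<forall>\<^sub>\<approx>z\<in>V. (\<Sum>k<?p. d k * f k z) \<noteq> 0"
        from cosparse_open_subset[OF this b(1,3)] bV2 V2(1) obtain W' where "W' \<subseteq> ?b" "W' \<noteq> {}"
          "\<forall>z\<in>W'. (\<Sum>k<?p. d k * f k z) \<noteq> 0" by blast
        then show False using d by auto
      qed
      then have zero: "\<forall>\<^sub>\<approx>z\<in>V. (\<Sum>k<?p. d k * f k z) = 0"
        using meromorphic_imp_constant_or_avoid[OF mero V(1,2)] by blast
      have "(\<Sum>k<?p. d k * f k z) = (\<Sum>k<length (map (\<lambda>y. y \<circ> ?l) ys). d k * (map (\<lambda>y. y \<circ> ?l) ys ! k) z)" for z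
        using lys by (auto simp: f_def intro!: sum.cong)
      with zero have "\<forall>\<^sub>\<approx>z\<in>V. (\<Sum>k<length (map (\<lambda>y. y \<circ> ?l) ys). d k * (map (\<lambda>y. y \<circ> ?l) ys ! k) z) = 0"
        by (simp only:)
      from indV[rule_format, OF this] have "\<forall>k<length (map (\<lambda>y. y \<circ> ?l) ys). d k = 0" by blast
      then show "\<forall>k<?p. d k = 0" using lys by simp
    qed
    then obtain e where e: "\<And>z. z \<in> ?b \<Longrightarrow> G 0 z = (\<Sum>k<?p. e k * f k z)" by auto
    have lb: "?l holomorphic_on ?b" "?l ` ?b \<subseteq> W2"
      using lb0 \<rho>(2) by (auto intro: holomorphic_on_subset)
    \<comment> \<open>The first component is \<open>G 0\<close> near \<open>v\<close>, but the
      vector is now built from the \<open>\<delta>\<close>-derivatives of hypergeometric solutions.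
      Its system \<open>B\<close> has poles only in \<open>S\<close>, so it continues across the
      slits at \<open>T1 - S\<close>.\<close>
    define X where "X i z = (\<Sum>k<?p. e k * ((delta ^^ i) (ys ! k) \<circ> ?l) z)" for i z
    have X: "lin_sol ?p B ?b X"
      unfolding X_def[abs_def] B_def[abs_def]
      by (intro lin_sol_lincomb lin_sol_compose[OF ylin b(1) lb]) auto
    have "\<exists>Z. lin_sol ?p B (slit_plane S c) Z \<and> (\<forall>i<?p. Z i v = X i v)"
      by (rule lin_sol_exists_slit_plane[OF genS holB]) (use bSD b(4) in auto)
    then obtain Z where Z: "lin_sol ?p B (slit_plane S c) Z" "\<forall>i<?p. Z i v = X i v" by blast
    have "Z 0 z = X 0 z" if "z \<in> ?b" for z
    proof (rule lin_sol_unique[OF lin_sol_subset[OF Z(1) bSD] X b(1,2,4) _ _ p0 that])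
      show "B i j holomorphic_on ?b" if "i < ?p" "j < ?p" for i j
        using holB[OF that] by (rule holomorphic_on_subset) (use bSD slit_plane_subset_compl[of c S] genS in \<open>auto simp: generic_centre_def\<close>)
    qed (use Z in auto)
    then have "Z 0 z = G 0 z" if "z \<in> ?b" for z using e[OF that] that by (simp add: X_def f_def)
    moreover have "Z 0 holomorphic_on ?D"
      by (rule holomorphic_on_subset[OF lin_sol_holomorphic[OF Z(1) p0 open_slit_plane[OF genS]] slit_plane_antimono[OF \<open>S \<subseteq> T1\<close>]])
    ultimately have "Z 0 z = G 0 z" if "z \<in> ?D" for z
      using analytic_continuation_open[OF b(1) oD b(3) connected_slit_plane bD, of "Z 0" "G 0" z]
        lin_sol_holomorphic[OF G(1) p0 oD] that by blast
    then have "\<forall>z\<in>ball c r. Z 0 z = y z" using Gy r(2) by auto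
    then show "\<exists>Z r. r > 0 \<and> lin_sol ?p B (slit_plane S c) Z \<and> (\<forall>z\<in>ball c r. Z 0 z = y z)"
      using Z(1) r(1) by blast
  qed
qed

lemma tame_hypergeom_solution:
  assumes ts: "distinct ts" "length ts \<ge> 3 * M" "M \<ge> 1"
    and p: "length a \<ge> 1" "length b = length a - 1" and deg: "degree (ratfun_num l) < M" "degree (ratfun_den l) < M"
    and eq: "is_hypergeom_eq a b l cs" and y: "y \<in> ode_solutions cs U" and W: "open W" "W \<noteq> {}" "W \<subseteq> U"
  shows "\<exists>U'\<subseteq>W. open U' \<and> U' \<noteq> {} \<and> tame ts U' y"
proof -
  have tsne: "ts \<noteq> []" using ts by auto
  have "\<forall>\<^sub>\<approx>x\<in>U. y analytic_on {x} \<and>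
      ode_residual cs y x = 0"
    using y unfolding ode_solutions_def by (intro eventually_conj meromorphic_on_imp_analytic_cosparse) auto
  from cosparse_open_subset[OF this W] obtain U1 where U1: "U1 \<subseteq> W" "open U1" "U1 \<noteq> {}"
    and y_an: "\<And>x. x \<in> U1 \<Longrightarrow> y analytic_on {x}"
    and ode: "\<forall>x\<in>U1. ode_residual cs y x = 0"
    by blast
  have yhol: "y holomorphic_on U1"
    using y_an by (intro analytic_imp_holomorphic) (auto simp: analytic_on_def)
  have "tame ts U1 y"
  proof (cases "\<exists>c. l = to_fract [:c:]")
    case True
    then have cs: "cs = [0]" using eq by (simp add: is_hypergeom_eq_def)
    have "ratfun_eval 0 x = 0" for x by (simp add: ratfun_eval_def ratfun_num_def)
    then have d0: "deriv y x = 0" if "x \<in> U1" for x using ode that cs by simp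
    show ?thesis
    proof (rule tame_locally_const[OF tsne])
      fix c assume "c \<in> U1"
      then obtain r where r: "r > 0" "ball c r \<subseteq> U1" using U1(2) open_contains_ball by metis
      have "(y has_field_derivative 0) (at z)" if "z \<in> ball c r" for z
        using holomorphic_derivI[OF yhol U1(2), of z] d0[of z] that r(2) by auto
      then have "y constant_on ball c r" by (rule has_field_derivative_0_imp_constant_on) auto
      then show "\<exists>r>0. \<forall>z\<in>ball c r. y z = y c"
        using r(1) unfolding constant_on_def by (metis centre_in_ball)
    qed
  next
    case False
    then have nc: "\<nexists>c. l = to_fract [:c:]" and pull: "is_pullback a b l cs"
      using eq by (auto simp: is_hypergeom_eq_def)
    define S where "S = {x. poly (ratfun_num l) x = 0 \<or> poly (ratfun_den l) x = 0 \<or> poly (ratfun_num l - ratfun_den l) x = 0}"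
    define T1 where "T1 = S \<union> (\<Union>i<length cs. {x. poly (ratfun_den (cs ! i)) x = 0})"
    obtain B where B: "\<And>i j. i < length a \<Longrightarrow> j < length a \<Longrightarrow> B i j holomorphic_on - S"
      and ext: "\<And>U y c. open U \<Longrightarrow> y holomorphic_on U \<Longrightarrow> c \<in> U \<Longrightarrow> generic_centre T1 c \<Longrightarrow>
      (\<forall>x\<in>U. ode_residual cs y x = 0) \<Longrightarrow>
      (\<exists>Z r. r > 0 \<and> lin_sol (length a) B (slit_plane S c) Z \<and> (\<forall>z\<in>ball c r. Z 0 z = y z))"
      using pullback_extends[OF p pull nc, folded S_def, folded T1_def] by blast
    have nd: "ratfun_num l \<noteq> 0" "ratfun_den l \<noteq> 0" "ratfun_num l - ratfun_den l \<noteq> 0"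
      using ratfun_nonconstant[OF nc, of 0] ratfun_nonconstant[OF nc, of 1] by (auto simp: ratfun_den_nonzero)
    have Seq: "S = {x. poly (ratfun_num l) x = 0} \<union> {x. poly (ratfun_den l) x = 0} \<union> {x. poly (ratfun_num l - ratfun_den l) x = 0}"
      by (auto simp: S_def)
    have finS: "finite S" unfolding Seq using nd by (simp add: poly_roots_finite del: poly_diff)
    \<comment> \<open>The zeros of the numerator, of the denominator and of their difference are the
      fibres over 0, \<infinity> and 1. Each has at most \<open>M - 1\<close> points, so
      \<open>3 * M\<close> letters do not fit into \<open>S\<close>.\<close>
    have "card S \<le> card {x. poly (ratfun_num l) x = 0} + card {x. poly (ratfun_den l) x = 0}
        + card {x. poly (ratfun_num l - ratfun_den l) x = 0}"
      unfolding Seq by (intro card_Un_le[THEN order_trans] add_mono card_Un_le) auto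
    also have "\<dots> \<le> degree (ratfun_num l) + degree (ratfun_den l) + degree (ratfun_num l - ratfun_den l)"
      using nd by (intro add_mono card_poly_roots_bound) auto
    also have "degree (ratfun_num l - ratfun_den l) < M" using deg by (rule degree_diff_less)
    finally have "card S < length ts" using deg ts(2) by linarith
    then have "\<not> set ts \<subseteq> S" using card_mono[OF finS, of "set ts"] distinct_card[OF ts(1)] by auto
    moreover have "finite T1" unfolding T1_def using finS by (auto simp: poly_roots_finite ratfun_den_nonzero)
    ultimately show ?thesis
      by (intro tame_few_poles[OF tsne, of S T1 "length a" B]) (use p B ext[OF U1(2) yhol _ _ ode] in \<open>auto simp: T1_def\<close>)
  qed
  then show ?thesis using U1 by blast
qed

subsection \<open>Common multiples of the first integers\<close>

text \<open>Passing from \<open>n\<close> to \<open>Suc n\<close> raises exactly the quotients whose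
  \<open>p ^ j\<close> divides \<open>Suc n\<close>, and their number is the multiplicity of
  \<open>p\<close> in \<open>Suc n\<close>. Powers beyond \<open>L\<close> exceed \<open>n\<close>
  and would contribute 0.\<close>

lemma legendre_formula:
  assumes "prime p" "n < p ^ L"
  shows "multiplicity p (fact n :: nat) = (\<Sum>j=1..L. n div p ^ j)"
  using assms(2)
proof (induction n)
  case (Suc n)
  have p: "p > 1" using assms(1) by (rule prime_gt_1_nat)
  have mult_le: "multiplicity p (Suc n) \<le> L"
  proof (rule ccontr)
    assume "\<not> ?thesis"
    then have "p ^ L dvd Suc n" by (intro multiplicity_dvd') simp
    then show False using Suc.prems by (meson dvd_imp_le not_less zero_less_Suc)
  qed
  have dvd: "p ^ j dvd Suc n \<longleftrightarrow> j \<le> multiplicity p (Suc n)" for j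
    using p by (intro power_dvd_iff_le_multiplicity) auto
  have "(\<Sum>j=1..L. Suc n div p ^ j) = (\<Sum>j=1..L. n div p ^ j + (if p ^ j dvd Suc n then 1 else 0))"
    by (intro sum.cong) (auto simp: div_Suc mod_eq_0_iff_dvd)
  also have "\<dots> = (\<Sum>j=1..L. n div p ^ j) + card {j \<in> {1..L}. p ^ j dvd Suc n}"
    by (simp add: sum.distrib sum.If_cases Int_def)
  also have "{j \<in> {1..L}. p ^ j dvd Suc n} = {1..multiplicity p (Suc n)}"
    using mult_le unfolding dvd by auto
  also have "(\<Sum>j=1..L. n div p ^ j) = multiplicity p (fact n :: nat)"
    using Suc by simp
  finally have "(\<Sum>j=1..L. Suc n div p ^ j) = multiplicity p (fact n :: nat) + multiplicity p (Suc n)"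
    by simp
  also have "\<dots> = multiplicity p (fact (Suc n) :: nat)"
    using assms(1) by (simp add: prime_elem_multiplicity_mult_distrib del: mult_Suc)
  finally show ?case ..
qed simp

text \<open>With \<open>m = n div 2\<close>, this is the central binomial coefficient of
  \<open>2 * m\<close>, multiplied by \<open>n\<close> if \<open>n\<close> is odd.\<close>

definition swing :: "nat \<Rightarrow> nat" where
  "swing n = fact n div (fact (n div 2) * fact (n div 2))"

lemma swing: "swing n * (fact (n div 2) * fact (n div 2)) = fact n"
  and swing_le: "swing n \<le> 16 ^ (n div 2)"
proof -
  define m where "m = n div 2"
  have c: "fact m * fact m * ((2 * m) choose m) = (fact (2 * m) :: nat)"
    using binomial_fact_lemma[of m "2 * m"] by simp
  have ch: "(2 * m) choose m \<le> 4 ^ m"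
    using binomial_le_pow2[of "2 * m" m] by (simp add: power_mult)
  have "\<exists>k. fact n = fact m * fact m * (k * ((2 * m) choose m)) \<and> k \<le> 2 * m + 1"
  proof (cases "even n")
    case True
    then have "n = 2 * m" by (simp add: m_def)
    then show ?thesis using c by (intro exI[of _ 1]) simp
  next
    case False
    then have "n = 2 * m + 1" by (simp add: m_def)
    then show ?thesis using c by (intro exI[of _ "2 * m + 1"]) (simp add: algebra_simps)
  qed
  then obtain k where k: "fact n = fact m * fact m * (k * ((2 * m) choose m))" "k \<le> 2 * m + 1" by blast
  then have s: "swing n = k * ((2 * m) choose m)" unfolding swing_def m_def[symmetric] k(1) by simp
  show "swing n * (fact (n div 2) * fact (n div 2)) = fact n"
    unfolding m_def[symmetric] s k(1) by simp
  \<comment> \<open>The factor of the odd case is absorbed by a second \<open>4 ^ m\<close>, whence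
    the base 16.\<close>
  have "2 * m + 1 \<le> 4 ^ m" by (induction m) auto
  then have "k * ((2 * m) choose m) \<le> 4 ^ m * 4 ^ m" using k(2) ch by (intro mult_mono) auto
  then show "swing n \<le> 16 ^ (n div 2)"
    unfolding s m_def[symmetric] by (simp add: power_mult_distrib[symmetric])
qed

text \<open>Chebyshev's recursion: the swinging factorial of \<open>n\<close> contains every prime with a power in \<open>(n/2, n]\<close>.\<close>

fun common_mult :: "nat \<Rightarrow> nat" where
  "common_mult n = (if n = 0 then 1 else common_mult (n div 2) * swing n)"

declare common_mult.simps [simp del]

lemma swing_pos: "swing n > 0"
  using swing[of n] by (metis fact_nonzero gr0I mult_zero_left)

lemma common_mult_pos: "common_mult n > 0"
  by (induction n rule: less_induct) (subst common_mult.simps, auto simp: swing_pos)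

lemma common_mult_le: "common_mult n \<le> 16 ^ (n + 1)"
proof (induction n rule: less_induct)
  case (less n)
  show ?case
  proof (cases "n = 0")
    case False
    have "common_mult n = common_mult (n div 2) * swing n" using False by (simp add: common_mult.simps)
    also have "\<dots> \<le> 16 ^ (n div 2 + 1) * 16 ^ (n div 2)"
      using less[of "n div 2"] False swing_le[of n] by (intro mult_mono) auto
    also have "\<dots> = 16 ^ (2 * (n div 2) + 1)" by (simp flip: power_add add: mult_2)
    also have "\<dots> \<le> 16 ^ (n + 1)" by (intro power_increasing) auto
    finally show ?thesis .
  qed (simp add: common_mult.simps)
qed

text \<open>If \<open>p ^ J \<le> n div 2\<close>, the recursion already supplies \<open>J\<close>.
  Otherwise \<open>p ^ (J - 1) \<le> n div 2\<close>, since \<open>p \<ge> 2\<close>, and the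
  recursion supplies \<open>J - 1\<close>; the missing factor \<open>p\<close> divides
  \<open>swing n\<close>, because the term \<open>j = J\<close> of Legendre's formula is positive
  for \<open>n\<close> and zero for \<open>n div 2\<close>.\<close>

lemma multiplicity_common_mult:
  assumes p: "prime p" and "p ^ J \<le> n" shows "J \<le> multiplicity p (common_mult n)"
  using assms(2)
proof (induction n arbitrary: J rule: less_induct)
  case (less n)
  have p1: "p > 1" using p by (rule prime_gt_1_nat)
  define m where "m = n div 2"
  show ?case
  proof (cases J)
    case (Suc i)
    have "p ^ J \<ge> 1" using p1 by simp
    then have n: "n > 0" using less.prems by linarith
    then have mn: "m < n" by (simp add: m_def)
    have eq: "multiplicity p (common_mult n) = multiplicity p (common_mult m) + multiplicity p (swing n)"
      using n p by (subst common_mult.simps)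
        (simp add: m_def prime_elem_multiplicity_mult_distrib common_mult_pos swing_pos)
    show ?thesis
    proof (cases "p ^ J \<le> m")
      case True
      then show ?thesis using less.IH[OF mn True] eq by simp
    next
      case False
      have "2 * p ^ i \<le> p * p ^ i" using p1 by (intro mult_right_mono) auto
      moreover have "p ^ J = p * p ^ i" using Suc by simp
      ultimately have "p ^ i * 2 \<le> n" using less.prems by linarith
      then have "p ^ i \<le> m" by (simp add: m_def less_eq_div_iff_mult_less_eq)
      then have 1: "i \<le> multiplicity p (common_mult m)" using less.IH[OF mn] by simp
      obtain L where L: "n < p ^ L" using p1 by (metis less_exp order_less_le_trans power_mono linorder_not_le nat_less_le One_nat_def Suc_leI numeral_2_eq_2 zero_le)
      have JL: "J \<le> L"
      proof (rule ccontr)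
        assume "\<not> J \<le> L"
        then have "p ^ L \<le> p ^ J" using p1 by (intro power_increasing) auto
        then show False using L less.prems by linarith
      qed
      have "multiplicity p (fact n :: nat) = multiplicity p (swing n) + 2 * multiplicity p (fact m :: nat)"
        using p swing_pos[of n] by (subst swing[of n, symmetric])
          (simp add: m_def prime_elem_multiplicity_mult_distrib)
      moreover have "(\<Sum>j=1..L. n div p ^ j) > (\<Sum>j=1..L. 2 * (m div p ^ j))"
      proof (rule sum_strict_mono_ex1)
        show "\<forall>j\<in>{1..L}. 2 * (m div p ^ j) \<le> n div p ^ j"
        proof
          fix j assume "j \<in> {1..L}"
          have "m div p ^ j * p ^ j \<le> m" by (rule div_times_less_eq_dividend)
          moreover have "2 * m \<le> n" by (simp add: m_def)
          ultimately have "2 * (m div p ^ j) * p ^ j \<le> n" unfolding mult.assoc by linarith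
          then show "2 * (m div p ^ j) \<le> n div p ^ j"
            using p1 by (simp add: less_eq_div_iff_mult_less_eq)
        qed
        have "m div p ^ J = 0" using False by simp
        moreover have "n div p ^ J > 0" using less.prems p1 by (simp add: div_greater_zero_iff)
        ultimately show "\<exists>j\<in>{1..L}. 2 * (m div p ^ j) < n div p ^ j"
          using JL Suc by (intro bexI[of _ J]) auto
      qed simp
      moreover have "multiplicity p (fact n :: nat) = (\<Sum>j=1..L. n div p ^ j)"
        by (rule legendre_formula[OF p L])
      moreover have "multiplicity p (fact m :: nat) = (\<Sum>j=1..L. m div p ^ j)"
        by (rule legendre_formula[OF p]) (use L mn in linarith)
      ultimately have "multiplicity p (swing n) > 0" by (simp add: sum_distrib_left)
      then show ?thesis using 1 eq Suc by simp
    qed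
  qed simp
qed

lemma dvd_common_mult:
  assumes "1 \<le> k" "k \<le> n" shows "k dvd common_mult n"
proof (rule multiplicity_le_imp_dvd)
  fix p :: nat assume "prime p"
  have "p ^ multiplicity p k \<le> k"
    using assms by (intro dvd_imp_le multiplicity_dvd) auto
  then show "multiplicity p k \<le> multiplicity p (common_mult n)"
    using assms by (intro multiplicity_common_mult \<open>prime p\<close>) linarith
qed (use assms in auto)

subsection \<open>Hyperlogarithms are G-functions\<close>

definition geom_fps :: "nat \<Rightarrow> complex fps" where
  "geom_fps k = Abs_fps (\<lambda>n. of_nat k ^ n)"

fun hyperlog_fps :: "nat list \<Rightarrow> complex fps" where
  "hyperlog_fps [] = 1"
| "hyperlog_fps (k # ks) = fps_integral0 (hyperlog_fps ks * geom_fps k)"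

fun hyperlog_fps_op :: "nat list \<Rightarrow> complex fps \<Rightarrow> complex fps" where
  "hyperlog_fps_op [] F = F"
| "hyperlog_fps_op (k # ks) F = hyperlog_fps_op ks (fps_of_poly [:1, - of_nat k:] * fps_deriv F)"

lemma geom_fps: "fps_of_poly [:1, - of_nat k:] * geom_fps k = 1"
proof (rule fps_ext)
  fix n
  have eq: "fps_of_poly [:1, - of_nat k :: complex:] = 1 - fps_X * fps_const (of_nat k)"
    by (simp add: fps_of_poly_pCons mult.commute)
  have "fps_of_poly [:1, - of_nat k:] * geom_fps k = geom_fps k - fps_X * (fps_const (of_nat k) * geom_fps k)"
    unfolding eq by (simp add: left_diff_distrib mult.assoc)
  then have "(fps_of_poly [:1, - of_nat k:] * geom_fps k) $ n = geom_fps k $ n - (fps_X * (fps_const (of_nat k) * geom_fps k)) $ n"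
    by simp
  also have "\<dots> = (1 :: complex fps) $ n"
    by (cases n) (simp_all add: geom_fps_def)
  finally show "(fps_of_poly [:1, - of_nat k:] * geom_fps k) $ n = 1 $ n" .
qed

lemma hyperlog_fps_deriv:
  "fps_of_poly [:1, - of_nat k:] * fps_deriv (hyperlog_fps (k # ks)) = hyperlog_fps ks"
  using geom_fps[of k] by (simp add: fps_deriv_fps_integral mult.left_commute)

lemma hyperlog_fps_op_hyperlog: "hyperlog_fps_op ks (hyperlog_fps ks) = 1"
proof (induction ks)
  case (Cons k ks)
  then show ?case using hyperlog_fps_deriv[of k ks] by simp
qed simp

lemma hyperlog_fps_op_append:
  "hyperlog_fps_op (ks @ ls) F = hyperlog_fps_op ls (hyperlog_fps_op ks F)"
  by (induction ks arbitrary: F) auto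

text \<open>Rational coefficients are algebraic and fixed by every element of
  \<open>gal_Qbar\<close>, so the bound on conjugates reduces to a bound on the coefficients
  themselves.\<close>

lemma hyperlog_fps_Rats: "hyperlog_fps ks $ n \<in> \<rat>"
proof (induction ks arbitrary: n)
  case Nil
  show ?case by (cases n) auto
next
  case (Cons k ks)
  then show ?case
    by (cases n) (auto simp: fps_mult_nth geom_fps_def simp del: of_nat_Suc intro!: Rats_mult Rats_inverse Rats_sum)
qed

text \<open>Convolution with the geometric series gives \<open>m + 1\<close> terms of size at most
  \<open>N ^ m\<close>, and the integration divides by \<open>m + 1\<close>; so further letters do
  not worsen the growth.\<close>

lemma hyperlog_fps_bound:
  assumes "\<forall>k\<in>set ks. k \<le> N" "N \<ge> 1" shows "norm (hyperlog_fps ks $ n) \<le> real N ^ n"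
  using assms(1)
proof (induction ks arbitrary: n)
  case Nil
  show ?case by (cases n) auto
next
  case (Cons k ks)
  show ?case
  proof (cases n)
    case (Suc m)
    have "norm ((hyperlog_fps ks * geom_fps k) $ m) \<le> (\<Sum>i=0..m. real N ^ i * real N ^ (m - i))"
      unfolding fps_mult_nth
    proof (rule sum_norm_le)
      fix i
      show "norm (hyperlog_fps ks $ i * geom_fps k $ (m - i)) \<le> real N ^ i * real N ^ (m - i)"
        using Cons by (auto simp: norm_mult geom_fps_def norm_power intro!: mult_mono power_mono)
    qed
    also have "\<dots> = (\<Sum>i=0..m. real N ^ m)" by (intro sum.cong) (auto simp flip: power_add)
    also have "\<dots> = real (Suc m) * real N ^ m" by simp
    finally have "norm ((hyperlog_fps ks * geom_fps k) $ m) / real (Suc m) \<le> real N ^ m"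
      by (simp add: field_simps)
    also have "\<dots> \<le> real N ^ n" using Suc assms(2) by (intro power_increasing) auto
    finally show ?thesis using Suc by (simp add: norm_mult norm_inverse divide_inverse mult.commute del: of_nat_Suc)
  qed simp
qed

text \<open>Each integration divides by a number up to \<open>n\<close>, so one factor
  \<open>e\<close> per letter clears all denominators.\<close>

lemma hyperlog_fps_denominator:
  assumes "\<And>k. 1 \<le> k \<Longrightarrow> k \<le> n \<Longrightarrow> k dvd (e :: nat)" "m \<le> n"
  shows "of_nat (e ^ length ks) * hyperlog_fps ks $ m \<in> \<int>"
  using assms(2)
proof (induction ks arbitrary: m)
  case Nil
  show ?case by (cases m) auto
next
  case (Cons k ks)
  show ?case
  proof (cases m)
    case (Suc l)
    obtain q where q: "e = Suc l * q" using assms(1)[of "Suc l"] Cons.prems Suc by (auto elim: dvdE)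
    have "of_nat (e ^ length ks) * (hyperlog_fps ks * geom_fps k) $ l =
       (\<Sum>i=0..l. of_nat (e ^ length ks) * hyperlog_fps ks $ i * geom_fps k $ (l - i))"
      by (simp add: fps_mult_nth sum_distrib_left mult.assoc)
    also have "\<dots> \<in> \<int>"
      by (intro Ints_sum Ints_mult[OF Cons.IH]) (use Cons.prems Suc in \<open>auto simp: geom_fps_def\<close>)
    finally have "of_nat q * (of_nat (e ^ length ks) * (hyperlog_fps ks * geom_fps k) $ l) \<in> \<int>"
      by (rule Ints_mult[OF Ints_of_nat])
    moreover have "of_nat (e ^ length (k # ks)) * hyperlog_fps (k # ks) $ m =
        (of_nat e * inverse (of_nat (Suc l))) * (of_nat (e ^ length ks) * (hyperlog_fps ks * geom_fps k) $ l)"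
      using Suc by (simp del: of_nat_Suc)
    moreover have "of_nat e * inverse (of_nat (Suc l)) = (of_nat q :: complex)"
      unfolding q of_nat_mult using of_nat_neq_0[of l, where 'a = complex] by (simp del: of_nat_Suc)
    ultimately show ?thesis by (simp only:)
  qed simp
qed

text \<open>The operator is expanded by the product rule, one letter at a time; the leading
  coefficient is a product of polynomials \<open>1 - k x\<close>, hence nonzero.\<close>

lemma hyperlog_fps_op_expand:
  "\<exists>p. (\<forall>i j. coeff (p i) j \<in> \<rat>) \<and> p (length ks) \<noteq> 0 \<and>
     (\<forall>F. hyperlog_fps_op ks F = (\<Sum>i\<le>length ks. fps_of_poly (p i) * (fps_deriv ^^ i) F))"
proof (induction ks rule: rev_induct)
  case Nil
  show ?case by (intro exI[of _ "\<lambda>_. 1"]) (auto simp: coeff_1)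
next
  case (snoc k ks)
  let ?n = "length ks"
  obtain p where p: "\<And>i j. coeff (p i) j \<in> \<rat>" "p ?n \<noteq> 0"
    "\<And>F. hyperlog_fps_op ks F = (\<Sum>i\<le>?n. fps_of_poly (p i) * (fps_deriv ^^ i) F)"
    using snoc by blast
  define l :: "complex poly" where "l = [:1, - of_nat k:]"
  define q where "q i = l * ((if i \<le> ?n then pderiv (p i) else 0) + (if i = 0 then 0 else p (i - 1)))" for i
  have ratmul: "coeff (l * r) j \<in> \<rat>" if "\<And>j. coeff r j \<in> \<rat>" for r j
    unfolding l_def using that by (cases j) (auto simp: coeff_pCons)
  have "coeff (q i) j \<in> \<rat>" for i j
    unfolding q_def using p(1) by (intro ratmul) (auto simp: coeff_pderiv simp del: of_nat_Suc)
  moreover have "l \<noteq> 0" by (simp add: l_def)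
  then have "q (Suc ?n) \<noteq> 0" using p(2) by (simp add: q_def)
  moreover have "hyperlog_fps_op (ks @ [k]) F = (\<Sum>i\<le>Suc ?n. fps_of_poly (q i) * (fps_deriv ^^ i) F)" for F
  proof -
    have "hyperlog_fps_op (ks @ [k]) F = fps_of_poly l * fps_deriv (\<Sum>i\<le>?n. fps_of_poly (p i) * (fps_deriv ^^ i) F)"
      by (simp add: hyperlog_fps_op_append p(3) l_def)
    also have "fps_deriv (\<Sum>i\<le>?n. fps_of_poly (p i) * (fps_deriv ^^ i) F) =
        (\<Sum>i\<le>?n. fps_of_poly (pderiv (p i)) * (fps_deriv ^^ i) F) + (\<Sum>i\<le>?n. fps_of_poly (p i) * (fps_deriv ^^ Suc i) F)"
      by (simp add: fps_deriv_sum fps_of_poly_pderiv sum.distrib add.commute)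
    also have "(\<Sum>i\<le>?n. fps_of_poly (pderiv (p i)) * (fps_deriv ^^ i) F) =
        (\<Sum>i\<le>Suc ?n. fps_of_poly (if i \<le> ?n then pderiv (p i) else 0) * (fps_deriv ^^ i) F)"
      by simp
    also have "(\<Sum>i\<le>?n. fps_of_poly (p i) * (fps_deriv ^^ Suc i) F) =
        (\<Sum>i\<le>Suc ?n. fps_of_poly (if i = 0 then 0 else p (i - 1)) * (fps_deriv ^^ i) F)"
      by (simp add: sum.atMost_Suc_shift del: sum.atMost_Suc)
    finally show ?thesis
      by (simp only: q_def fps_of_poly_mult fps_of_poly_add sum_distrib_left sum.distrib[symmetric]
          distrib_left distrib_right mult.assoc)
  qed
  ultimately show ?case by (intro exI[of _ q]) auto
qed

theorem G_function_hyperlog: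
  assumes "\<forall>k\<in>set ks. k \<le> N" "N \<ge> 1" shows "G_function (hyperlog_fps ks)"
  unfolding G_function_def
proof (intro conjI allI)
  let ?F = "hyperlog_fps ks"
  show "?F $ n \<in> Qbar" for n
    using hyperlog_fps_Rats[of ks n] by (auto simp: Qbar_def intro: rat_imp_algebraic)
  show "\<exists>r A. (\<forall>i\<le>r. A i \<in> Qbar_ratfun) \<and> (\<exists>i\<le>r. A i \<noteq> 0) \<and>
        (\<Sum>i\<le>r. A i * fps_to_fls ((fps_deriv ^^ i) ?F)) = 0"
  proof -
    \<comment> \<open>The extra letter 0 stands for plain differentiation, which annihilates the
      constant 1 that the letters \<open>ks\<close> leave behind.\<close>
    obtain p where p: "\<And>i j. coeff (p i) j \<in> \<rat>" "p (length (ks @ [0])) \<noteq> 0"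
      "\<And>F. hyperlog_fps_op (ks @ [0]) F = (\<Sum>i\<le>length (ks @ [0]). fps_of_poly (p i) * (fps_deriv ^^ i) F)"
      using hyperlog_fps_op_expand[of "ks @ [0]"] by blast
    let ?r = "length (ks @ [0])"
    have "hyperlog_fps_op (ks @ [0]) ?F = 0"
      by (simp add: hyperlog_fps_op_append hyperlog_fps_op_hyperlog)
    then have "fps_to_fls (\<Sum>i\<le>?r. fps_of_poly (p i) * (fps_deriv ^^ i) ?F) = 0" unfolding p(3) by simp
    moreover have "fps_to_fls (\<Sum>i\<le>n. f i) = (\<Sum>i\<le>n. fps_to_fls (f i))" for n and f :: "nat \<Rightarrow> complex fps"
      by (induction n) simp_all
    ultimately have "(\<Sum>i\<le>?r. fps_to_fls (fps_of_poly (p i)) * fps_to_fls ((fps_deriv ^^ i) ?F)) = 0"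
      by (simp only: fls_times_fps_to_fls)
    moreover have "fps_to_fls (fps_of_poly (p i)) \<in> Qbar_ratfun" for i
    proof -
      have "coeff (p i) j \<in> Qbar" for j using p(1) by (auto simp: Qbar_def intro: rat_imp_algebraic)
      moreover have "coeff (1 :: complex poly) j \<in> Qbar" for j by (auto simp: Qbar_def coeff_1)
      ultimately show ?thesis unfolding Qbar_ratfun_def mem_Collect_eq
        by (intro exI[of _ "p i"] exI[of _ 1]) auto
    qed
    moreover have "fps_to_fls (fps_of_poly (p ?r)) \<noteq> 0" using p(2) by simp
    ultimately show ?thesis
      by (intro exI[of _ ?r] exI[of _ "\<lambda>i. fps_to_fls (fps_of_poly (p i))"]) blast
  qed
  show "\<exists>C>0. \<forall>\<sigma>\<in>gal_Qbar. \<forall>n. norm (\<sigma> (?F $ n)) \<le> C ^ (n + 1)"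
  proof (intro exI[of _ "real N"] conjI ballI allI)
    fix \<sigma> n assume "\<sigma> \<in> gal_Qbar"
    then have "\<sigma> (?F $ n) = ?F $ n" using hyperlog_fps_Rats[of ks n] by (auto simp: gal_Qbar_def)
    then have "norm (\<sigma> (?F $ n)) \<le> real N ^ n" using hyperlog_fps_bound[OF assms] by simp
    also have "\<dots> \<le> real N ^ (n + 1)" using assms(2) by (intro power_increasing) auto
    finally show "norm (\<sigma> (?F $ n)) \<le> real N ^ (n + 1)" .
  qed (use assms(2) in auto)
  show "\<exists>D>0. \<exists>d::nat \<Rightarrow> int. \<forall>n. 1 \<le> d n \<and> real_of_int (d n) \<le> D ^ (n + 1) \<and>
        (\<forall>m\<le>n. algebraic_int (of_int (d n) * ?F $ m))"
  \<comment> \<open>\<open>common_mult n\<close> clears one integration up to order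
    \<open>n\<close>, so \<open>d n\<close> needs one factor per letter; \<open>D\<close> is the
    corresponding power of the base 16 in the bound for \<open>common_mult\<close>.\<close>
  proof (intro exI[of _ "16 ^ length ks"] conjI exI[of _ "\<lambda>n. int (common_mult n ^ length ks)"] allI impI)
    fix n
    show "1 \<le> int (common_mult n ^ length ks)" using common_mult_pos[of n] by simp
    have "real (common_mult n) \<le> 16 ^ (n + 1)"
      using common_mult_le[of n] by (metis of_nat_le_iff of_nat_numeral of_nat_power)
    then have "real (common_mult n) ^ length ks \<le> (16 ^ (n + 1)) ^ length ks" by (intro power_mono) auto
    also have "\<dots> = (16 ^ length ks) ^ (n + 1)" by (simp only: power_mult[symmetric] mult.commute)
    finally show "real_of_int (int (common_mult n ^ length ks)) \<le> (16 ^ length ks) ^ (n + 1)" by simp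
    fix m assume "m \<le> n"
    have "of_nat (common_mult n ^ length ks) * ?F $ m \<in> \<int>"
      by (rule hyperlog_fps_denominator[OF dvd_common_mult \<open>m \<le> n\<close>])
    then show "algebraic_int (of_int (int (common_mult n ^ length ks)) * ?F $ m)"
      by (auto intro: int_imp_algebraic_int)
  qed auto
qed

section \<open>From the formal series to the analytic function\<close>

lemma hyperlog_fps_conv_radius:
  assumes "\<forall>k\<in>set ks. k \<le> N" "N \<ge> 1"
  shows "fps_conv_radius (hyperlog_fps ks) \<ge> ereal (1 / real N)"
  unfolding fps_conv_radius_def
proof (rule conv_radius_geI_ex')
  fix r :: real assume r: "0 < r" "ereal r < ereal (1 / real N)"
  have le: "norm (hyperlog_fps ks $ n * of_real r ^ n) \<le> (real N * r) ^ n" for n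
    using mult_right_mono[OF hyperlog_fps_bound[OF assms, of n], of "r ^ n"] r(1)
    by (simp add: norm_mult norm_power power_mult_distrib)
  have "summable (\<lambda>n. (real N * r) ^ n)"
    using r assms(2) by (intro summable_geometric) (simp add: field_simps)
  then show "summable (\<lambda>n. hyperlog_fps ks $ n * of_real r ^ n)"
    by (rule summable_comparison_test') (rule le)
qed

lemma eval_hyperlog_fps:
  assumes "\<forall>k\<in>set ks. k \<le> N" "N \<ge> 1" "z \<in> ball 0 (1 / real N)"
  shows "hyperlog_op (map of_nat ks) (eval_fps (hyperlog_fps ks)) z = 1"
  using assms(1)
proof (induction ks)
  case Nil
  show ?case by simp
next
  case (Cons k ks)
  have "(1 - of_nat k * w) * deriv (eval_fps (hyperlog_fps (k # ks))) w = eval_fps (hyperlog_fps ks) w"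
    if "w \<in> ball 0 (1 / real N)" for w
  proof -
    have w: "ereal (norm w) < ereal (1 / real N)" using that by simp
    have R: "ereal (norm w) < fps_conv_radius (hyperlog_fps (k # ks))"
      using less_le_trans[OF w hyperlog_fps_conv_radius[OF Cons.prems assms(2)]] .
    then have "ereal (norm w) < fps_conv_radius (fps_deriv (hyperlog_fps (k # ks)))"
      using less_le_trans fps_conv_radius_deriv by blast
    then have "eval_fps (fps_of_poly [:1, - of_nat k:] * fps_deriv (hyperlog_fps (k # ks))) w =
        poly [:1, - of_nat k:] w * eval_fps (fps_deriv (hyperlog_fps (k # ks))) w"
      by (subst eval_fps_mult) auto
    moreover have "deriv (eval_fps (hyperlog_fps (k # ks))) w = eval_fps (fps_deriv (hyperlog_fps (k # ks))) w"
      by (intro DERIV_imp_deriv has_field_derivative_eval_fps R)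
    ultimately show ?thesis unfolding hyperlog_fps_deriv by (simp add: mult.commute)
  qed
  from hyperlog_op_cong[OF open_ball this assms(3), where ks = "map of_nat ks"] Cons show ?case by simp
qed

subsection \<open>The field of hypergeometric functions\<close>

lemma hyperlog_op_extend:
  assumes "open U" "connected U" "f holomorphic_on U" "open W" "W \<noteq> {}" "W \<subseteq> U"
    "\<And>z. z \<in> W \<Longrightarrow> hyperlog_op ks f z = 1" "z \<in> U"
  shows "hyperlog_op ks f z = 1"
  using analytic_continuation_open[of W U "hyperlog_op ks f" "\<lambda>_. 1" z] assms
    hyperlog_op_holomorphic[OF assms(1,3)] by auto

text \<open>It is enough to follow the differential equation along the chain: the end may be any
  branch, and the monodromy computation applies to all of them.\<close>

lemma hyperlog_continuation:
  assumes "analytic_continuation (U0, f0) (U, f)" "open U0" "connected U0" "f0 holomorphic_on U0"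
    "\<forall>z\<in>U0. hyperlog_op ks f0 z = 1"
  shows "f holomorphic_on U \<and> (\<forall>z\<in>U. hyperlog_op ks f z = 1)"
proof -
  have "open (fst X) \<and> connected (fst X) \<and> snd X holomorphic_on fst X \<and>
      (\<forall>z\<in>fst X. hyperlog_op ks (snd X) z = 1)" if "analytic_continuation (U0, f0) X" for X
    using that unfolding analytic_continuation_def
  proof (induction rule: rtranclp_induct)
    case base
    show ?case using assms by simp
  next
    case (step Y Z)
    obtain V g where Z: "Z = (V, g)" by (cases Z)
    obtain V' g' where Y: "Y = (V', g')" by (cases Y)
    from step.hyps(2) obtain W where W: "open V" "connected V" "g holomorphic_on V" "open W" "W \<noteq> {}"
      "W \<subseteq> V' \<inter> V" "\<forall>x\<in>W. g' x = g x"
      unfolding Y Z direct_continuation_def by auto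
    have "hyperlog_op ks g z = 1" if "z \<in> V" for z
    proof (rule hyperlog_op_extend[OF W(1-5) _ _ that])
      fix w assume "w \<in> W"
      then have "hyperlog_op ks g' w = hyperlog_op ks g w"
        using W(7) by (intro hyperlog_op_cong[OF W(4)]) auto
      then show "hyperlog_op ks g w = 1" using step.IH W(6) \<open>w \<in> W\<close> by (auto simp: Y)
    qed (use W in auto)
    then show ?case using W by (simp add: Z)
  qed
  from this[OF assms(1)] show ?thesis by simp
qed

section \<open>Local quotients of tame functions\<close>

abbreviation quotient_near :: "complex list \<Rightarrow> complex set \<Rightarrow> cfun \<Rightarrow> bool" where
  "quotient_near ts W f \<equiv> \<exists>U' p q. U' \<subseteq> W \<and> open U' \<and> U' \<noteq> {} \<and> tame ts U' p \<and> tame ts U' q \<and>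
     (\<forall>x\<in>U'. q x \<noteq> 0 \<and> f x = p x / q x)"

text \<open>Division is confined to this level, because monodromic relations come with sums and
  products only. Asking for a quotient inside every open \<open>W\<close> makes two functions
  compatible: the second is treated inside the open set found for the first.\<close>

definition locally_quotient :: "complex list \<Rightarrow> complex set \<Rightarrow> cfun \<Rightarrow> bool" where
  "locally_quotient ts U f \<longleftrightarrow> (\<forall>W. open W \<longrightarrow> W \<noteq> {} \<longrightarrow> W \<subseteq> U \<longrightarrow>
     (quotient_near ts W f))"

lemma locally_quotientI:
  assumes "\<And>W. open W \<Longrightarrow> W \<noteq> {} \<Longrightarrow> W \<subseteq> U \<Longrightarrow>
    quotient_near ts W f"
  shows "locally_quotient ts U f"
  unfolding locally_quotient_def using assms by simp

lemma locally_quotientE: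
  assumes "locally_quotient ts U f" "open W" "W \<noteq> {}" "W \<subseteq> U"
  obtains U' p q where "U' \<subseteq> W" "open U'" "U' \<noteq> {}" "tame ts U' p" "tame ts U' q"
    "\<forall>x\<in>U'. q x \<noteq> 0 \<and> f x = p x / q x"
proof -
  have "quotient_near ts W f"
    using assms unfolding locally_quotient_def by simp
  then show ?thesis using that by (elim exE conjE)
qed

lemma locally_quotient_tame:
  assumes ts: "ts \<noteq> []"
    and "\<And>W. open W \<Longrightarrow> W \<noteq> {} \<Longrightarrow> W \<subseteq> U \<Longrightarrow> \<exists>U'\<subseteq>W. open U' \<and> U' \<noteq> {} \<and> tame ts U' f"
  shows "locally_quotient ts U f"
proof (rule locally_quotientI)
  fix W assume "open W" "W \<noteq> {}" "W \<subseteq> U"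
  from assms(2)[OF this] obtain U' where U': "U' \<subseteq> W" "open U'" "U' \<noteq> {}" "tame ts U' f" by blast
  have "tame ts U' (\<lambda>_. 1)" by (rule tame_locally_const[OF ts]) (auto intro: zero_less_one)
  with U' show "quotient_near ts W f"
    by (intro exI[of _ U'] exI[of _ f] exI[of _ "\<lambda>_. 1"] conjI) simp_all
qed

lemma locally_quotient_binop:
  assumes f: "locally_quotient ts U f" and g: "locally_quotient ts U g"
    and r: "\<And>U p q p' q'. tame ts U p \<Longrightarrow> tame ts U q \<Longrightarrow> tame ts U p' \<Longrightarrow> tame ts U q' \<Longrightarrow>
      tame ts U (\<lambda>x. r (p x) (q x) (p' x) (q' x))"
    and op: "\<And>a b a' b'. b \<noteq> 0 \<Longrightarrow> b' \<noteq> 0 \<Longrightarrow> op (a / b) (a' / b') = r a b a' b' / (b * b')" and ts: "ts \<noteq> []"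
  shows "locally_quotient ts U (\<lambda>x. op (f x) (g x))"
proof (rule locally_quotientI)
  fix W assume W: "open W" "W \<noteq> {}" "W \<subseteq> U"
  obtain U1 p q where 1: "U1 \<subseteq> W" "open U1" "U1 \<noteq> {}" "tame ts U1 p" "tame ts U1 q"
    "\<forall>x\<in>U1. q x \<noteq> 0 \<and> f x = p x / q x" using locally_quotientE[OF f W] .
  have "U1 \<subseteq> U" using 1(1) W(3) by blast
  obtain U2 p' q' where 2: "U2 \<subseteq> U1" "open U2" "U2 \<noteq> {}" "tame ts U2 p'" "tame ts U2 q'"
    "\<forall>x\<in>U2. q' x \<noteq> 0 \<and> g x = p' x / q' x" using locally_quotientE[OF g 1(2,3) \<open>U1 \<subseteq> U\<close>] .
  note t = tame_subset[OF 1(4) 2(1)] tame_subset[OF 1(5) 2(1)]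
  have "\<forall>x\<in>U2. q x * q' x \<noteq> 0 \<and> op (f x) (g x) = r (p x) (q x) (p' x) (q' x) / (q x * q' x)"
  proof
    fix x assume "x \<in> U2"
    then have "q x \<noteq> 0" "q' x \<noteq> 0" "f x = p x / q x" "g x = p' x / q' x" using 1(6) 2(1,6) by blast+
    then show "q x * q' x \<noteq> 0 \<and> op (f x) (g x) = r (p x) (q x) (p' x) (q' x) / (q x * q' x)"
      using op by simp
  qed
  moreover have "U2 \<subseteq> W" using 1(1) 2(1) by blast
  ultimately show "quotient_near ts W (\<lambda>x. op (f x) (g x))"
    using r[OF t 2(4,5)] tame_mult[OF ts t(2) 2(5)] 2(2,3)
    by (intro exI[of _ U2] exI[of _ "\<lambda>x. r (p x) (q x) (p' x) (q' x)"] exI[of _ "\<lambda>x. q x * q' x"] conjI)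
qed

lemma locally_quotient_inverse:
  assumes g: "locally_quotient ts U g" "\<forall>\<^sub>\<approx>x\<in>U. g x \<noteq> 0"
  shows "locally_quotient ts U (\<lambda>x. 1 / g x)"
proof (rule locally_quotientI)
  fix W assume W: "open W" "W \<noteq> {}" "W \<subseteq> U"
  from cosparse_open_subset[OF g(2) this] obtain W' where W': "W' \<subseteq> W" "open W'" "W' \<noteq> {}" "\<forall>x\<in>W'. g x \<noteq> 0" by blast
  have "W' \<subseteq> U" using W'(1) W(3) by blast
  obtain U' p q where U': "U' \<subseteq> W'" "open U'" "U' \<noteq> {}" "tame ts U' p" "tame ts U' q"
    "\<forall>x\<in>U'. q x \<noteq> 0 \<and> g x = p x / q x" using locally_quotientE[OF g(1) W'(2,3) \<open>W' \<subseteq> U\<close>] .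
  have "\<forall>x\<in>U'. p x \<noteq> 0 \<and> 1 / g x = q x / p x"
  proof
    fix x assume "x \<in> U'"
    then have "g x = p x / q x" "g x \<noteq> 0" using U'(1,6) W'(4) by blast+
    then show "p x \<noteq> 0 \<and> 1 / g x = q x / p x" by auto
  qed
  moreover have "U' \<subseteq> W" using U'(1) W'(1) by blast
  ultimately show "quotient_near ts W (\<lambda>x. 1 / g x)"
    using U'(2-5) by (intro exI[of _ U'] exI[of _ q] exI[of _ p] conjI)
qed

text \<open>Meromorphy is carried through the induction for the sake of division: on a connected
  set, a meromorphic denominator that is not zero almost everywhere is nonzero almost
  everywhere.\<close>

lemma hypergeom_field_quotient:
  assumes ts: "distinct ts" "length ts \<ge> 3 * M" "M \<ge> 1" and U: "open U" "connected U"
    and "\<Phi> \<in> hypergeom_field_on M U"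
  shows "\<Phi> meromorphic_on U \<and> locally_quotient ts U \<Phi>"
proof -
  have tsne: "ts \<noteq> []" using ts by auto
  have quot_mult: "locally_quotient ts U (\<lambda>x. f x * g x)" if "locally_quotient ts U f" "locally_quotient ts U g" for f g
    by (rule locally_quotient_binop[where op = "(*)" and r = "\<lambda>a b a' b'. a * a'", OF that])
      (auto intro: tame_mult[OF tsne] simp: tsne)
  show ?thesis using assms(6)
  proof (induction rule: hypergeom_field_on.induct)
    case (algebraic g)
    then show ?case
      using locally_quotient_tame[OF tsne tame_algebraic_function[OF tsne algebraic]]
      by (simp add: algebraic_function_on_def)
  next
    case (solution a b l cs y)
    have "locally_quotient ts U y"
      by (rule locally_quotient_tame[OF tsne], rule tame_hypergeom_solution[OF ts solution(1,2,4,5,6,7)])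
    then show ?case using solution(7) by (simp add: ode_solutions_def)
  next
    case (add f g)
    have "locally_quotient ts U (\<lambda>x. f x + g x)"
      by (rule locally_quotient_binop[where op = "(+)" and r = "\<lambda>a b a' b'. a * b' + a' * b"])
        (use add in \<open>auto intro!: tame_add[OF tsne] tame_mult[OF tsne] simp: tsne add_frac_eq\<close>)
    then show ?case using add by (auto intro: meromorphic_intros)
  next
    case (diff f g)
    have "locally_quotient ts U (\<lambda>x. f x - g x)"
      by (rule locally_quotient_binop[where op = "(-)" and r = "\<lambda>a b a' b'. a * b' - a' * b"])
        (use diff in \<open>auto intro!: tame_diff[OF tsne] tame_mult[OF tsne] simp: tsne diff_frac_eq\<close>)
    then show ?case using diff by (auto intro: meromorphic_intros)
  next
    case (mult f g)
    then show ?case using quot_mult[of f g] by (auto intro: meromorphic_intros)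
  next
    case (divide f g)
    have "\<forall>\<^sub>\<approx>x\<in>U. g x \<noteq> 0"
      using meromorphic_imp_constant_or_avoid[of g U 0] divide U by blast
    then have "locally_quotient ts U (\<lambda>x. 1 / g x)" using divide.IH by (intro locally_quotient_inverse) auto
    from quot_mult[OF _ this] have "locally_quotient ts U (\<lambda>x. f x / g x)" using divide.IH by simp
    then show ?case using divide by (auto intro: meromorphic_intros)
  qed
qed

text \<open>The relation \<open>f q = p\<close> near \<open>c\<close> extends to the slit plane, and
  the loop carries it to \<open>(f + C) q = p\<close> with \<open>C \<noteq> 0\<close>. Hence
  \<open>C q = 0\<close>, although \<open>q\<close> does not vanish at \<open>c\<close>.\<close>

lemma hyperlog_not_quotient:
  assumes ks: "ks \<noteq> []" "distinct ks" "0 \<notin> set ks"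
    and U: "open U" "U \<noteq> {}" "f holomorphic_on U" "\<And>z. z \<in> U \<Longrightarrow> hyperlog_op ks f z = 1"
    and tame: "tame (map inverse ks) U p" "tame (map inverse ks) U q"
    and quot: "\<And>x. x \<in> U \<Longrightarrow> q x \<noteq> 0 \<and> f x = p x / q x"
  shows False
proof -
  let ?ts = "map inverse ks"
  obtain T1 m1 where 1: "finite T1" "set ?ts \<subseteq> T1" "m1 > 0" and p:
     "\<And>T c m. T1 \<subseteq> T \<Longrightarrow> generic_centre T c \<Longrightarrow> c \<in> U \<Longrightarrow> m1 dvd m \<Longrightarrow> m > 0 \<Longrightarrow>
        fixes_germ ?ts m T c p"
    using tame(1) unfolding tame_def by auto
  obtain T2 m2 where 2: "finite T2" "set ?ts \<subseteq> T2" "m2 > 0" and q: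
     "\<And>T c m. T2 \<subseteq> T \<Longrightarrow> generic_centre T c \<Longrightarrow> c \<in> U \<Longrightarrow> m2 dvd m \<Longrightarrow> m > 0 \<Longrightarrow>
        fixes_germ ?ts m T c q"
    using tame(2) unfolding tame_def by auto
  define T where "T = T1 \<union> T2"
  define m where "m = m1 * m2"
  have m: "m > 0" using 1 2 by (simp add: m_def)
  have "finite T" using 1 2 by (simp add: T_def)
  then obtain c where c: "c \<in> U" "generic_centre T c" using exists_generic_centre[of T U] U(1,2) by blast
  let ?D = "slit_plane T c"
  let ?A = "loop_rel ?ts m T c"
  note oD = open_slit_plane[OF c(2)]
  have cT: "c \<notin> T" using c(2) by (simp add: generic_centre_def)
  have tsT: "inverse ` set ks \<subseteq> T" using 1 by (auto simp: T_def)
  have mono: "monodromic T ?D ?A"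
    by (rule monodromic_nested_crossing[OF _ _ c(2) m]) (use ks tsT in auto)
  obtain P r1 where P: "r1 > 0" "\<forall>z\<in>ball c r1. P z = p z" "(P, P) \<in> ?A"
    using p[OF _ c(2,1), of m] m by (auto simp: T_def m_def)
  obtain Q r2 where Q: "r2 > 0" "\<forall>z\<in>ball c r2. Q z = q z" "(Q, Q) \<in> ?A"
    using q[OF _ c(2,1), of m] m by (auto simp: T_def m_def)
  have "open (U \<inter> ?D)" "c \<in> U \<inter> ?D" using oD U c centre_in_slit_plane by auto
  then obtain r3 where r3: "r3 > 0" "ball c r3 \<subseteq> U \<inter> ?D" using open_contains_ball by metis
  define r where "r = min r1 (min r2 r3)"
  have r: "r > 0" "ball c r \<subseteq> ball c r1" "ball c r \<subseteq> ball c r2" "ball c r \<subseteq> U" "ball c r \<subseteq> ?D"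
    using P Q r3 by (auto simp: r_def)
  let ?b = "ball c r"
  let ?n = "Suc (length ks)"
  have Dks: "?D \<subseteq> - inverse ` set ks" using slit_plane_subset_compl[OF cT] tsT by blast
  have hol: "hyperlog_sys ks i j holomorphic_on - T" if "i < ?n" "j < ?n" for i j
    using hyperlog_sys_holomorphic[of i ks j] that ks(3) tsT by (auto intro: holomorphic_on_subset)
  have "f \<in> sol_space ?n (hyperlog_sys ks) ?b"
    by (rule hyperlog_in_sol_space[OF open_ball _ _ ks(3)])
      (use U r Dks in \<open>auto intro: holomorphic_on_subset\<close>)
  then obtain Z where Z: "lin_sol ?n (hyperlog_sys ks) ?b Z" "\<forall>z\<in>?b. f z = Z 0 z"
    by (auto simp: sol_space_def)
  have "\<exists>Y. lin_sol ?n (hyperlog_sys ks) ?D Y \<and> (\<forall>i<?n. Y i c = Z i c)"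
    by (rule lin_sol_exists_slit_plane[OF c(2) hol centre_in_slit_plane])
  then obtain Y where Y: "lin_sol ?n (hyperlog_sys ks) ?D Y" "\<forall>i<?n. Y i c = Z i c" by blast
  have Yf: "Y 0 z = f z" if "z \<in> ?b" for z
  proof -
    have "Y 0 z = Z 0 z"
    proof (rule lin_sol_unique[OF lin_sol_subset[OF Y(1) r(5)] Z(1) open_ball connected_ball _ _ _ zero_less_Suc that])
      show "hyperlog_sys ks i j holomorphic_on ?b" if "i < ?n" "j < ?n" for i j
        using hol[OF that] by (rule holomorphic_on_subset) (use r(5) slit_plane_subset_compl[OF cT] in blast)
    qed (use r(1) Y(2) in auto)
    then show ?thesis using Z(2) that by simp
  qed
  have Yhol: "Y 0 holomorphic_on ?D" by (rule lin_sol_holomorphic[OF Y(1) zero_less_Suc oD])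
  have "hyperlog_op ks (Y 0) z = 1" if "z \<in> ?D" for z
  proof (rule hyperlog_op_extend[OF oD connected_slit_plane Yhol open_ball _ r(5) _ that])
    fix w assume w: "w \<in> ?b"
    have "hyperlog_op ks (Y 0) w = hyperlog_op ks f w" by (rule hyperlog_op_cong[OF open_ball Yf w])
    then show "hyperlog_op ks (Y 0) w = 1" using U(4) r(4) w by auto
  qed (use r(1) in auto)
  then obtain C where C: "C \<noteq> 0" "(Y 0, \<lambda>z. Y 0 z + C) \<in> ?A"
    using hyperlog_monodromy[OF ks tsT c(2) m] Yhol by blast
  have YQ: "(\<lambda>z. Y 0 z * Q z, \<lambda>z. (Y 0 z + C) * Q z) \<in> ?A" by (rule monodromic.mult[OF mono C(2) Q(3)])
  have "Y 0 z * Q z = P z" if "z \<in> ?b" for z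
  proof -
    have "P z = p z" "Q z = q z" "z \<in> U" using P(2) Q(2) r that by blast+
    then show ?thesis using Yf[OF that] quot[of z] by simp
  qed
  then have "Y 0 z * Q z = P z" if "z \<in> ?D" for z
    using analytic_continuation_open[OF open_ball oD _ connected_slit_plane r(5), of "\<lambda>z. Y 0 z * Q z" P z]
      monodromic.hol(1)[OF mono YQ] monodromic.hol(1)[OF mono P(3)] r(1) that by auto
  then have "\<forall>z\<in>?D. (Y 0 z + C) * Q z = P z" using monodromic.inject[OF mono YQ P(3)] by blast
  then have "(Y 0 c + C) * Q c = Y 0 c * Q c"
    using \<open>\<And>z. z \<in> ?D \<Longrightarrow> Y 0 z * Q z = P z\<close> centre_in_slit_plane[of c T] by simp
  then have "C * Q c = 0" by (simp add: distrib_right)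
  moreover have "Q c \<noteq> 0" using Q(1,2) quot[OF c(1)] by simp
  ultimately show False using C(1) by simp
qed

theorem corollary1:
  fixes M :: nat
  assumes "M \<ge> 1"
  shows "\<exists>F :: complex fps. G_function F \<and> \<not> in_hypergeom_field M F"
proof -
  \<comment> \<open>Positive integers as letters keep the coefficients rational with controlled
    denominators. Their number \<open>3 * M\<close> exceeds the \<open>3 * (M - 1)\<close> branch
    points that a single pullback can have.\<close>
  define ks where "ks = [1..<3 * M + 1]"
  let ?F = "hyperlog_fps ks" and ?ks = "map of_nat ks :: complex list"
  let ?N = "3 * M"
  have N: "\<forall>k\<in>set ks. k \<le> ?N" "?N \<ge> 1" using assms by (auto simp: ks_def)
  have ks: "?ks \<noteq> []" "distinct ?ks" "0 \<notin> set ?ks"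
    using assms by (auto simp: ks_def distinct_map inj_on_def simp del: upt_Suc)
  have ts: "distinct (map inverse ?ks)" "length (map inverse ?ks) \<ge> 3 * M"
    using ks(2) by (auto simp: distinct_map inj_on_def ks_def simp del: upt_Suc)
  have "\<not> in_hypergeom_field M ?F"
  proof
    assume "in_hypergeom_field M ?F"
    then obtain U f \<Phi> where U: "open U" "connected U" "U \<noteq> {}"
      and cont: "analytic_continuation (eball 0 (fps_conv_radius ?F), eval_fps ?F) (U, f)"
      and \<Phi>: "\<Phi> \<in> hypergeom_field_on M U" "\<forall>\<^sub>\<approx>x\<in>U. f x = \<Phi> x"
      unfolding in_hypergeom_field_def by blast
    let ?E = "eball (0 :: complex) (fps_conv_radius ?F)"
    have bE: "ball 0 (1 / real ?N) \<subseteq> ?E"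
    proof
      fix z :: complex assume "z \<in> ball 0 (1 / real ?N)"
      then have "ereal (norm z) < ereal (1 / real ?N)" by simp
      also note hyperlog_fps_conv_radius[OF N]
      finally show "z \<in> ?E" by simp
    qed
    have E: "open ?E" "connected ?E" "eval_fps ?F holomorphic_on ?E"
      by (auto intro!: holomorphic_intros)
    \<comment> \<open>The disc of convergence is only known to contain the disc of radius
      \<open>1 / real ?N\<close> on which the equation was verified; the identity theorem bridges
      the gap.\<close>
    have "hyperlog_op ?ks (eval_fps ?F) z = 1" if "z \<in> ?E" for z
      by (rule hyperlog_op_extend[OF E open_ball _ bE eval_hyperlog_fps[OF N] that]) (use assms in auto)
    then have f: "f holomorphic_on U" "\<And>z. z \<in> U \<Longrightarrow> hyperlog_op ?ks f z = 1"
      using hyperlog_continuation[OF cont E] by blast+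
    from cosparse_open_subset[OF \<Phi>(2) U(1,3) subset_refl] obtain W where
      W: "W \<subseteq> U" "open W" "W \<noteq> {}" "\<forall>x\<in>W. f x = \<Phi> x" by blast
    have "locally_quotient (map inverse ?ks) U \<Phi>"
      using hypergeom_field_quotient[OF ts assms U(1,2) \<Phi>(1)] by blast
    from locally_quotientE[OF this W(2,3,1)] obtain U' p q where
      U': "U' \<subseteq> W" "open U'" "U' \<noteq> {}" "tame (map inverse ?ks) U' p" "tame (map inverse ?ks) U' q"
      "\<forall>x\<in>U'. q x \<noteq> 0 \<and> \<Phi> x = p x / q x" .
    have "U' \<subseteq> U" using U'(1) W(1) by blast
    show False
      by (rule hyperlog_not_quotient[OF ks U'(2,3) holomorphic_on_subset[OF f(1) \<open>U' \<subseteq> U\<close>] f(2) U'(4,5)])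
        (use \<open>U' \<subseteq> U\<close> U' W(4) in auto)
  qed
  then show ?thesis using G_function_hyperlog[OF N] by blast
qed

end
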